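(* Let $\mathcal{C}\subset\mathbb{R}^d$ be a bounded convex set with $C^1$ boundary and nonempty interior, let $\epsilon>0$, and let $\rho^*=e^{-U}$ with $U:\mathcal{C}\to\mathbb{R}$ satisfying: $\nabla U$ is $C_1$-Lipschitz on $\mathcal{C}$ for some $C_1>0$, and there are $x_0\in\mathcal{C}$ and constants $C_0,C_2>0$ with $|U(x_0)|\le C_0$ and $\|\nabla U(x_0)\|_2\le C_2$. Let $$F^\epsilon[\rho]=\int_{\mathcal{C}}\left(U(x)+\ln\left((\varphi_\epsilon*\rho)(x)\right)\right)d\rho(x),\qquad \varphi_\epsilon(x)=\exp\left(-\tfrac{\|x\|_2^2}{2\epsilon}\right),\qquad \rho\in\mathcal{P}_2(\mathcal{C}).$$ Then $F^\epsilon$ is both L-differentiable and Wasserstein differentiable on $\mathcal{P}_2(\mathcal{C})$, and the two gradients coincide: $$\nabla_W F^\epsilon[\rho]=\partial_\rho F^\epsilon[\rho]=\nabla\frac{\delta F^\epsilon}{\delta\rho}\Big|_\rho\qquad\text{for all }\rho\in\mathcal{P}_2(\mathcal{C}).$$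
   Context: $\mathcal{P}_2(\mathcal{C})$ is the set of probability measures on $\mathcal{C}$ with finite second moment, with the Wasserstein-2 distance $W_2$; $(\varphi_\epsilon*\rho)(x)=\int_{\mathcal{C}}\varphi_\epsilon(x-z)\,d\rho(z)$. First variation: $\frac{\delta F}{\delta\rho}\big|_\rho:\mathcal{C}\to\mathbb{R}\cup\{\infty\}$ is the first variation of $F$ at $\rho$ if for all $\nu$ with $F[\nu]<\infty$, $\int\frac{\delta F}{\delta\rho}\big|_\rho\,d(\nu-\rho)=\frac{d}{d\epsilon'}F[(1-\epsilon')\rho+\epsilon'\nu]\big|_{\epsilon'=0}$ (derivative from the right). It is determined up to an additive constant; for $F^\epsilon$ it is $\frac{\delta F^\epsilon}{\delta\rho}\big|_\rho(x)=U(x)+\int_{\mathcal{C}}\frac{\varphi_\epsilon(x-z)}{\int_{\mathcal{C}}\varphi_\epsilon(z-w)d\rho(w)}d\rho(z)+\ln\left(\int_{\mathcal{C}}\varphi_\epsilon(x-z)d\rho(z)\right)$. Wasserstein differentiability: $\xi\in L^2(\rho;\mathbb{R}^d)$ is a Wasserstein gradient of $F$ at $\rho$ if for all $\nu$ with $F[\nu]<\infty$, $F[\nu]=F[\rho]+\int\langle\xi(x),y-x\rangle d\pi(x,y)+o(W_2(\rho,\nu))$ for some $\pi\in\Pi_o(\rho,\nu)$, the set of optimal transport plans (quadratic cost). The collection of such $\xi$ is denoted $\nabla_W F[\rho]$, and $F$ is Wasserstein differentiable at $\rho$ if it is nonempty; writing $\nabla_WF[\rho]=\xi$ for a vector field $\xi$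 means that $\xi$ is a Wasserstein gradient of $F$ at $\rho$. L-differentiability: let $\nu$ be an atomless probability measure on a Polish space and $L^2(\nu;\mathcal{C})$ the set of square-integrable maps with values in $\mathcal{C}$ (a subset of $L^2(\nu;\mathbb{R}^d)$). The lift of $F$ is $\tilde F(X)=F[X_\#\nu]$, $X\in L^2(\nu;\mathcal{C})$. $F$ is L-differentiable at $\rho$ if there is $X$ with $X_\#\nu=\rho$ such that $\tilde F$ is Fréchet differentiable at $X$ (as a function on $L^2(\nu;\mathcal{C})$), with derivative $D\tilde F(X)\in L^2(\nu;\mathbb{R}^d)$. In that case (known fact) $\tilde F$ is Fréchet differentiable at every $X$ with $X_\#\nu=\rho$ and there is a measurable $\xi:\mathcal{C}\to\mathbb{R}^d$ with $D\tilde F(X)(z)=\xi(X(z))$ a.s. for all such $X$; one sets $\partial_\rho F[\rho]=\xi$.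
   Formalization: The set C is additionally assumed to be Borel; without this, for C an open disk plus a non-measurable (Bernstein) part of its boundary circle, some probability measure on C is the law of no C-valued map, so L-differentiability fails. *)

theory Defs
  imports "HOL-Probability.Probability"
begin

section \<open>Domains with continuously differentiable boundary\<close>

text \<open>
  Near each boundary point the set is the sublevel set of a continuously differentiable function
  without critical points. Interior and frontier are used, so nothing is said about which
  boundary points belong to \<open>C\<close>.
\<close>

definition C1_boundary :: "'a::euclidean_space set \<Rightarrow> bool" where
  "C1_boundary C \<longleftrightarrow>
     (\<forall>p\<in>frontier C. \<exists>V (g :: 'a \<Rightarrow> real) (Dg :: 'a \<Rightarrow> 'a).
        open V \<and> p \<in> V \<and>
        (\<forall>x\<in>V. (g has_derivative (\<lambda>h. Dg x \<bullet> h)) (at x)) \<and>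
        continuous_on V Dg \<and> (\<forall>x\<in>V. Dg x \<noteq> 0) \<and>
        interior C \<inter> V = {x \<in> V. g x < 0} \<and>
        frontier C \<inter> V = {x \<in> V. g x = 0})"

text \<open>
  At boundary points belonging to \<open>C\<close> the gradient is the derivative relative to \<open>C\<close>; it is
  unique when \<open>C\<close> is convex with nonempty interior.
\<close>

definition is_gradient_on :: "'a::euclidean_space set \<Rightarrow> ('a \<Rightarrow> real) \<Rightarrow> ('a \<Rightarrow> 'a) \<Rightarrow> bool" where
  "is_gradient_on C f \<xi> \<longleftrightarrow>
     (\<forall>x\<in>C. (f has_derivative (\<lambda>h. \<xi> x \<bullet> h)) (at x within C))"

section \<open>Wasserstein space\<close>

text \<open>Measures on \<open>C\<close> are measures on the trace of the Borel sets, so their space is \<open>C\<close> itself.\<close>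

abbreviation borel_on :: "'a::euclidean_space set \<Rightarrow> 'a measure" where
  "borel_on C \<equiv> restrict_space borel C"

definition P2 :: "'a::euclidean_space set \<Rightarrow> 'a measure set" where
  "P2 C = {\<rho>. prob_space \<rho> \<and> sets \<rho> = sets (borel_on C) \<and> integrable \<rho> (\<lambda>x. (norm x)\<^sup>2)}"

definition couplings ::
    "'a::euclidean_space set \<Rightarrow> 'a measure \<Rightarrow> 'a measure \<Rightarrow> ('a \<times> 'a) measure set" where
  "couplings C \<rho> \<nu> =
     {\<pi>. sets \<pi> = sets (borel_on C \<Otimes>\<^sub>M borel_on C) \<and>
         distr \<pi> (borel_on C) fst = \<rho> \<and> distr \<pi> (borel_on C) snd = \<nu>}"

definition transport_cost :: "('a::euclidean_space \<times> 'a) measure \<Rightarrow> ennreal" where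
  "transport_cost \<pi> = (\<integral>\<^sup>+p. ennreal ((norm (fst p - snd p))\<^sup>2) \<partial>\<pi>)"

definition optimal_plans ::
    "'a::euclidean_space set \<Rightarrow> 'a measure \<Rightarrow> 'a measure \<Rightarrow> ('a \<times> 'a) measure set" where
  "optimal_plans C \<rho> \<nu> =
     {\<pi> \<in> couplings C \<rho> \<nu>. \<forall>\<pi>'\<in>couplings C \<rho> \<nu>. transport_cost \<pi> \<le> transport_cost \<pi>'}"

definition W2 :: "'a::euclidean_space set \<Rightarrow> 'a measure \<Rightarrow> 'a measure \<Rightarrow> real" where
  "W2 C \<rho> \<nu> = sqrt (enn2real (INF \<pi>\<in>couplings C \<rho> \<nu>. transport_cost \<pi>))"

section \<open>First variation\<close>

text \<open>The convex combination \<open>(1 - t) \<rho> + t \<nu>\<close>, for \<open>\<rho>\<close> and \<open>\<nu>\<close> on the same measurable space.\<close>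

definition mix :: "real \<Rightarrow> 'a measure \<Rightarrow> 'a measure \<Rightarrow> 'a measure" where
  "mix t \<rho> \<nu> = measure_of (space \<rho>) (sets \<rho>)
     (\<lambda>A. ennreal (1 - t) * emeasure \<rho> A + ennreal t * emeasure \<nu> A)"

definition ext_integrable :: "'a measure \<Rightarrow> ('a \<Rightarrow> ereal) \<Rightarrow> bool" where
  "ext_integrable M g \<longleftrightarrow>
     (AE x in M. \<bar>g x\<bar> \<noteq> \<infinity>) \<and> integrable M (\<lambda>x. real_of_ereal (g x))"

text \<open>
  As \<open>real_of_ereal \<infinity> = 0\<close>, the finiteness of \<open>F \<rho>\<close> and the almost everywhere finiteness
  of \<open>g\<close> are required explicitly here and below.
\<close>

definition is_first_variation ::
    "'a::euclidean_space set \<Rightarrow> ('a measure \<Rightarrow> ereal) \<Rightarrow> 'a measure \<Rightarrow> ('a \<Rightarrow> ereal) \<Rightarrow> bool" where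
  "is_first_variation C F \<rho> g \<longleftrightarrow>
     \<bar>F \<rho>\<bar> \<noteq> \<infinity> \<and> (\<forall>x\<in>C. g x \<noteq> -\<infinity>) \<and> ext_integrable \<rho> g \<and>
     (\<forall>\<nu>\<in>P2 C. F \<nu> < \<infinity> \<longrightarrow>
        ext_integrable \<nu> g \<and>
        ((\<lambda>t. (F (mix t \<rho> \<nu>) - F \<rho>) / ereal t) \<longlongrightarrow>
           ereal ((\<integral>x. real_of_ereal (g x) \<partial>\<nu>) - (\<integral>x. real_of_ereal (g x) \<partial>\<rho>))) (at_right 0))"

section \<open>Wasserstein differentiability\<close>

text \<open>
  Square-integrable maps are represented by everywhere defined functions with all values in \<open>C\<close>,
  rather than by classes modulo null sets.
\<close>

definition L2_space :: "'b measure \<Rightarrow> 'a::euclidean_space set \<Rightarrow> ('b \<Rightarrow> 'a) set" where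
  "L2_space M C = {X \<in> M \<rightarrow>\<^sub>M borel_on C. integrable M (\<lambda>z. (norm (X z))\<^sup>2)}"

definition L2_dist :: "'b measure \<Rightarrow> ('b \<Rightarrow> 'a::euclidean_space) \<Rightarrow> ('b \<Rightarrow> 'a) \<Rightarrow> real" where
  "L2_dist M X Y = sqrt (\<integral>z. (norm (X z - Y z))\<^sup>2 \<partial>M)"

text \<open>
  The function \<open>plan\<close> picks the optimal plan used in the expansion at each \<open>\<nu>\<close>; the little-o is
  uniform in \<open>\<nu>\<close> as \<open>W2 C \<rho> \<nu>\<close> tends to zero.
\<close>

definition wasserstein_gradients ::
    "'a::euclidean_space set \<Rightarrow> ('a measure \<Rightarrow> ereal) \<Rightarrow> 'a measure \<Rightarrow> ('a \<Rightarrow> 'a) set" where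
  "wasserstein_gradients C F \<rho> =
     {\<xi> \<in> L2_space \<rho> UNIV. \<bar>F \<rho>\<bar> \<noteq> \<infinity> \<and>
       (\<exists>plan :: 'a measure \<Rightarrow> ('a \<times> 'a) measure.
          (\<forall>\<nu>\<in>P2 C. F \<nu> < \<infinity> \<longrightarrow> plan \<nu> \<in> optimal_plans C \<rho> \<nu>) \<and>
          (\<forall>e>0. \<exists>\<delta>>0. \<forall>\<nu>\<in>P2 C. F \<nu> < \<infinity> \<and> W2 C \<rho> \<nu> < \<delta> \<longrightarrow>
             \<bar>F \<nu> - F \<rho> - ereal (\<integral>p. \<xi> (fst p) \<bullet> (snd p - fst p) \<partial>(plan \<nu>))\<bar>
               \<le> ereal (e * W2 C \<rho> \<nu>)))}"

definition wasserstein_differentiable ::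
    "'a::euclidean_space set \<Rightarrow> ('a measure \<Rightarrow> ereal) \<Rightarrow> 'a measure \<Rightarrow> bool" where
  "wasserstein_differentiable C F \<rho> \<longleftrightarrow> wasserstein_gradients C F \<rho> \<noteq> {}"

section \<open>L-differentiability\<close>

definition atomless :: "'b measure \<Rightarrow> bool" where
  "atomless M \<longleftrightarrow>
     (\<forall>A\<in>sets M. 0 < emeasure M A \<longrightarrow>
        (\<exists>B\<in>sets M. B \<subseteq> A \<and> 0 < emeasure M B \<and> emeasure M B < emeasure M A))"

definition lift ::
    "'a::euclidean_space set \<Rightarrow> 'b measure \<Rightarrow> ('a measure \<Rightarrow> ereal) \<Rightarrow> ('b \<Rightarrow> 'a) \<Rightarrow> ereal" where
  "lift C M F X = F (distr M (borel_on C) X)"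

text \<open>The derivative \<open>D\<close> is the Riesz representative; increments stay inside \<open>L2_space M C\<close>.\<close>

definition has_frechet_derivative_L2 ::
    "'a::euclidean_space set \<Rightarrow> 'b measure \<Rightarrow> (('b \<Rightarrow> 'a) \<Rightarrow> ereal) \<Rightarrow> ('b \<Rightarrow> 'a) \<Rightarrow> ('b \<Rightarrow> 'a) \<Rightarrow> bool"
  where
  "has_frechet_derivative_L2 C M \<Phi> D X \<longleftrightarrow>
     X \<in> L2_space M C \<and> D \<in> L2_space M UNIV \<and> \<bar>\<Phi> X\<bar> \<noteq> \<infinity> \<and>
     (\<forall>e>0. \<exists>\<delta>>0. \<forall>Y\<in>L2_space M C. L2_dist M Y X < \<delta> \<longrightarrow>
        \<bar>\<Phi> Y - \<Phi> X - ereal (\<integral>z. D z \<bullet> (Y z - X z) \<partial>M)\<bar> \<le> ereal (e * L2_dist M Y X))"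

definition L_differentiable ::
    "'a::euclidean_space set \<Rightarrow> 'b measure \<Rightarrow> ('a measure \<Rightarrow> ereal) \<Rightarrow> 'a measure \<Rightarrow> bool" where
  "L_differentiable C M F \<rho> \<longleftrightarrow>
     (\<exists>X\<in>L2_space M C. distr M (borel_on C) X = \<rho> \<and>
        (\<exists>D. has_frechet_derivative_L2 C M (lift C M F) D X))"

definition is_L_derivative ::
    "'a::euclidean_space set \<Rightarrow> 'b measure \<Rightarrow> ('a measure \<Rightarrow> ereal) \<Rightarrow> 'a measure \<Rightarrow> ('a \<Rightarrow> 'a) \<Rightarrow> bool"
  where
  "is_L_derivative C M F \<rho> \<xi> \<longleftrightarrow>
     L_differentiable C M F \<rho> \<and> \<xi> \<in> borel_measurable (borel_on C) \<and>
     (\<forall>X\<in>L2_space M C. distr M (borel_on C) X = \<rho> \<longrightarrow>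
        has_frechet_derivative_L2 C M (lift C M F) (\<lambda>z. \<xi> (X z)) X)"

section \<open>The regularized energy\<close>

definition gauss_kernel :: "real \<Rightarrow> 'a::euclidean_space \<Rightarrow> real" where
  "gauss_kernel \<epsilon> x = exp (- ((norm x)\<^sup>2 / (2 * \<epsilon>)))"

definition gauss_conv :: "real \<Rightarrow> 'a::euclidean_space measure \<Rightarrow> 'a \<Rightarrow> real" where
  "gauss_conv \<epsilon> \<rho> x = (\<integral>z. gauss_kernel \<epsilon> (x - z) \<partial>\<rho>)"

text \<open>
  The value \<open>\<infinity>\<close> marks non-integrability of the integrand, which Bochner integration
  would otherwise silently turn into \<open>0\<close>.
\<close>

definition reg_energy :: "('a::euclidean_space \<Rightarrow> real) \<Rightarrow> real \<Rightarrow> 'a measure \<Rightarrow> ereal" where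
  "reg_energy U \<epsilon> \<rho> =
     (if integrable \<rho> (\<lambda>x. U x + ln (gauss_conv \<epsilon> \<rho> x))
      then ereal (\<integral>x. U x + ln (gauss_conv \<epsilon> \<rho> x) \<partial>\<rho>) else \<infinity>)"

definition reg_energy_variation ::
    "('a::euclidean_space \<Rightarrow> real) \<Rightarrow> real \<Rightarrow> 'a measure \<Rightarrow> 'a \<Rightarrow> real" where
  "reg_energy_variation U \<epsilon> \<rho> x =
     U x + (\<integral>z. gauss_kernel \<epsilon> (x - z) / gauss_conv \<epsilon> \<rho> z \<partial>\<rho>) + ln (gauss_conv \<epsilon> \<rho> x)"

end

theory Submission
  imports Defs
begin

text \<open>
  For a probability space with maps \<open>X, Y\<close> into \<open>C\<close>, a pointwise Taylor expansion of \<open>U\<close>, of the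
  Gaussian kernel and of the logarithm gives
  \<open>F (law Y) = F (law X) + E \<langle>\<xi> (X), Y - X\<rangle> + O (E |Y - X|\<^sup>2)\<close>, where \<open>\<xi>\<close> is the gradient of the
  first variation at the law of \<open>X\<close>; the two terms of \<open>\<xi>\<close> that come from the entropy are exchanged
  into this form by Fubini's theorem and the oddness of the gradient of the kernel. On an optimal plan
  with \<open>X, Y\<close> the projections this is Wasserstein differentiability; on the reference space it is
  Frechet differentiability of the lift.

  Optimal plans exist by weak compactness, which reduces to Helly's theorem on the line because a
  space-filling curve onto a bounded box has a measurable section. The same section, with the
  quantile transform, realises every law on \<open>C\<close> on an atomless space.
\<close>

section \<open>Weak sequential compactness\<close>

text \<open>Two features of \<open>C\<close> shape the argument. It need not be closed, so weak
  compactness alone places a limit of plans only near the closure of \<open>C \<times> C\<close>;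
  that the limit charges nothing outside \<open>C \<times> C\<close> comes from its marginals, which
  are exactly \<rho> and \<nu>. And it is bounded, so the kernel stays above a constant
  \<open>m > 0\<close> on differences of points of \<open>C\<close>; the convolutions then lie in
  \<open>[m, 1]\<close>, where logarithm and reciprocal are under control. The law enters the
  logarithmic term twice, as the measure integrated against and inside the convolution. Over two
  independent copies of the probability space its first-order change contains \<open>Y - X\<close>
  at both copies, which is why the gradient has two nonlocal terms. Every remainder is at most a
  constant built from \<epsilon>, \<open>m\<close> and the Lipschitz constant of the gradient of
  \<open>U\<close>, times the mean square displacement, so both little-o statements follow from one
  quadratic inequality.\<close>

lemma binary_expansion_exists:
  fixes x :: real
  assumes "0 \<le> x" "x \<le> 1"
  obtains a :: "nat \<Rightarrow> real"
  where "\<And>k. a k \<in> {0, 1}" "(\<lambda>k. a k * (1/2) ^ Suc k) sums x"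
proof -
  \<comment> \<open>Greedy digits: \<open>r k\<close> is what remains of \<open>x\<close> after
    \<open>k\<close> digits, multiplied by \<open>2 ^ k\<close>. The closed test
    \<open>1/2 \<le> y\<close> keeps \<open>r k\<close> in \<open>[0, 1]\<close>, and
    \<open>x = 1\<close> gets the expansion with all digits 1.\<close>
  define r where "r = rec_nat x (\<lambda>_ y. if 1/2 \<le> y then 2 * y - 1 else 2 * y)"
  define a where "a k = (if 1/2 \<le> r k then 1 else 0 :: real)" for k
  have r_Suc: "r (Suc k) = 2 * r k - a k" for k
    by (simp add: r_def a_def)
  have r01: "0 \<le> r k \<and> r k \<le> 1" for k
  proof (induction k)
    case 0
    then show ?case using assms by (simp add: r_def)
  next
    case (Suc k)
    then show ?case unfolding r_Suc by (auto simp: a_def)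
  qed
  have partial: "(\<Sum>j<k. a j * (1/2) ^ Suc j) = x - r k * (1/2) ^ k" for k
  proof (induction k)
    case 0
    then show ?case by (simp add: r_def)
  next
    case (Suc k)
    then show ?case by (simp add: r_Suc field_simps)
  qed
  have "(\<lambda>k. r k * (1/2) ^ k) \<longlonglongrightarrow> 0"
  proof (rule Lim_null_comparison)
    show "\<forall>\<^sub>F k in sequentially. norm (r k * (1/2) ^ k) \<le> (1/2 :: real) ^ k"
      using r01 by (intro always_eventually) (auto simp: abs_mult intro!: mult_left_le_one_le)
  qed (intro LIMSEQ_power_zero, simp)
  then have "(\<lambda>k. x - r k * (1/2) ^ k) \<longlonglongrightarrow> x - 0"
    by (intro tendsto_intros)
  then have "(\<lambda>k. a k * (1/2) ^ Suc k) sums x"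
    unfolding sums_def partial by simp
  then show ?thesis
    by (intro that[of a]) (auto simp: a_def)
qed

section \<open>Schoenberg's space-filling curve\<close>

text \<open>A continuous even function of period 2 that is 0 on \<open>[0, 1/3]\<close> and 1 on
  \<open>[2/3, 1]\<close>; a truncated cosine takes the place of the usual piecewise linear
  profile.\<close>

definition schoenberg_step :: "real \<Rightarrow> real" where
  "schoenberg_step t = max 0 (min 1 (1/2 - cos (pi * t)))"

lemma schoenberg_step_bounds: "0 \<le> schoenberg_step t" "schoenberg_step t \<le> 1"
  by (auto simp: schoenberg_step_def)

lemma continuous_on_schoenberg_step [continuous_intros]:
  fixes f :: "'a::t2_space \<Rightarrow> real"
  shows "continuous_on A f \<Longrightarrow> continuous_on A (\<lambda>t. schoenberg_step (f t))"
  unfolding schoenberg_step_def by (intro continuous_intros)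

text \<open>Period 2 removes \<open>m\<close>, and \<open>2 * a / 3 + u\<close> lies on one of the
  two flat pieces of the profile. The slack \<open>u\<close> leaves room for the tail of a Cantor
  expansion.\<close>

lemma schoenberg_step_eq:
  assumes "a \<in> {0, 1}" "0 \<le> u" "u \<le> 1/3"
  shows "schoenberg_step (2 * of_int m + 2 * a / 3 + u) = a"
proof -
  have cos_ge: "1/2 \<le> cos (pi * v)" if "0 \<le> v" "v \<le> 1/3" for v :: real
  proof -
    have "cos (pi / 3) \<le> cos (pi * v)"
      using that by (intro cos_monotone_0_pi_le) (auto simp: field_simps)
    then show ?thesis by (simp add: cos_60)
  qed
  have "cos (pi * (2 * of_int m + 2 * a / 3 + u)) = cos (pi * (2 * a / 3 + u))"
    using cos_add[of "pi * (2 * a / 3 + u)" "2 * pi * of_int m"]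
      cos_int_2pin[of m] sin_int_2pin[of m]
    by (simp add: algebra_simps)
  moreover consider "a = 0" | "a = 1"
    using assms by auto
  then have "schoenberg_step (2 * a / 3 + u) = a"
  proof cases
    case 1
    then show ?thesis using cos_ge[of u] assms by (auto simp: schoenberg_step_def)
  next
    case 2
    \<comment> \<open>Reflecting the argument \<open>t\<close> to \<open>1 - t\<close> flips the
      sign of the cosine, so the second plateau reduces to the first.\<close>
    have "cos (pi * (2/3 + u)) = - cos (pi * (1/3 - u))"
      using cos_pi_minus[of "pi * (1/3 - u)"] by (simp add: algebra_simps)
    with cos_ge[of "1/3 - u"] assms 2 show ?thesis
      by (auto simp: schoenberg_step_def)
  qed
  ultimately show ?thesis
    by (simp add: schoenberg_step_def)
qed

text \<open>
  Multiplying the Cantor expansion by \<open>3 ^ k\<close> moves the digit \<open>a k\<close> into first place, up to an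
  even integer, where \<open>schoenberg_step\<close> reads it off.
\<close>

lemma schoenberg_step_cantor:
  fixes a :: "nat \<Rightarrow> real"
  assumes a: "\<And>k. a k \<in> {0, 1}"
  defines "t \<equiv> (\<Sum>k. 2 * a k / 3 ^ Suc k)"
  shows "schoenberg_step (3 ^ k * t) = a k" "0 \<le> t" "t \<le> 1"
proof -
  have a01: "0 \<le> a k" "a k \<le> 1" for k
    using a[of k] by auto
  have geo: "(\<lambda>j. 2 / 3 ^ Suc j :: real) sums 1"
    using sums_mult[OF geometric_sums[of "1/3::real"], of "2/3"]
    by (simp add: power_one_over divide_simps)
  have sm: "summable (\<lambda>j. 2 * a (j + k) / 3 ^ Suc j)" for k
    using a01 by (intro summable_comparison_test_ev[OF _ sums_summable[OF geo]] always_eventually)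
      (auto simp: divide_simps)
  have bnd: "0 \<le> (\<Sum>j. 2 * a (j + k) / 3 ^ Suc j)" "(\<Sum>j. 2 * a (j + k) / 3 ^ Suc j) \<le> 1" for k
  proof -
    show "0 \<le> (\<Sum>j. 2 * a (j + k) / 3 ^ Suc j)"
      using a01 by (intro suminf_nonneg sm) auto
    have "(\<Sum>j. 2 * a (j + k) / 3 ^ Suc j) \<le> (\<Sum>j. 2 / 3 ^ Suc j)"
      using a01 by (intro suminf_le sm sums_summable[OF geo]) (auto simp: divide_simps)
    then show "(\<Sum>j. 2 * a (j + k) / 3 ^ Suc j) \<le> 1"
      using sums_unique[OF geo] by simp
  qed
  from bnd[of 0] show "0 \<le> t" "t \<le> 1"
    by (auto simp: t_def)
  have shift: "(\<Sum>j. 2 * a (j + k) / 3 ^ Suc j)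
      = 2 * a k / 3 + (\<Sum>j. 2 * a (j + Suc k) / 3 ^ Suc j) / 3" for k
    using suminf_split_head[OF sm[of k]] suminf_divide[OF sm[of "Suc k"], of 3]
    by (simp add: mult.commute)
  have "\<exists>m::int. 3 ^ k * t = 2 * of_int m + (\<Sum>j. 2 * a (j + k) / 3 ^ Suc j)"
  proof (induction k)
    case 0
    show ?case by (intro exI[of _ 0]) (simp add: t_def)
  next
    case (Suc k)
    then obtain m :: int
      where m: "3 ^ k * t = 2 * of_int m + (\<Sum>j. 2 * a (j + k) / 3 ^ Suc j)" by blast
    \<comment> \<open>The digit is an integer, so multiplication by 3 turns
      \<open>2 * a k / 3\<close> into the even integer \<open>2 * i\<close>, which joins the even
      part already split off.\<close>
    obtain i :: int where i: "a k = of_int i"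
      using a[of k] by (metis insert_iff of_int_0 of_int_1 singletonD)
    have "3 ^ Suc k * t = 3 * (3 ^ k * t)" by simp
    also have "\<dots> = 2 * of_int (3 * m + i) + (\<Sum>j. 2 * a (j + Suc k) / 3 ^ Suc j)"
      unfolding m shift[of k] using i by (simp add: algebra_simps)
    finally show ?case by blast
  qed
  then obtain m :: int
    where "3 ^ k * t = 2 * of_int m + (\<Sum>j. 2 * a (j + k) / 3 ^ Suc j)" by blast
  then have "3 ^ k * t = 2 * of_int m + 2 * a k / 3 + (\<Sum>j. 2 * a (j + Suc k) / 3 ^ Suc j) / 3"
    unfolding shift[of k] by simp
  then show "schoenberg_step (3 ^ k * t) = a k"
    using schoenberg_step_eq[OF a[of k], of "(\<Sum>j. 2 * a (j + Suc k) / 3 ^ Suc j) / 3" m]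
      bnd[of "Suc k"] by simp
qed

text \<open>For \<open>i < n\<close> and \<open>t\<close> in the Cantor set this is the binary
  number formed by the digits of \<open>t\<close> at the positions congruent to \<open>i\<close>
  modulo \<open>n\<close>, so that one parameter carries \<open>n\<close> coordinates.\<close>

definition schoenberg_coord :: "nat \<Rightarrow> nat \<Rightarrow> real \<Rightarrow> real" where
  "schoenberg_coord n i t = (\<Sum>k. schoenberg_step (3 ^ (n * k + i) * t) * (1/2) ^ Suc k)"

lemma half_power_sums: "(\<lambda>k. (1/2 :: real) ^ Suc k) sums 1"
  using power_half_series by simp

lemma continuous_on_schoenberg_coord: "continuous_on UNIV (schoenberg_coord n i)"
proof -
  have "uniform_limit UNIV (\<lambda>m t. \<Sum>k<m. schoenberg_step (3 ^ (n * k + i) * t) * (1/2) ^ Suc k)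
      (\<lambda>t. \<Sum>k. schoenberg_step (3 ^ (n * k + i) * t) * (1/2) ^ Suc k) sequentially"
    using schoenberg_step_bounds
    by (intro Weierstrass_m_test[OF _ sums_summable[OF half_power_sums]])
       (auto simp: abs_mult intro!: mult_left_le_one_le)
  then show ?thesis
    unfolding schoenberg_coord_def
    by (rule uniform_limit_theorem[rotated])
       (auto intro!: always_eventually continuous_intros)
qed

lemma schoenberg_coord_bounds: "0 \<le> schoenberg_coord n i t" "schoenberg_coord n i t \<le> 1"
proof -
  have le: "schoenberg_step s * (1/2) ^ Suc k \<le> (1/2) ^ Suc k" for s k
    using schoenberg_step_bounds[of s] by (intro mult_left_le_one_le) auto
  have sm: "summable (\<lambda>k. schoenberg_step (3 ^ (n * k + i) * t) * (1/2) ^ Suc k)"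
    using schoenberg_step_bounds le
    by (intro summable_comparison_test_ev[OF _ sums_summable[OF half_power_sums]] always_eventually)
       (auto simp: abs_mult)
  show "0 \<le> schoenberg_coord n i t"
    unfolding schoenberg_coord_def using schoenberg_step_bounds by (intro suminf_nonneg sm) auto
  show "schoenberg_coord n i t \<le> 1"
    unfolding schoenberg_coord_def using suminf_le[OF le sm sums_summable[OF half_power_sums]]
      sums_unique[OF half_power_sums] by simp
qed

lemma schoenberg_coord_surj:
  fixes x :: "nat \<Rightarrow> real"
  assumes "\<And>i. i < n \<Longrightarrow> 0 \<le> x i \<and> x i \<le> 1"
  obtains t where "0 \<le> t" "t \<le> 1" "\<And>i. i < n \<Longrightarrow> schoenberg_coord n i t = x i"
proof -
  have "\<exists>a. i < n \<longrightarrow> (\<forall>k. a k \<in> {0, 1::real}) \<and> (\<lambda>k. a k * (1/2) ^ Suc k) sums x i" for i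
  proof (cases "i < n")
    case True
    with assms[OF this] show ?thesis
      by (elim conjE) (rule binary_expansion_exists[of "x i"], auto)
  qed auto
  then obtain a where "\<forall>i. i < n \<longrightarrow>
      (\<forall>k. a i k \<in> {0, 1::real}) \<and> (\<lambda>k. a i k * (1/2) ^ Suc k) sums x i"
    using choice[of "\<lambda>i a. i < n \<longrightarrow>
      (\<forall>k. a k \<in> {0, 1::real}) \<and> (\<lambda>k. a k * (1/2) ^ Suc k) sums x i"] by blast
  then have a: "\<And>i k. i < n \<Longrightarrow> a i k \<in> {0, 1::real}"
      and sums: "\<And>i. i < n \<Longrightarrow> (\<lambda>k. a i k * (1/2) ^ Suc k) sums x i"
    by blast+
  \<comment> \<open>The binary digits of all coordinates are interleaved into one sequence. For
    \<open>n = 0\<close> nothing is known about \<open>a\<close>, and the default 0 keeps the digits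
    in \<open>{0, 1}\<close>.\<close>
  define c where "c j = (if n = 0 then 0 else a (j mod n) (j div n))" for j
  have c: "c j \<in> {0, 1}" for j
    using a[of "j mod n" "j div n"] by (auto simp: c_def)
  define t where "t = (\<Sum>k. 2 * c k / 3 ^ Suc k)"
  note t = schoenberg_step_cantor[of c, OF c, folded t_def]
  have "schoenberg_coord n i t = x i" if "i < n" for i
  proof -
    have "c (n * k + i) = a i k" for k
      using that by (auto simp: c_def)
    then have "schoenberg_coord n i t = (\<Sum>k. a i k * (1/2) ^ Suc k)"
      unfolding schoenberg_coord_def t(1) by simp
    then show ?thesis using sums[OF that] by (simp add: sums_iff)
  qed
  with t that show ?thesis by blast
qed

text \<open>The coordinates are rescaled from \<open>[0, 1]\<close> to \<open>[-B, B]\<close>, one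
  for each basis vector. Boundedness is stated for the range over the whole line, because the weak
  limits taken later are laws on the line and test functions are composed with \<open>\<phi>\<close>
  there.\<close>

lemma space_filling_curve_exists:
  fixes K :: "'c::euclidean_space set"
  assumes "bounded K"
  obtains \<phi> :: "real \<Rightarrow> 'c"
  where "continuous_on UNIV \<phi>" "bounded (range \<phi>)" "K \<subseteq> \<phi> ` {0..1}"
proof -
  obtain B where B: "\<And>x. x \<in> K \<Longrightarrow> norm x \<le> B" "B > 0"
    using assms by (auto simp: bounded_pos)
  obtain idx where idx: "bij_betw idx (Basis :: 'c set) {..<DIM('c)}"
    using ex_bij_betw_finite_nat[OF finite_Basis, where 'a1='c] by (auto simp: atLeast0LessThan)
  define \<phi> :: "real \<Rightarrow> 'c"
    where "\<phi> t = (\<Sum>b\<in>Basis. (B * (2 * schoenberg_coord DIM('c) (idx b) t - 1)) *\<^sub>R b)" for t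
  have inner: "\<phi> t \<bullet> b = B * (2 * schoenberg_coord DIM('c) (idx b) t - 1)" if "b \<in> Basis" for t b
    using that by (simp add: \<phi>_def)
  show ?thesis
  proof (rule that[of \<phi>])
    show "continuous_on UNIV \<phi>"
      unfolding \<phi>_def
      by (intro continuous_intros continuous_on_compose2[OF continuous_on_schoenberg_coord]) auto
    have "norm (\<phi> t) \<le> (\<Sum>b\<in>(Basis::'c set). B)" for t
    proof (rule order_trans[OF norm_le_l1], rule sum_mono)
      fix b :: 'c assume "b \<in> Basis"
      moreover have "\<bar>2 * schoenberg_coord DIM('c) (idx b) t - 1\<bar> \<le> 1"
        using schoenberg_coord_bounds[of "DIM('c)" "idx b" t] by (auto simp: abs_le_iff)
      ultimately show "\<bar>\<phi> t \<bullet> b\<bar> \<le> B"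
        using B(2) by (simp add: inner abs_mult mult_left_le)
    qed
    then show "bounded (range \<phi>)"
      by (auto simp: bounded_iff)
    show "K \<subseteq> \<phi> ` {0..1}"
    proof
      fix x assume x: "x \<in> K"
      define y where "y i = (x \<bullet> the_inv_into Basis idx i / B + 1) / 2" for i
      have y_idx: "y (idx b) = (x \<bullet> b / B + 1) / 2" if "b \<in> Basis" for b
        using the_inv_into_f_f[OF bij_betw_imp_inj_on[OF idx] that] by (simp add: y_def)
      have "0 \<le> y i \<and> y i \<le> 1" if i: "i < DIM('c)" for i
      proof -
        obtain b where b: "b \<in> Basis" "i = idx b"
          using i idx by (metis bij_betw_imp_surj_on imageE lessThan_iff)
        have "\<bar>x \<bullet> b\<bar> \<le> B"
          using Basis_le_norm[OF b(1), of x] B(1)[OF x] by linarith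
        then have "-B \<le> x \<bullet> b" "x \<bullet> b \<le> B" by auto
        then show ?thesis
          using B(2) by (simp add: b y_idx field_simps)
      qed
      from schoenberg_coord_surj[of "DIM('c)" y, OF this] obtain t
        where t: "0 \<le> t" "t \<le> 1" "\<And>i. i < DIM('c) \<Longrightarrow> schoenberg_coord DIM('c) i t = y i"
        by blast
      have "x = \<phi> t"
      proof (rule euclidean_eqI)
        fix b :: 'c assume b: "b \<in> Basis"
        then have "idx b < DIM('c)"
          using idx by (auto dest: bij_betwE)
        with b show "x \<bullet> b = \<phi> t \<bullet> b"
          using B(2) by (simp add: inner t y_idx field_simps)
      qed
      with t show "x \<in> \<phi> ` {0..1}" by auto
    qed
  qed
qed

section \<open>Borel right inverse of the curve and weak limits on bounded sets\<close>

text \<open>Least preimages: the fibres of \<open>\<phi>\<close> in \<open>[0, 1]\<close> are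
  compact, so \<open>s x\<close> can be the smallest parameter mapped to \<open>x\<close>. The least
  preimage is at most \<open>a\<close> exactly if some preimage is, so a sublevel set of
  \<open>s\<close> on the image is itself the image of a compact set, hence closed. Off the image
  \<open>s\<close> is 0.\<close>

lemma measurable_section_exists:
  fixes K :: "'c::euclidean_space set"
  assumes "bounded K"
  obtains \<phi> :: "real \<Rightarrow> 'c" and s :: "'c \<Rightarrow> real"
  where "continuous_on UNIV \<phi>" "bounded (range \<phi>)" "s \<in> borel_measurable borel"
    "\<And>x. s x \<in> {0..1}" "\<And>x. x \<in> K \<Longrightarrow> \<phi> (s x) = x"
proof -
  obtain \<phi> :: "real \<Rightarrow> 'c"
    where \<phi>: "continuous_on UNIV \<phi>" "bounded (range \<phi>)" "K \<subseteq> \<phi> ` {0..1}"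
    using space_filling_curve_exists[OF assms] .
  let ?Q = "\<phi> ` {0..1}"
  define s where "s x = (if x \<in> ?Q then Inf {t\<in>{0..1}. \<phi> t = x} else 0)" for x
  have compact_fiber: "compact {t\<in>{0..1}. \<phi> t = x}" for x
  proof -
    have "closed (\<phi> -` {x})"
      using \<phi>(1) by (intro closed_vimage) auto
    then have "compact ({0..1} \<inter> \<phi> -` {x})"
      by (intro compact_Int_closed) auto
    then show ?thesis
      by (simp add: Int_def)
  qed
  have s_mem: "s x \<in> {t\<in>{0..1}. \<phi> t = x}" if "x \<in> ?Q" for x
  proof -
    have "Inf {t\<in>{0..1}. \<phi> t = x} \<in> {t\<in>{0..1}. \<phi> t = x}"
      using that compact_imp_closed[OF compact_fiber] compact_imp_bounded[OF compact_fiber]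
      by (intro closed_contains_Inf bounded_imp_bdd_below) auto
    with that show ?thesis by (simp add: s_def)
  qed
  have s_le: "s x \<le> t" if "t \<in> {0..1}" "\<phi> t = x" for x t
  proof -
    have "x \<in> ?Q" using that by auto
    then show ?thesis
      using that compact_imp_bounded[OF compact_fiber]
      by (auto simp: s_def intro!: cInf_lower bounded_imp_bdd_below)
  qed
  have Q: "closed (\<phi> ` A)" if "compact A" for A
    using that \<phi>(1) by (intro compact_imp_closed compact_continuous_image)
      (auto intro: continuous_on_subset)
  have "s \<in> borel_measurable borel"
  proof (rule borel_measurableI_le)
    fix a :: real
    have "{x \<in> space borel. s x \<le> a} = \<phi> ` ({0..1} \<inter> {..a}) \<union> (if 0 \<le> a then - ?Q else {})"
    proof (intro set_eqI iffI)
      fix x assume x: "x \<in> {x \<in> space borel. s x \<le> a}"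
      show "x \<in> \<phi> ` ({0..1} \<inter> {..a}) \<union> (if 0 \<le> a then - ?Q else {})"
      proof (cases "x \<in> ?Q")
        case True
        from s_mem[OF this] x show ?thesis
          by (intro UnI1 image_eqI[of _ _ "s x"]) auto
      next
        case False
        with x show ?thesis by (simp add: s_def)
      qed
    next
      fix x assume "x \<in> \<phi> ` ({0..1} \<inter> {..a}) \<union> (if 0 \<le> a then - ?Q else {})"
      then consider t where "t \<in> {0..1}" "t \<le> a" "\<phi> t = x" | "0 \<le> a" "x \<notin> ?Q"
        by (auto split: if_splits)
      then show "x \<in> {x \<in> space borel. s x \<le> a}"
        by cases (use s_le in \<open>force simp: s_def\<close>)+
    qed
    moreover have "compact ({0..1} \<inter> {..a})"
      by (intro compact_Int_closed) auto
    ultimately show "{x \<in> space borel. s x \<le> a} \<in> sets borel"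
      using Q[of "{0..1} \<inter> {..a}"] Q[of "{0..1}"] by (auto simp: borel_closed)
  qed
  moreover have "s x \<in> {0..1}" for x
    using s_mem[of x] by (cases "x \<in> ?Q") (auto simp: s_def)
  ultimately show ?thesis
    using \<phi> s_mem by (intro that[of \<phi> s]) auto
qed

text \<open>The limit is taken for the laws of \<open>s\<close> on \<open>[0, 1]\<close> and then
  pushed forward by \<open>\<phi>\<close>. A test function \<open>f\<close> appears on the line as
  \<open>f\<close> after \<open>\<phi>\<close>, which is continuous, so discontinuities of
  \<open>s\<close> do no harm. As \<open>\<phi>\<close> has bounded range, this composite is bounded
  for every continuous \<open>f\<close>; the quadratic cost is therefore an admissible test
  function.\<close>

lemma weakly_convergent_subsequence:
  fixes \<pi> :: "nat \<Rightarrow> 'c::euclidean_space measure" and K :: "'c set"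
  assumes prob: "\<And>n. prob_space (\<pi> n)" and sets: "\<And>n. sets (\<pi> n) = sets borel"
    and "bounded K" and AE: "\<And>n. AE x in \<pi> n. x \<in> K"
  obtains r :: "nat \<Rightarrow> nat" and \<pi>0 :: "'c measure"
  where "strict_mono r" "prob_space \<pi>0" "sets \<pi>0 = sets borel"
    "\<And>f::'c \<Rightarrow> real. continuous_on UNIV f \<Longrightarrow> (\<lambda>n. \<integral>x. f x \<partial>\<pi> (r n)) \<longlonglongrightarrow> (\<integral>x. f x \<partial>\<pi>0)"
proof -
  obtain \<phi> :: "real \<Rightarrow> 'c" and s :: "'c \<Rightarrow> real"
    where \<phi>: "continuous_on UNIV \<phi>" "bounded (range \<phi>)"
      and s [measurable]: "s \<in> borel_measurable borel"
      and s01: "\<And>x. s x \<in> {0..1}" and sec: "\<And>x. x \<in> K \<Longrightarrow> \<phi> (s x) = x"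
    using measurable_section_exists[OF \<open>bounded K\<close>] by blast
  have \<phi>_m [measurable]: "\<phi> \<in> borel_measurable borel"
    by (rule borel_measurable_continuous_onI[OF \<phi>(1)])
  have s_m: "s \<in> borel_measurable (\<pi> n)" for n
    using s by (simp cong: measurable_cong_sets add: sets)
  define \<mu> where "\<mu> n = distr (\<pi> n) borel s" for n
  have rd: "real_distribution (\<mu> n)" for n
    unfolding \<mu>_def by (rule prob_space.real_distribution_distr[OF prob s_m])
  have "tight \<mu>"
    unfolding tight_def
  proof (intro conjI allI impI)
    fix e :: real assume "e > 0"
    \<comment> \<open>Tightness is phrased with intervals open on the left; the endpoint -1 keeps
      the value 0 of \<open>s\<close> inside.\<close>
    have "measure (\<mu> n) {-1<..1} = 1" for n
    proof -
      have "s -` {-1<..1} = UNIV" using s01 by (force)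
      then have "measure (\<mu> n) {-1<..1} = measure (\<pi> n) (space (\<pi> n))"
        unfolding \<mu>_def by (subst measure_distr[OF s_m]) auto
      then show ?thesis using prob_space.prob_space[OF prob] by simp
    qed
    then show "\<exists>a b. a < b \<and> (\<forall>n. 1 - e < measure (\<mu> n) {a<..b})"
      using \<open>e > 0\<close> by (intro exI[of _ "-1"] exI[of _ 1]) auto
  qed (rule rd)
  from tight_imp_convergent_subsubsequence[OF this strict_mono_id]
  obtain r M where r: "strict_mono (r :: nat \<Rightarrow> nat)" and M: "real_distribution M"
      and conv: "weak_conv_m (\<mu> \<circ> id \<circ> r) M"
    by blast
  interpret M: real_distribution M by fact
  have "(\<lambda>n. \<integral>x. f x \<partial>\<pi> (r n)) \<longlonglongrightarrow> (\<integral>x. f x \<partial>distr M borel \<phi>)"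
    if f: "continuous_on UNIV f" for f :: "'c \<Rightarrow> real"
  proof -
    have f_m [measurable]: "f \<in> borel_measurable borel"
      by (rule borel_measurable_continuous_onI[OF f])
    have f\<phi>: "continuous_on UNIV (\<lambda>t. f (\<phi> t))"
      by (rule continuous_on_compose2[OF f \<phi>(1)]) auto
    have "bounded (f ` closure (range \<phi>))"
      using \<phi>(2) f
      by (intro compact_imp_bounded compact_continuous_image) (auto intro: continuous_on_subset)
    then obtain B where B: "\<And>y. y \<in> closure (range \<phi>) \<Longrightarrow> norm (f y) \<le> B"
      by (auto simp: bounded_iff)
    have "norm (f (\<phi> t)) \<le> B" for t
      using closure_subset[of "range \<phi>"] by (intro B) auto
    then have "(\<lambda>n. integral\<^sup>L ((\<mu> \<circ> id \<circ> r) n) (\<lambda>t. f (\<phi> t))) \<longlonglongrightarrow> integral\<^sup>L M (\<lambda>t. f (\<phi> t))"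
      using f\<phi> rd
      by (intro weak_conv_imp_integral_bdd_continuous_conv[OF _ M conv])
         (auto simp: continuous_on_eq_continuous_at)
    moreover have "integral\<^sup>L ((\<mu> \<circ> id \<circ> r) n) (\<lambda>t. f (\<phi> t)) = (\<integral>x. f x \<partial>\<pi> (r n))" for n
    proof -
      have "integral\<^sup>L ((\<mu> \<circ> id \<circ> r) n) (\<lambda>t. f (\<phi> t)) = (\<integral>x. f (\<phi> (s x)) \<partial>\<pi> (r n))"
        unfolding \<mu>_def comp_def id_def by (rule integral_distr[OF s_m]) measurable
      also have "\<dots> = (\<integral>x. f x \<partial>\<pi> (r n))"
      proof (rule integral_cong_AE)
        show "AE x in \<pi> (r n). f (\<phi> (s x)) = f x"
          using AE[of "r n"] by eventually_elim (simp add: sec)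
      qed (auto simp: sets cong: measurable_cong_sets)
      finally show ?thesis .
    qed
    moreover have "(\<integral>x. f x \<partial>distr M borel \<phi>) = (\<integral>t. f (\<phi> t) \<partial>M)"
      by (rule integral_distr) auto
    ultimately show ?thesis by simp
  qed
  moreover have "prob_space (distr M borel \<phi>)"
    by (rule M.prob_space_distr) auto
  ultimately show ?thesis
    using r by (intro that[of r "distr M borel \<phi>"]) auto
qed

section \<open>Optimal transport plans\<close>

text \<open>Closed sets form an intersection-stable generator of the Borel sets, and the indicator
  of a nonempty closed set is the pointwise limit of the continuous functions
  \<open>max 0 (1 - real n * infdist x A)\<close>.\<close>

lemma measure_eqI_continuous:
  fixes M N :: "'c::metric_space measure"
  assumes M: "prob_space M" "sets M = sets borel" and N: "prob_space N" "sets N = sets borel"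
    and eq: "\<And>f::'c \<Rightarrow> real. continuous_on UNIV f \<Longrightarrow> (\<And>x. \<bar>f x\<bar> \<le> 1) \<Longrightarrow>
      (\<integral>x. f x \<partial>M) = (\<integral>x. f x \<partial>N)"
  shows "M = N"
proof -
  interpret M: prob_space M by fact
  interpret N: prob_space N by fact
  have closed: "emeasure M A = emeasure N A" if A: "closed A" for A
  \<comment> \<open>The empty set is treated apart: \<open>infdist x {}\<close> is 0 by convention,
    and the approximating functions would be constantly 1.\<close>
  proof (cases "A = {}")
    case False
    define f where "f n x = max 0 (1 - real n * infdist x A)" for n x
    have f_cont: "continuous_on UNIV (f n)" for n
      unfolding f_def by (intro continuous_intros)
    have f_bd: "\<bar>f n x\<bar> \<le> 1" for n x
      using infdist_nonneg[of x A] by (auto simp: f_def)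
    have f_lim: "(\<lambda>n. f n x) \<longlonglongrightarrow> indicator A x" for x
    proof (cases "x \<in> A")
      case True
      then show ?thesis by (simp add: f_def)
    next
      case x: False
      then have pos: "0 < infdist x A"
        using in_closed_iff_infdist_zero[OF A False, of x] infdist_nonneg[of x A] by linarith
      obtain k :: nat where "1 / infdist x A \<le> real k"
        using real_arch_simple by blast
      have "f n x = 0" if "n \<ge> k" for n
      proof -
        have "1 / infdist x A \<le> real n"
          using that \<open>1 / infdist x A \<le> real k\<close> by simp
        then show ?thesis using pos by (simp add: f_def field_simps)
      qed
      then show ?thesis
        using x by (intro tendsto_eventually eventually_sequentiallyI[of k]) auto
    qed
    have lim: "(\<lambda>n. \<integral>x. f n x \<partial>P) \<longlonglongrightarrow> measure P A"
      if P: "prob_space P" "sets P = sets borel" for P :: "'c measure"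
    proof -
      interpret P: prob_space P by fact
      have [measurable_cong]: "sets P = sets borel" by fact
      have [measurable]: "A \<in> sets borel" "f n \<in> borel_measurable borel" for n
        using A f_cont by (auto intro: borel_closed borel_measurable_continuous_onI)
      have "(\<lambda>n. \<integral>x. f n x \<partial>P) \<longlonglongrightarrow> (\<integral>x. indicator A x \<partial>P)"
        by (rule integral_dominated_convergence[where w="\<lambda>_. 1"]) (use f_bd f_lim in auto)
      then show ?thesis
        by (simp add: sets_eq_imp_space_eq[OF P(2)])
    qed
    have "measure M A = measure N A"
      using lim[OF M] lim[OF N] eq[OF f_cont f_bd] by (intro LIMSEQ_unique[OF lim[OF M]]) simp
    then show ?thesis
      by (simp add: M.emeasure_eq_measure N.emeasure_eq_measure)
  qed simp
  have borel: "sets (borel :: 'c measure) = sigma_sets UNIV (Collect closed)"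
    by (simp add: borel_eq_closed)
  show ?thesis
  proof (rule measure_eqI_generator_eq[where E="Collect closed" and \<Omega>=UNIV and A="\<lambda>_. UNIV"])
    show "Int_stable (Collect closed :: 'c set set)"
      by (auto simp: Int_stable_def)
    show "emeasure M UNIV \<noteq> \<infinity>" for i :: nat
      by simp
  qed (use closed borel M N in auto)
qed

section \<open>Couplings over the trace of the Borel sets\<close>

lemma measurable_borel_on_into_borel:
  "f \<in> M \<rightarrow>\<^sub>M borel_on C \<Longrightarrow> f \<in> borel_measurable M"
  by (simp add: measurable_restrict_space2_iff)

lemma space_eq_of_sets_borel_on: "sets \<rho> = sets (borel_on C) \<Longrightarrow> space \<rho> = C"
  by (drule sets_eq_imp_space_eq) (simp add: space_restrict_space)

lemma measurable_ident_borel_on: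
  "sets \<rho> = sets (borel_on C) \<Longrightarrow> (\<lambda>x. x) \<in> borel_measurable \<rho>"
  by (simp add: measurable_restrict_space1 cong: measurable_cong_sets)

lemma couplingsD:
  assumes "\<pi> \<in> couplings C \<rho> \<nu>" "prob_space \<rho>"
  shows "prob_space \<pi>" "fst \<in> \<pi> \<rightarrow>\<^sub>M borel_on C" "snd \<in> \<pi> \<rightarrow>\<^sub>M borel_on C"
    "space \<pi> = C \<times> C" "distr \<pi> (borel_on C) fst = \<rho>" "distr \<pi> (borel_on C) snd = \<nu>"
proof -
  have s: "sets \<pi> = sets (borel_on C \<Otimes>\<^sub>M borel_on C)"
    using assms by (simp add: couplings_def)
  show fst: "fst \<in> \<pi> \<rightarrow>\<^sub>M borel_on C" and "snd \<in> \<pi> \<rightarrow>\<^sub>M borel_on C"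
    unfolding measurable_cong_sets[OF s refl] by (rule measurable_fst, rule measurable_snd)
  show "space \<pi> = C \<times> C"
    using sets_eq_imp_space_eq[OF s] by (simp add: space_pair_measure space_restrict_space)
  show fst_eq: "distr \<pi> (borel_on C) fst = \<rho>" and "distr \<pi> (borel_on C) snd = \<nu>"
    using assms by (auto simp: couplings_def)
  show "prob_space \<pi>"
    by (rule prob_space_distrD[OF fst]) (simp add: fst_eq assms)
qed

text \<open>Boundedness of \<open>C\<close> makes every cost finite, so that costs in
  \<open>ennreal\<close> can be compared as real integrals.\<close>

lemma coupling_cost_integrable:
  fixes C :: "'a::euclidean_space set"
  assumes "bounded C" "\<pi> \<in> couplings C \<rho> \<nu>" "prob_space \<rho>"
  shows "integrable \<pi> (\<lambda>p. (norm (fst p - snd p))\<^sup>2)"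
    "transport_cost \<pi> = ennreal (\<integral>p. (norm (fst p - snd p))\<^sup>2 \<partial>\<pi>)"
proof -
  note \<pi> = couplingsD[OF assms(2,3)]
  interpret prob_space \<pi> by fact
  have [measurable]: "fst \<in> borel_measurable \<pi>" "snd \<in> borel_measurable \<pi>"
    using \<pi>(2,3) by (auto dest: measurable_borel_on_into_borel)
  obtain B where B: "\<And>x. x \<in> C \<Longrightarrow> norm x \<le> B"
    using \<open>bounded C\<close> by (auto simp: bounded_iff)
  have bound: "norm (fst p - snd p) \<le> 2 * B" if "p \<in> space \<pi>" for p
    using that B[of "fst p"] B[of "snd p"] norm_triangle_ineq4[of "fst p" "snd p"]
    by (auto simp: \<pi>(4))
  have "norm ((norm (fst p - snd p))\<^sup>2) \<le> (2 * B)\<^sup>2" if "p \<in> space \<pi>" for p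
    using power_mono[OF bound[OF that] norm_ge_zero, of 2] by simp
  then show int: "integrable \<pi> (\<lambda>p. (norm (fst p - snd p))\<^sup>2)"
    by (intro integrable_const_bound[where B="(2 * B)\<^sup>2"] AE_I2) auto
  show "transport_cost \<pi> = ennreal (\<integral>p. (norm (fst p - snd p))\<^sup>2 \<partial>\<pi>)"
    unfolding transport_cost_def by (rule nn_integral_eq_integral[OF int]) auto
qed

lemma (in pair_prob_space) distr_pair_snd: "distr (M1 \<Otimes>\<^sub>M M2) M2 snd = M2"
proof (intro measure_eqI)
  fix A assume A: "A \<in> sets (distr (M1 \<Otimes>\<^sub>M M2) M2 snd)"
  then have "emeasure (distr (M1 \<Otimes>\<^sub>M M2) M2 snd) A = emeasure (M1 \<Otimes>\<^sub>M M2) (space M1 \<times> A)"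
    by (auto simp: emeasure_distr space_pair_measure dest: sets.sets_into_space
      intro!: arg_cong2[where f=emeasure])
  with A show "emeasure (distr (M1 \<Otimes>\<^sub>M M2) M2 snd) A = emeasure M2 A"
    by (simp add: M2.emeasure_pair_measure_Times M1.emeasure_space_1)
qed simp

lemma product_coupling:
  assumes "prob_space \<rho>" "prob_space \<nu>" "sets \<rho> = sets (borel_on C)" "sets \<nu> = sets (borel_on C)"
  shows "\<rho> \<Otimes>\<^sub>M \<nu> \<in> couplings C \<rho> \<nu>"
proof -
  interpret \<rho>: prob_space \<rho> by fact
  interpret \<nu>: prob_space \<nu> by fact
  interpret pair_prob_space \<rho> \<nu> ..
  have sets: "sets (\<rho> \<Otimes>\<^sub>M \<nu>) = sets (borel_on C \<Otimes>\<^sub>M borel_on C)"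
    by (intro sets_pair_measure_cong assms)
  have "distr (\<rho> \<Otimes>\<^sub>M \<nu>) (borel_on C) fst = distr (\<rho> \<Otimes>\<^sub>M \<nu>) \<rho> fst"
    by (intro distr_cong) (auto simp: assms)
  moreover have "distr (\<rho> \<Otimes>\<^sub>M \<nu>) (borel_on C) snd = distr (\<rho> \<Otimes>\<^sub>M \<nu>) \<nu> snd"
    by (intro distr_cong) (auto simp: assms)
  ultimately show ?thesis
    by (simp add: couplings_def sets \<nu>.distr_pair_fst distr_pair_snd)
qed

text \<open>Weak limits are measures on the Borel sets of the whole product space, whereas
  \<open>couplings\<close> live over \<open>C \<times> C\<close>. Both marginals give full mass to
  \<open>C\<close>, so \<pi> gives full mass to \<open>C \<times> C\<close>; sending the remaining
  null set to one point \<open>(c, c)\<close> changes neither the marginals nor the cost.\<close>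

lemma coupling_pullback:
  fixes C :: "'a::euclidean_space set"
  assumes C: "C \<in> sets borel"
    and \<rho>: "prob_space \<rho>" "sets \<rho> = sets (borel_on C)"
    and \<nu>: "prob_space \<nu>" "sets \<nu> = sets (borel_on C)"
    and \<pi>: "prob_space \<pi>" "sets \<pi> = sets borel"
    and fst: "distr \<pi> borel fst = distr \<rho> borel (\<lambda>x. x)"
    and snd: "distr \<pi> borel snd = distr \<nu> borel (\<lambda>x. x)"
  obtains \<pi>' where "\<pi>' \<in> couplings C \<rho> \<nu>"
    "transport_cost \<pi>' = transport_cost \<pi>"
proof -
  interpret \<rho>: prob_space \<rho> by fact
  interpret \<nu>: prob_space \<nu> by fact
  interpret \<pi>: prob_space \<pi> by fact
  note C [measurable]
  have sets_\<pi> [measurable_cong]: "sets \<pi> = sets (borel \<Otimes>\<^sub>M borel)"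
    using \<pi> by (simp only: borel_prod)
  have sp: "space \<rho> = C" "space \<nu> = C"
    by (rule space_eq_of_sets_borel_on, fact)+
  have sp\<pi>: "space \<pi> = UNIV"
    using sets_eq_imp_space_eq[OF \<pi>(2)] by simp
  obtain c where c: "c \<in> C"
    using \<rho>.not_empty sp by auto
  have id: "(\<lambda>x. x) \<in> borel_measurable \<rho>" "(\<lambda>x. x) \<in> borel_measurable \<nu>"
    by (rule measurable_ident_borel_on, fact)+
  have fst': "emeasure \<pi> (fst -` A) = emeasure \<rho> (A \<inter> C)" if "A \<in> sets borel" for A
    using emeasure_distr[of fst \<pi> borel A] emeasure_distr[OF id(1), of A] that fst
    by (simp add: sp sp\<pi>)
  have snd': "emeasure \<pi> (snd -` A) = emeasure \<nu> (A \<inter> C)" if "A \<in> sets borel" for A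
    using emeasure_distr[of snd \<pi> borel A] emeasure_distr[OF id(2), of A] that snd
    by (simp add: sp sp\<pi>)
  have "AE p in \<pi>. fst p \<in> C"
    using fst'[OF C] \<rho>.emeasure_space_1 \<pi>.AE_prob_1[of "fst -` C"]
    by (simp add: measure_def sp)
  moreover have "AE p in \<pi>. snd p \<in> C"
    using snd'[OF C] \<nu>.emeasure_space_1 \<pi>.AE_prob_1[of "snd -` C"]
    by (simp add: measure_def sp)
  ultimately have AE_C: "AE p in \<pi>. p \<in> C \<times> C"
    by eventually_elim (auto simp: mem_Times_iff)
  define T where "T p = (if p \<in> C \<times> C then p else (c, c))" for p
  have T: "T \<in> \<pi> \<rightarrow>\<^sub>M borel_on C \<Otimes>\<^sub>M borel_on C"
  proof (rule measurable_pair)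
    have 1: "fst \<circ> T = (\<lambda>p. if p \<in> C \<times> C then fst p else c)"
      and 2: "snd \<circ> T = (\<lambda>p. if p \<in> C \<times> C then snd p else c)"
      by (auto simp: T_def)
    show "fst \<circ> T \<in> \<pi> \<rightarrow>\<^sub>M borel_on C"
      unfolding 1 using c by (intro measurable_restrict_space2) auto
    show "snd \<circ> T \<in> \<pi> \<rightarrow>\<^sub>M borel_on C"
      unfolding 2 using c by (intro measurable_restrict_space2) auto
  qed
  define \<pi>' where "\<pi>' = distr \<pi> (borel_on C \<Otimes>\<^sub>M borel_on C) T"
  have sub: "A \<inter> C = A" "A \<in> sets borel" if "A \<in> sets (borel_on C)" for A
    using that C by (auto simp: sets_restrict_space_iff)
  have "distr \<pi>' (borel_on C) fst = \<rho>"
  proof (rule measure_eqI)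
    fix A assume "A \<in> sets (distr \<pi>' (borel_on C) fst)"
    then have A: "A \<in> sets (borel_on C)" by simp
    have "emeasure (distr \<pi>' (borel_on C) fst) A = emeasure \<pi> ((fst \<circ> T) -` A \<inter> space \<pi>)"
      unfolding \<pi>'_def using A T
      by (subst distr_distr) (auto intro: emeasure_distr measurable_comp)
    also have "\<dots> = emeasure \<pi> (fst -` A)"
      using AE_C measurable_sets[OF measurable_comp[OF T measurable_fst] A] sub(2)[OF A]
        measurable_sets[of fst \<pi> borel A]
      by (intro emeasure_eq_AE) (auto simp: T_def sp\<pi>)
    also have "\<dots> = emeasure \<rho> A"
      using fst'[OF sub(2)[OF A]] sub(1)[OF A] by simp
    finally show "emeasure (distr \<pi>' (borel_on C) fst) A = emeasure \<rho> A" .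
  qed (simp add: \<rho>)
  moreover have "distr \<pi>' (borel_on C) snd = \<nu>"
  proof (rule measure_eqI)
    fix A assume "A \<in> sets (distr \<pi>' (borel_on C) snd)"
    then have A: "A \<in> sets (borel_on C)" by simp
    have "emeasure (distr \<pi>' (borel_on C) snd) A = emeasure \<pi> ((snd \<circ> T) -` A \<inter> space \<pi>)"
      unfolding \<pi>'_def using A T
      by (subst distr_distr) (auto intro: emeasure_distr measurable_comp)
    also have "\<dots> = emeasure \<pi> (snd -` A)"
      using AE_C measurable_sets[OF measurable_comp[OF T measurable_snd] A] sub(2)[OF A]
        measurable_sets[of snd \<pi> borel A]
      by (intro emeasure_eq_AE) (auto simp: T_def sp\<pi>)
    also have "\<dots> = emeasure \<nu> A"
      using snd'[OF sub(2)[OF A]] sub(1)[OF A] by simp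
    finally show "emeasure (distr \<pi>' (borel_on C) snd) A = emeasure \<nu> A" .
  qed (simp add: \<nu>)
  ultimately have "\<pi>' \<in> couplings C \<rho> \<nu>"
    by (simp add: couplings_def \<pi>'_def)
  moreover have "transport_cost \<pi>' = transport_cost \<pi>"
  proof -
    have "fst \<in> borel_measurable (borel_on C \<Otimes>\<^sub>M borel_on C)"
      "snd \<in> borel_measurable (borel_on C \<Otimes>\<^sub>M borel_on C)"
      by (rule measurable_borel_on_into_borel[OF measurable_fst]
        measurable_borel_on_into_borel[OF measurable_snd])+
    then have "(\<lambda>p. ennreal ((norm (fst p - snd p))\<^sup>2)) \<in>
        borel_measurable (borel_on C \<Otimes>\<^sub>M borel_on C)"
      by measurable
    then have "transport_cost \<pi>' = (\<integral>\<^sup>+p. ennreal ((norm (fst (T p) - snd (T p)))\<^sup>2) \<partial>\<pi>)"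
      unfolding transport_cost_def \<pi>'_def by (intro nn_integral_distr T) simp
    also have "\<dots> = transport_cost \<pi>"
      unfolding transport_cost_def using AE_C
      by (intro nn_integral_cong_AE) (auto simp: T_def)
    finally show ?thesis .
  qed
  ultimately show ?thesis
    using that by blast
qed

text \<open>A weak limit of a minimising sequence keeps the marginals, because continuous functions
  determine a measure. The costs converge along the subsequence as well, the squared distance being
  an admissible test function, so the limit attains the infimum.\<close>

theorem optimal_plans_nonempty:
  fixes C :: "'a::euclidean_space set"
  assumes bnd: "bounded C" and C: "C \<in> sets borel" and \<rho>: "\<rho> \<in> P2 C" and \<nu>: "\<nu> \<in> P2 C"
  shows "optimal_plans C \<rho> \<nu> \<noteq> {}"
proof -
  have \<rho>': "prob_space \<rho>" "sets \<rho> = sets (borel_on C)"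
    and \<nu>': "prob_space \<nu>" "sets \<nu> = sets (borel_on C)"
    using \<rho> \<nu> by (auto simp: P2_def)
  define m where "m = (INF \<pi>\<in>couplings C \<rho> \<nu>. transport_cost \<pi>)"
  have m_le: "m \<le> transport_cost \<pi>" if "\<pi> \<in> couplings C \<rho> \<nu>" for \<pi>
    unfolding m_def by (rule INF_lower[OF that])
  \<comment> \<open>The product measure is a coupling of finite cost, so the infimum is a real
    number that can be approached up to \<open>1 / real (Suc n)\<close>.\<close>
  have m_fin: "m < \<infinity>"
    using m_le[OF product_coupling[OF \<rho>'(1) \<nu>'(1) \<rho>'(2) \<nu>'(2)]]
      coupling_cost_integrable(2)[OF bnd product_coupling[OF \<rho>'(1) \<nu>'(1) \<rho>'(2) \<nu>'(2)] \<rho>'(1)]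
    by (simp add: order_le_less_trans)
  define m' where "m' = enn2real m"
  have m': "m = ennreal m'" "0 \<le> m'"
    using m_fin by (auto simp: m'_def)
  have "\<exists>\<pi>\<in>couplings C \<rho> \<nu>. transport_cost \<pi> < ennreal (m' + 1 / real (Suc n))" for n
  proof -
    have "m < ennreal (m' + 1 / real (Suc n))"
      unfolding m'(1) using m'(2) by (intro ennreal_lessI) (auto intro: add_pos_nonneg add_nonneg_pos)
    then show ?thesis
      unfolding m_def INF_less_iff .
  qed
  then obtain p where p: "\<And>n. p n \<in> couplings C \<rho> \<nu>"
      and p_cost: "\<And>n. transport_cost (p n) < ennreal (m' + 1 / real (Suc n))"
    by metis
  note pD = couplingsD[OF p \<rho>'(1)]
  have fst_p [measurable]: "fst \<in> borel_measurable (p n)"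
    and snd_p [measurable]: "snd \<in> borel_measurable (p n)" for n
    using pD(2,3)[of n] by (auto dest: measurable_borel_on_into_borel)
  have id_p [measurable]: "(\<lambda>x. x) \<in> borel_measurable (p n)" for n
    using borel_measurable_Pair[OF fst_p snd_p] by simp
  \<comment> \<open>The plans are reread as measures on the whole product space, where weak
    compactness is available.\<close>
  define q where "q n = distr (p n) borel (\<lambda>x. x)" for n
  have q_prob: "prob_space (q n)" for n
    unfolding q_def by (rule prob_space.prob_space_distr[OF pD(1) id_p])
  have q_AE: "AE x in q n. x \<in> C \<times> C" for n
    unfolding q_def using pD(4)[of n] C
    by (subst AE_distr_iff) (use id_p[of n] in \<open>auto simp: borel_prod[symmetric] intro!: AE_I2\<close>)
  have "bounded (C \<times> C)"
    by (rule bounded_Times[OF bnd bnd])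
  from weakly_convergent_subsequence[of q, OF q_prob _ this q_AE]
  obtain r and \<pi> :: "('a \<times> 'a) measure"
    where r: "strict_mono (r :: nat \<Rightarrow> nat)" and \<pi>: "prob_space \<pi>" "sets \<pi> = sets borel"
      and conv: "\<And>f::'a \<times> 'a \<Rightarrow> real. continuous_on UNIV f \<Longrightarrow>
        (\<lambda>n. \<integral>x. f x \<partial>q (r n)) \<longlonglongrightarrow> (\<integral>x. f x \<partial>\<pi>)"
    by (auto simp: q_def)
  interpret \<pi>: prob_space \<pi> by fact
  have sets_\<pi> [measurable_cong]: "sets \<pi> = sets (borel \<Otimes>\<^sub>M borel)"
    using \<pi> by (simp only: borel_prod)
  have int_q: "(\<integral>x. f x \<partial>q n) = (\<integral>x. f x \<partial>p n)" if "continuous_on UNIV f"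
    for f :: "'a \<times> 'a \<Rightarrow> real" and n
    unfolding q_def using that
    by (intro integral_distr) (auto intro: borel_measurable_continuous_onI)
  have marginal: "distr \<pi> borel g = distr \<mu> borel (\<lambda>x. x)"
    if g: "continuous_on UNIV g" "\<And>n. g \<in> p n \<rightarrow>\<^sub>M borel_on C" "g \<in> borel_measurable \<pi>"
      and \<mu>: "prob_space \<mu>" "sets \<mu> = sets (borel_on C)" "\<And>n. distr (p n) (borel_on C) g = \<mu>"
    for g :: "'a \<times> 'a \<Rightarrow> 'a" and \<mu>
  proof (rule measure_eqI_continuous)
    have id: "(\<lambda>x. x) \<in> borel_measurable \<mu>"
      by (rule measurable_ident_borel_on[OF \<mu>(2)])
    show "prob_space (distr \<pi> borel g)" "prob_space (distr \<mu> borel (\<lambda>x. x))"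
      by (rule \<pi>.prob_space_distr[OF g(3)], rule prob_space.prob_space_distr[OF \<mu>(1) id])
    fix f :: "'a \<Rightarrow> real" assume f: "continuous_on UNIV f"
    have f_m: "f \<in> borel_measurable borel"
      by (rule borel_measurable_continuous_onI[OF f])
    have fg: "continuous_on UNIV (\<lambda>x. f (g x))"
      by (rule continuous_on_compose2[OF f g(1)]) auto
    have "(\<integral>x. f (g x) \<partial>p n) = (\<integral>x. f x \<partial>\<mu>)" for n
      unfolding \<mu>(3)[of n, symmetric]
      by (rule integral_distr[symmetric, OF g(2)]) (rule measurable_restrict_space1[OF f_m])
    \<comment> \<open>Every plan of the sequence has the marginal \<mu>, so the convergent sequence
      of integrals is constant and its limit is that constant.\<close>
    then have "(\<integral>x. f x \<partial>\<mu>) = (\<integral>x. f (g x) \<partial>\<pi>)"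
      using conv[OF fg] by (simp add: int_q[OF fg] LIMSEQ_const_iff)
    then show "(\<integral>x. f x \<partial>distr \<pi> borel g) = (\<integral>x. f x \<partial>distr \<mu> borel (\<lambda>x. x))"
      using f_m g(3) id by (simp add: integral_distr)
  qed auto
  have "distr \<pi> borel fst = distr \<rho> borel (\<lambda>x. x)"
    using pD \<rho>' by (intro marginal) (auto intro: continuous_intros)
  moreover have "distr \<pi> borel snd = distr \<nu> borel (\<lambda>x. x)"
    using pD \<nu>' by (intro marginal) (auto intro: continuous_intros)
  ultimately obtain \<pi>' where \<pi>': "\<pi>' \<in> couplings C \<rho> \<nu>" "transport_cost \<pi>' = transport_cost \<pi>"
    using coupling_pullback[OF C \<rho>' \<nu>' \<pi> ] by blast
  let ?c = "\<lambda>x::'a \<times> 'a. (norm (fst x - snd x))\<^sup>2"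
  have "transport_cost \<pi>' \<le> ennreal m'"
  proof -
    have c: "continuous_on UNIV ?c"
      by (intro continuous_intros)
    have p_le: "(\<integral>x. ?c x \<partial>p n) \<le> m' + 1 / real (Suc n)" for n
      using p_cost[of n] m'(2) unfolding coupling_cost_integrable(2)[OF bnd p \<rho>'(1)]
      by (subst (asm) ennreal_less_iff) auto
    have "(\<lambda>n. 1 / real (Suc n)) \<longlonglongrightarrow> 0"
      using LIMSEQ_inverse_real_of_nat by (simp add: inverse_eq_divide)
    then have "(\<lambda>n. m' + 1 / real (Suc n)) \<longlonglongrightarrow> m' + 0"
      by (intro tendsto_intros)
    from LIMSEQ_subseq_LIMSEQ[OF this r]
    have "(\<lambda>n. m' + 1 / real (Suc (r n))) \<longlonglongrightarrow> m'"
      by (simp add: comp_def)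
    then have "(\<integral>x. ?c x \<partial>\<pi>) \<le> m'"
      using conv[OF c] p_le by (intro LIMSEQ_le) (auto simp: int_q[OF c])
    moreover have "(\<integral>x. ?c x \<partial>\<pi>) = (\<integral>x. ?c x \<partial>\<pi>')"
    proof -
      \<comment> \<open>\<open>\<pi>\<close> and \<open>\<pi>'\<close> live over different spaces;
        what is known to agree is the extended cost, and the real integrals are matched through
        it.\<close>
      have "(\<integral>x. ?c x \<partial>\<pi>) = enn2real (transport_cost \<pi>)"
        unfolding transport_cost_def by (rule integral_eq_nn_integral) auto
      also have "\<dots> = (\<integral>x. ?c x \<partial>\<pi>')"
        unfolding \<pi>'(2)[symmetric] coupling_cost_integrable(2)[OF bnd \<pi>'(1) \<rho>'(1)] by simp
      finally show ?thesis .
    qed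
    ultimately show ?thesis
      unfolding coupling_cost_integrable(2)[OF bnd \<pi>'(1) \<rho>'(1)] by (intro ennreal_leI) simp
  qed
  then have "transport_cost \<pi>' \<le> transport_cost \<sigma>" if "\<sigma> \<in> couplings C \<rho> \<nu>" for \<sigma>
    using m_le[OF that] m'(1) by auto
  with \<pi>'(1) show ?thesis
    by (auto simp: optimal_plans_def)
qed

text \<open>An optimal plan attains the infimum in \<open>W2\<close>, so a remainder that is
  quadratic in the displacement under such a plan is quadratic in \<open>W2\<close>.\<close>

lemma W2_optimal_plan:
  fixes C :: "'a::euclidean_space set"
  assumes "bounded C" "prob_space \<rho>" "\<pi> \<in> optimal_plans C \<rho> \<nu>"
  shows "(W2 C \<rho> \<nu>)\<^sup>2 = (\<integral>p. (norm (fst p - snd p))\<^sup>2 \<partial>\<pi>)" "0 \<le> W2 C \<rho> \<nu>"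
proof -
  have \<pi>: "\<pi> \<in> couplings C \<rho> \<nu>"
    using assms by (simp add: optimal_plans_def)
  have "(INF \<pi>\<in>couplings C \<rho> \<nu>. transport_cost \<pi>) = transport_cost \<pi>"
    using assms by (intro antisym INF_lower2[OF \<pi>] INF_greatest) (auto simp: optimal_plans_def)
  then have "W2 C \<rho> \<nu> = sqrt (\<integral>p. (norm (fst p - snd p))\<^sup>2 \<partial>\<pi>)"
    by (simp add: W2_def coupling_cost_integrable(2)[OF assms(1) \<pi> assms(2)])
  then show "(W2 C \<rho> \<nu>)\<^sup>2 = (\<integral>p. (norm (fst p - snd p))\<^sup>2 \<partial>\<pi>)" "0 \<le> W2 C \<rho> \<nu>"
    by auto
qed

section \<open>Random variables on atomless Polish spaces\<close>

text \<open>The Cantor encoding of the membership pattern of a point in a countable base.\<close>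

lemma measurable_injection_into_real:
  obtains b :: "'b::polish_space \<Rightarrow> real" where "b \<in> borel_measurable borel" "inj b"
proof -
  obtain B :: "'b set set" where B: "countable B" "topological_basis B"
    using ex_countable_basis by blast
  have "B \<noteq> {}"
    using topological_basisE[OF B(2) open_UNIV UNIV_I] by blast
  define e where "e = from_nat_into B"
  have range_e: "range e = B"
    unfolding e_def by (rule range_from_nat_into[OF \<open>B \<noteq> {}\<close> B(1)])
  have open_e: "open (e n)" for n
    using range_e topological_basis_open[OF B(2)] by blast
  define b where "b x = (\<Sum>k. 2 * indicator (e k) x / 3 ^ Suc k :: real)" for x
  have [measurable]: "e k \<in> sets borel" for k
    by (rule borel_open[OF open_e])
  have digit: "schoenberg_step (3 ^ k * b x) = indicator (e k) x" for k x
    unfolding b_def by (rule schoenberg_step_cantor(1)) (auto simp: indicator_def)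
  have "inj b"
  proof (rule injI, rule ccontr)
    fix x y assume eq: "b x = b y" and "x \<noteq> y"
    then obtain U where U: "open U" "x \<in> U" "y \<notin> U"
      using t1_space[of x y] by blast
    from topological_basisE[OF B(2) U(1,2)] obtain k where "x \<in> e k" "e k \<subseteq> U"
      using range_e by blast
    with U(3) eq digit[of k x] digit[of k y] show False
      by (auto simp: indicator_def split: if_splits)
  qed
  moreover have "b \<in> borel_measurable borel"
    unfolding b_def by measurable
  ultimately show ?thesis
    using that by blast
qed

lemma (in finite_measure) atomless_singleton:
  assumes "atomless M" "{x} \<in> sets M"
  shows "measure M {x} = 0"
proof (rule ccontr)
  assume "measure M {x} \<noteq> 0"
  then have "0 < emeasure M {x}"
    by (simp add: emeasure_eq_measure zero_less_measure_iff)
  with assms obtain B where "B \<subseteq> {x}" "0 < emeasure M B" "emeasure M B < emeasure M {x}"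
    unfolding atomless_def by blast
  moreover from this have "B = {} \<or> B = {x}" by blast
  ultimately show False by auto
qed

text \<open>The probability integral transform; here \<open>C\<close> is the distribution function
  and \<open>I\<close> its pseudo-inverse. Without atoms \<open>C\<close> is continuous, hence
  \<open>C (I u) = u\<close>, and \<open>{x. C x < u}\<close> is the open half-line below
  \<open>I u\<close>, of mass \<open>u\<close>.\<close>

lemma (in cdf_distribution) continuous_cdf_transform:
  assumes "\<And>x. measure M {x} = 0" "0 \<le> v" "v \<le> 1"
  shows "measure M {x. C x \<le> v} = v"
proof -
  have meas: "{x. C x \<le> u} \<in> sets M" "{x. C x < u} \<in> sets M" for u
    using measurable_C by measurable
  have cont: "isCont C x" for x
    by (simp add: isCont_cdf assms)
  have eventually_at_left_less: "\<forall>\<^sub>F x in at_left a. x < a" for a :: real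
    by (simp add: eventually_at_filter)
  have less_iff: "C x < u \<longleftrightarrow> x < I u" if "0 < u" "u < 1" for u x
    using pseudoinverse[OF that, of x] by linarith
  have CI: "C (I u) = u" if "0 < u" "u < 1" for u
  proof (rule antisym)
    show "u \<le> C (I u)"
      using pseudoinverse[OF that, of "I u"] by simp
    show "C (I u) \<le> u"
    \<comment> \<open>Left of \<open>I u\<close> the values of \<open>C\<close> stay below
      \<open>u\<close>; continuity carries the bound to \<open>I u\<close> itself.\<close>
    proof (rule tendsto_upperbound)
      show "(C \<longlongrightarrow> C (I u)) (at_left (I u))"
        using cont[of "I u"] by (simp add: isCont_def filterlim_at_split)
      show "\<forall>\<^sub>F x in at_left (I u). C x \<le> u"
        using eventually_at_left_less[of "I u"]
        by eventually_elim (use less_iff[OF that] in \<open>auto intro: less_imp_le\<close>)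
    qed simp
  qed
  have less: "measure M {x. C x < u} = u" if "0 < u" "u < 1" for u
  proof -
    have "{x. C x < u} = {..<I u}"
      using less_iff[OF that] by auto
    moreover have "measure M {..I u} = measure M {..<I u} + measure M {I u}"
      by (subst finite_measure_Union[symmetric]) (auto simp: ivl_disj_un intro!: arg_cong[where f="measure M"])
    ultimately show ?thesis
      using CI[OF that] assms(1) by (simp add: cdf_def)
  qed
  show ?thesis
  proof (cases "v = 1")
    case True
    then have "{x. C x \<le> v} = space M"
      using cdf_bounded_prob by auto
    then show ?thesis
      using prob_space True by simp
  next
    case False
    show ?thesis
    proof (rule antisym)
      show "measure M {x. C x \<le> v} \<le> v"
      \<comment> \<open>Only strict sublevel sets with \<open>0 < u < 1\<close> are known so far;
        letting \<open>u\<close> decrease to \<open>v\<close> bounds the non-strict one, also for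
        \<open>v = 0\<close>.\<close>
      proof (rule dense_ge_bounded)
        show "v < 1" using False assms by simp
        fix u assume u: "v < u" "u < 1"
        have "measure M {x. C x \<le> v} \<le> measure M {x. C x < u}"
          using u meas by (intro finite_measure_mono) auto
        with less[of u] u assms show "measure M {x. C x \<le> v} \<le> u" by simp
      qed
      show "v \<le> measure M {x. C x \<le> v}"
      proof (cases "v = 0")
        case v: False
        have "measure M {x. C x < v} \<le> measure M {x. C x \<le> v}"
          using meas by (intro finite_measure_mono) auto
        with less[of v] v False assms show ?thesis by simp
      qed (simp add: measure_nonneg)
    qed
  qed
qed

text \<open>An injection has fibres of at most one point, so its law on the line has no atoms, and
  the distribution function of that law turns it into the uniform one.\<close>

lemma atomless_uniform_exists:
  fixes M :: "'b::polish_space measure"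
  assumes "prob_space M" "sets M = sets borel" "atomless M"
  obtains Z :: "'b \<Rightarrow> real"
  where "Z \<in> borel_measurable M" "\<And>z. 0 < Z z \<and> Z z < 1"
    "\<And>v. 0 \<le> v \<Longrightarrow> v \<le> 1 \<Longrightarrow> measure M {z. Z z \<le> v} = v"
proof -
  interpret prob_space M by fact
  have sp: "space M = UNIV"
    using sets_eq_imp_space_eq[OF assms(2)] by simp
  obtain b :: "'b \<Rightarrow> real" where b: "b \<in> borel_measurable borel" "inj b"
    using measurable_injection_into_real .
  have b_M [measurable]: "b \<in> borel_measurable M"
    using b(1) by (simp add: measurable_cong_sets[OF assms(2) refl])
  interpret \<mu>: real_distribution "distr M borel b"
    by (rule real_distribution_distr) simp
  interpret \<mu>: cdf_distribution "distr M borel b" ..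
  have no_atom: "measure (distr M borel b) {t} = 0" for t
  proof -
    have "measure (distr M borel b) {t} = measure M (b -` {t})"
      by (subst measure_distr) (auto simp: sp)
    moreover have "b -` {t} = {} \<or> (\<exists>x. b -` {t} = {x})"
    proof (cases "\<exists>x. b x = t")
      case True
      then obtain x where "b x = t" ..
      with b(2) have "b -` {t} = {x}" by (auto dest: injD)
      then show ?thesis by blast
    qed auto
    moreover have "measure M {x} = 0" for x
      using assms by (intro atomless_singleton) auto
    ultimately show ?thesis by auto
  qed
  define Y where "Y z = \<mu>.C (b z)" for z
  have Y [measurable]: "Y \<in> borel_measurable M"
    unfolding Y_def by measurable
  have Y_le: "measure M {z. Y z \<le> v} = v" if "0 \<le> v" "v \<le> 1" for v
  proof -
    have "{x. \<mu>.C x \<le> v} \<in> sets borel"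
      using \<mu>.measurable_C by measurable
    then have "measure (distr M borel b) {x. \<mu>.C x \<le> v} = measure M {z. Y z \<le> v}"
      by (subst measure_distr) (auto simp: sp Y_def intro!: arg_cong[where f="measure M"])
    then show ?thesis
      using \<mu>.continuous_cdf_transform[OF no_atom that] by simp
  qed
  have Y_meas: "{z. P (Y z)} \<in> sets M" if "{y. P y} \<in> sets borel" for P
    using measurable_sets[OF Y that] by (simp add: vimage_def sp)
  have "AE z in M. 0 < Y z"
  proof (rule AE_I')
    show "{z. Y z \<le> 0} \<in> null_sets M"
      using Y_le[of 0] Y_meas[of "\<lambda>y. y \<le> 0"] by (auto simp: null_sets_def emeasure_eq_measure atMost_def[symmetric])
  qed auto
  moreover have "AE z in M. Y z < 1"
  proof -
    have m: "{z. Y z < 1} \<in> sets M"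
      using Y_meas[of "\<lambda>y. y < 1"] by (simp add: lessThan_def[symmetric])
    have "1 \<le> measure M {z. Y z < 1}"
    proof (rule dense_le_bounded)
      fix v :: real assume v: "0 < v" "v < 1"
      have "measure M {z. Y z \<le> v} \<le> measure M {z. Y z < 1}"
        using v m by (intro finite_measure_mono) auto
      with Y_le[of v] v show "v \<le> measure M {z. Y z < 1}" by simp
    qed simp
    then have "measure M {z. Y z < 1} = 1"
      using prob_le_1 antisym by blast
    from AE_prob_1[OF this] show ?thesis by simp
  qed
  ultimately have Y01: "AE z in M. 0 < Y z \<and> Y z < 1" by auto
  \<comment> \<open>The pseudo-inverse is controlled only on the open unit interval. Values outside
    it occur on a null set and are replaced by 1/2.\<close>
  define Z where "Z z = (if 0 < Y z \<and> Y z < 1 then Y z else 1/2)" for z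
  have Z [measurable]: "Z \<in> borel_measurable M"
    unfolding Z_def by measurable
  show ?thesis
  proof (rule that[of Z])
    fix v :: real assume v: "0 \<le> v" "v \<le> 1"
    have "measure M {z. Z z \<le> v} = measure M {z. Y z \<le> v}"
    proof (rule measure_eq_AE)
      show "AE z in M. (z \<in> {z. Z z \<le> v}) = (z \<in> {z. Y z \<le> v})"
        using Y01 by eventually_elim (simp add: Z_def)
      show "{z. Z z \<le> v} \<in> sets M" "{z. Y z \<le> v} \<in> sets M"
        using measurable_sets[OF Z, of "{..v}"] measurable_sets[OF Y, of "{..v}"]
        by (simp_all add: vimage_def sp)
    qed
    with Y_le[OF v] show "measure M {z. Z z \<le> v} = v" by simp
  qed (auto simp: Z_def)
qed

text \<open>Quantile transform: the pseudo-inverse and the distribution function form a Galois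
  connection, so \<open>X z \<le> x\<close> is the event that the uniform variable \<open>Z\<close>
  is at most \<open>cdf \<sigma> x\<close>.\<close>

lemma atomless_real_law_exists:
  fixes M :: "'b::polish_space measure"
  assumes M: "prob_space M" "sets M = sets borel" "atomless M" and "real_distribution \<sigma>"
  obtains X where "X \<in> borel_measurable M" "distr M borel X = \<sigma>"
proof -
  interpret prob_space M by fact
  interpret \<sigma>: cdf_distribution \<sigma>
    using assms(4) by (simp add: cdf_distribution_def)
  have sp: "space M = UNIV"
    using sets_eq_imp_space_eq[OF M(2)] by simp
  obtain Z :: "'b \<Rightarrow> real" where Z: "Z \<in> borel_measurable M" "\<And>z. 0 < Z z \<and> Z z < 1"
      and Z_le: "\<And>v. 0 \<le> v \<Longrightarrow> v \<le> 1 \<Longrightarrow> measure M {z. Z z \<le> v} = v"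
    using atomless_uniform_exists[OF M] by blast
  define X where "X z = \<sigma>.I (Z z)" for z
  have "Z \<in> M \<rightarrow>\<^sub>M restrict_space borel {0<..<1}"
    using Z by (intro measurable_restrict_space2) auto
  from measurable_comp[OF this \<sigma>.measurable_CI] have X: "X \<in> borel_measurable M"
    by (simp add: X_def[abs_def] comp_def)
  have "distr M borel X = \<sigma>"
  proof (rule cdf_unique)
    show "real_distribution (distr M borel X)"
      using X by (rule real_distribution_distr)
    show "cdf (distr M borel X) = cdf \<sigma>"
    proof
      fix x
      have "cdf (distr M borel X) x = measure M {z. X z \<le> x}"
        unfolding cdf_def using X
        by (subst measure_distr) (auto simp: sp intro!: arg_cong[where f="measure M"])
      also have "{z. X z \<le> x} = {z. Z z \<le> cdf \<sigma> x}"
      proof -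
        have "X z \<le> x \<longleftrightarrow> Z z \<le> cdf \<sigma> x" for z
          using \<sigma>.pseudoinverse[of "Z z" x] Z(2)[of z] by (simp add: X_def)
        then show ?thesis by simp
      qed
      also have "measure M \<dots> = cdf \<sigma> x"
        by (intro Z_le \<sigma>.cdf_nonneg \<sigma>.cdf_bounded_prob)
      finally show "cdf (distr M borel X) x = cdf \<sigma> x" .
    qed
  qed fact
  with X that show ?thesis by blast
qed

text \<open>The law is encoded on the line by \<open>s\<close>, realised there by \<open>T\<close>
  and decoded by \<open>\<phi>\<close>; as \<open>\<phi>\<close> undoes \<open>s\<close> on
  \<open>C\<close>, the decoded variable has law \<rho>.\<close>

lemma atomless_law_exists:
  fixes M :: "'b::polish_space measure" and C :: "'a::euclidean_space set"
  assumes M: "prob_space M" "sets M = sets borel" "atomless M"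
    and C: "bounded C" "C \<in> sets borel" and \<rho>: "\<rho> \<in> P2 C"
  obtains X where "X \<in> L2_space M C" "distr M (borel_on C) X = \<rho>"
proof -
  interpret prob_space M by fact
  have \<rho>': "prob_space \<rho>" "sets \<rho> = sets (borel_on C)"
    using \<rho> by (auto simp: P2_def)
  interpret \<rho>: prob_space \<rho> by fact
  have sp: "space M = UNIV" "space \<rho> = C"
    using sets_eq_imp_space_eq[OF M(2)] sets_eq_imp_space_eq[OF \<rho>'(2)]
    by (auto simp: space_restrict_space)
  obtain c where c: "c \<in> C"
    using \<rho>.not_empty sp by auto
  obtain \<phi> :: "real \<Rightarrow> 'a" and s :: "'a \<Rightarrow> real"
    where \<phi>: "continuous_on UNIV \<phi>" and "bounded (range \<phi>)"
      and s: "s \<in> borel_measurable borel" and "\<And>x. s x \<in> {0..1}"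
      and sec: "\<And>x. x \<in> C \<Longrightarrow> \<phi> (s x) = x"
  proof (rule measurable_section_exists[OF \<open>bounded C\<close>], goal_cases)
    case (1 \<phi> s)
    show ?thesis by (rule 1(1)) (fact 1)+
  qed
  have s_\<rho>: "s \<in> borel_measurable \<rho>"
    using s by (simp add: measurable_cong_sets[OF \<rho>'(2) refl] measurable_restrict_space1)
  have \<phi>_m: "\<phi> \<in> borel_measurable borel"
    by (rule borel_measurable_continuous_onI[OF \<phi>])
  obtain T where T: "T \<in> borel_measurable M" "distr M borel T = distr \<rho> borel s"
    using atomless_real_law_exists[OF M \<rho>.real_distribution_distr[OF s_\<rho>]] .
  have [measurable]: "T \<in> borel_measurable M" "\<phi> \<in> borel_measurable borel" "C \<in> sets borel"
    by fact+
  have law: "emeasure M {z. \<phi> (T z) \<in> A} = emeasure \<rho> (A \<inter> C)" if A: "A \<in> sets borel" for A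
  proof -
    have A': "\<phi> -` A \<in> sets borel"
      using measurable_sets[OF \<phi>_m A] by simp
    have "emeasure M {z. \<phi> (T z) \<in> A} = emeasure (distr M borel T) (\<phi> -` A)"
      using A' by (subst emeasure_distr) (auto simp: sp intro!: arg_cong[where f="emeasure M"])
    also have "\<dots> = emeasure \<rho> (A \<inter> C)"
      unfolding T(2) using A' s_\<rho>
      by (subst emeasure_distr) (auto simp: sp sec intro!: arg_cong[where f="emeasure \<rho>"])
    finally show ?thesis .
  qed
  \<comment> \<open>\<open>L2_space\<close> asks for values in \<open>C\<close> everywhere, so the
    null set on which decoding leaves \<open>C\<close> is sent to \<open>c\<close>.\<close>
  define X where "X z = (if \<phi> (T z) \<in> C then \<phi> (T z) else c)" for z
  have X: "X \<in> M \<rightarrow>\<^sub>M borel_on C"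
    unfolding X_def using c by (intro measurable_restrict_space2) auto
  have "measure M {z. \<phi> (T z) \<in> C} = 1"
    using law[OF C(2)] \<rho>.emeasure_space_1 by (simp add: measure_def sp)
  from AE_prob_1[OF this] have in_C: "AE z in M. \<phi> (T z) \<in> C" by simp
  have "distr M (borel_on C) X = \<rho>"
  proof (rule measure_eqI)
    fix A assume "A \<in> sets (distr M (borel_on C) X)"
    then have A: "A \<in> sets (borel_on C)" by simp
    then have A': "A \<in> sets borel" "A \<inter> C = A"
      using C by (auto simp: sets_restrict_space_iff)
    have "emeasure (distr M (borel_on C) X) A = emeasure M (X -` A \<inter> space M)"
      by (rule emeasure_distr[OF X A])
    also have "\<dots> = emeasure M {z. \<phi> (T z) \<in> A}"
    proof (rule emeasure_eq_AE)
      show "AE z in M. (z \<in> X -` A \<inter> space M) = (z \<in> {z. \<phi> (T z) \<in> A})"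
        using in_C by eventually_elim (simp add: X_def sp)
      show "X -` A \<inter> space M \<in> sets M"
        by (rule measurable_sets[OF X A])
      have "(\<lambda>z. \<phi> (T z)) \<in> borel_measurable M" by measurable
      from measurable_sets[OF this A'(1)] show "{z. \<phi> (T z) \<in> A} \<in> sets M"
        by (simp add: vimage_def sp)
    qed
    also have "\<dots> = emeasure \<rho> A"
      using law[OF A'(1)] A'(2) by simp
    finally show "emeasure (distr M (borel_on C) X) A = emeasure \<rho> A" .
  qed (simp add: \<rho>')
  moreover have "X \<in> L2_space M C"
  proof -
    obtain B where B: "\<And>x. x \<in> C \<Longrightarrow> norm x \<le> B"
      using \<open>bounded C\<close> by (auto simp: bounded_iff)
    have "norm ((norm (X z))\<^sup>2) \<le> B\<^sup>2" for z
      using power_mono[OF B[of "X z"] norm_ge_zero, of 2] c by (auto simp: X_def)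
    moreover have [measurable]: "X \<in> borel_measurable M"
      using X by (simp add: measurable_restrict_space2_iff)
    ultimately show ?thesis
      unfolding L2_space_def using X
      by (auto intro!: integrable_const_bound[where B="B\<^sup>2"] AE_I2)
  qed
  ultimately show ?thesis
    using that by blast
qed

section \<open>Remainder estimates\<close>

text \<open>Mean value inequality on the segment from \<open>x\<close> to \<open>y\<close> for
  \<open>f z - \<xi> x \<bullet> z\<close>, whose gradient there has norm at most
  \<open>K * norm (y - x)\<close>. The segment stays in \<open>S\<close>, so derivatives relative to
  \<open>S\<close> suffice and boundary points are covered.\<close>

lemma convex_quadratic_remainder:
  fixes f :: "'a::euclidean_space \<Rightarrow> real" and \<xi> :: "'a \<Rightarrow> 'a"
  assumes "convex S" and deriv: "\<And>x. x \<in> S \<Longrightarrow> (f has_derivative (\<lambda>h. \<xi> x \<bullet> h)) (at x within S)"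
    and lip: "\<And>x y. x \<in> S \<Longrightarrow> y \<in> S \<Longrightarrow> norm (\<xi> x - \<xi> y) \<le> K * norm (x - y)"
    and xy: "x \<in> S" "y \<in> S" and "0 \<le> K"
  shows "\<bar>f y - f x - \<xi> x \<bullet> (y - x)\<bar> \<le> K * (norm (y - x))\<^sup>2"
proof -
  let ?S = "closed_segment x y"
  let ?h = "\<lambda>z. f z - \<xi> x \<bullet> z"
  have sub: "?S \<subseteq> S"
    using \<open>convex S\<close> xy by (rule closed_segment_subset[rotated 2])
  have "norm (?h y - ?h x) \<le> K * norm (y - x) * norm (y - x)"
  proof (rule differentiable_bound[of ?S])
    fix z assume z: "z \<in> ?S"
    then have "(f has_derivative (\<lambda>h. \<xi> z \<bullet> h)) (at z within ?S)"
      using deriv sub has_derivative_subset by blast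
    then show "(?h has_derivative (\<lambda>h. \<xi> z \<bullet> h - \<xi> x \<bullet> h)) (at z within ?S)"
      by (auto intro!: derivative_eq_intros)
    have "norm (\<xi> z - \<xi> x) \<le> K * norm (z - x)"
      using z sub xy by (intro lip) auto
    also have "\<dots> \<le> K * norm (y - x)"
      using segment_bound1[OF z] \<open>0 \<le> K\<close> by (intro mult_left_mono) auto
    finally have le: "norm (\<xi> z - \<xi> x) \<le> K * norm (y - x)" .
    show "onorm (\<lambda>h. \<xi> z \<bullet> h - \<xi> x \<bullet> h) \<le> K * norm (y - x)"
    proof (rule onorm_le)
      fix h
      have "norm (\<xi> z \<bullet> h - \<xi> x \<bullet> h) \<le> norm (\<xi> z - \<xi> x) * norm h"
        using Cauchy_Schwarz_ineq2[of "\<xi> z - \<xi> x" h] by (simp add: inner_diff_left)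
      also have "\<dots> \<le> K * norm (y - x) * norm h"
        using le by (rule mult_right_mono) simp
      finally show "norm (\<xi> z \<bullet> h - \<xi> x \<bullet> h) \<le> K * norm (y - x) * norm h" .
    qed
  qed auto
  then show ?thesis
    by (simp add: inner_diff_right power2_eq_square algebra_simps)
qed

text \<open>This serves to differentiate under the integral sign: quadratic bounds integrate, and
  the derivative is then read off from the integrated bound.\<close>

lemma has_derivative_quadratic_remainder:
  fixes f :: "'a::euclidean_space \<Rightarrow> real"
  assumes "\<And>y. y \<in> S \<Longrightarrow> \<bar>f y - f x - v \<bullet> (y - x)\<bar> \<le> K * (norm (y - x))\<^sup>2"
  shows "(f has_derivative (\<lambda>h. v \<bullet> h)) (at x within S)"
proof -
  \<comment> \<open>Enlarging the constant to a positive one makes the radius \<open>e / K'\<close>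
    available whatever the sign of \<open>K\<close>.\<close>
  define K' where "K' = \<bar>K\<bar> + 1"
  have K': "\<bar>f y - f x - v \<bullet> (y - x)\<bar> \<le> K' * (norm (y - x))\<^sup>2" "K' > 0" if "y \<in> S" for y
  proof -
    have "K * (norm (y - x))\<^sup>2 \<le> K' * (norm (y - x))\<^sup>2"
      by (intro mult_right_mono) (auto simp: K'_def)
    with assms[OF that] show "\<bar>f y - f x - v \<bullet> (y - x)\<bar> \<le> K' * (norm (y - x))\<^sup>2" by linarith
  qed (simp add: K'_def)
  show ?thesis
    unfolding has_derivative_within_alt
  proof (intro conjI allI impI bounded_linear_inner_right)
    fix e :: real assume "e > 0"
    have "norm (f y - f x - v \<bullet> (y - x)) \<le> e * norm (y - x)"
      if "y \<in> S" "norm (y - x) < e / K'" for y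
    proof -
      have "norm (f y - f x - v \<bullet> (y - x)) \<le> K' * norm (y - x) * norm (y - x)"
        using K'(1)[OF that(1)] by (simp add: power2_eq_square mult.assoc)
      also have "\<dots> \<le> e * norm (y - x)"
        using that(2) K'(2)[OF that(1)] by (intro mult_right_mono) (auto simp: field_simps)
      finally show ?thesis .
    qed
    moreover have "0 < K'" by (simp add: K'_def)
    ultimately show "\<exists>d>0. \<forall>y\<in>S. norm (y - x) < d \<longrightarrow>
        norm (f y - f x - v \<bullet> (y - x)) \<le> e * norm (y - x)"
      using \<open>e > 0\<close> by (intro exI[of _ "e / K'"]) auto
  qed
qed

text \<open>The inequality \<open>ln t \<le> t - 1\<close> at \<open>b / a\<close> and at
  \<open>a / b\<close> encloses \<open>ln b - ln a\<close> between \<open>1 - a / b\<close> and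
  \<open>(b - a) / a\<close>, and these two ends differ by exactly
  \<open>(b - a)\<^sup>2 / (a * b)\<close>.\<close>

lemma abs_ln_remainder:
  fixes a b m :: real
  assumes "0 < m" "m \<le> a" "m \<le> b"
  shows "\<bar>ln b - ln a - (b - a) / a\<bar> \<le> (b - a)\<^sup>2 / m\<^sup>2"
proof -
  have pos: "0 < a" "0 < b" using assms by auto
  have "ln b - ln a \<le> b / a - 1"
    using ln_le_minus_one[of "b / a"] pos by (simp add: ln_div)
  moreover have "ln a - ln b \<le> a / b - 1"
    using ln_le_minus_one[of "a / b"] pos by (simp add: ln_div)
  moreover have "b / a - 1 = (b - a) / a" "(b - a) / a - (1 - a / b) = (b - a)\<^sup>2 / (a * b)"
    using pos by (auto simp: field_simps power2_eq_square)
  ultimately have "\<bar>ln b - ln a - (b - a) / a\<bar> \<le> (b - a)\<^sup>2 / (a * b)" by linarith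
  also have "\<dots> \<le> (b - a)\<^sup>2 / m\<^sup>2"
    using assms by (intro divide_left_mono) (auto simp: power2_eq_square intro!: mult_mono mult_pos_pos)
  finally show ?thesis .
qed

lemma (in prob_space) square_integral_le:
  fixes f :: "'a \<Rightarrow> real"
  assumes "integrable M f" "integrable M (\<lambda>x. (f x)\<^sup>2)"
  shows "(\<integral>x. f x \<partial>M)\<^sup>2 \<le> (\<integral>x. (f x)\<^sup>2 \<partial>M)"
  using variance_eq[OF assms] variance_positive[of f] by linarith

section \<open>Derivative bounds for the Gaussian kernel\<close>

definition gauss_grad :: "real \<Rightarrow> 'a::euclidean_space \<Rightarrow> 'a" where
  "gauss_grad \<epsilon> u = (- gauss_kernel \<epsilon> u / \<epsilon>) *\<^sub>R u"

lemma gauss_kernel_pos: "0 < gauss_kernel \<epsilon> u"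
  by (simp add: gauss_kernel_def)

lemma gauss_kernel_le_1: "0 < \<epsilon> \<Longrightarrow> gauss_kernel \<epsilon> u \<le> 1"
  by (simp add: gauss_kernel_def)

lemma gauss_kernel_minus_commute: "gauss_kernel \<epsilon> (x - y) = gauss_kernel \<epsilon> (y - x)"
  by (simp add: gauss_kernel_def norm_minus_commute)

lemma gauss_grad_minus_commute: "gauss_grad \<epsilon> (x - y) = - gauss_grad \<epsilon> (y - x)"
  by (simp add: gauss_grad_def gauss_kernel_minus_commute[of _ x y] scaleR_diff_right)

lemma gauss_kernel_has_derivative:
  assumes "0 < \<epsilon>"
  shows "(gauss_kernel \<epsilon> has_derivative (\<lambda>h. gauss_grad \<epsilon> u \<bullet> h)) (at u within S)"
  unfolding gauss_kernel_def gauss_grad_def power2_norm_eq_inner using assms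
  by (auto intro!: derivative_eq_intros simp: inner_commute field_simps)

lemma continuous_on_gauss_kernel: "continuous_on S (gauss_kernel \<epsilon>)"
  unfolding gauss_kernel_def divide_inverse by (intro continuous_intros)

lemma gauss_kernel_measurable [measurable]: "gauss_kernel \<epsilon> \<in> borel_measurable borel"
  by (rule borel_measurable_continuous_onI[OF continuous_on_gauss_kernel])

lemma gauss_grad_measurable [measurable]: "gauss_grad \<epsilon> \<in> borel_measurable borel"
  unfolding gauss_grad_def by measurable

text \<open>This is \<open>s * exp (- s) \<le> 1\<close> for
  \<open>s = (norm u)\<^sup>2 / (2 * \<epsilon>)\<close>.\<close>

lemma gauss_kernel_norm_sq_le:
  assumes "0 < \<epsilon>"
  shows "gauss_kernel \<epsilon> u * (norm u)\<^sup>2 \<le> 2 * \<epsilon>"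
proof -
  define s where "s = (norm u)\<^sup>2 / (2 * \<epsilon>)"
  have "s \<le> exp s"
    using exp_ge_add_one_self[of s] by linarith
  then have "exp (- s) * s \<le> 1"
    by (simp add: exp_minus field_simps)
  then have "exp (- s) * ((norm u)\<^sup>2 / (2 * \<epsilon>)) \<le> 1"
    by (simp add: s_def)
  then show ?thesis
    using assms by (simp add: gauss_kernel_def s_def field_simps)
qed

text \<open>The constant comes from \<open>norm u \<le> 1 + (norm u)\<^sup>2\<close>: the kernel
  times the right-hand side is at most \<open>1 + 2 * \<epsilon>\<close>, and the gradient carries a
  factor \<open>1 / \<epsilon>\<close>.\<close>

lemma norm_gauss_grad_le:
  assumes "0 < \<epsilon>"
  shows "norm (gauss_grad \<epsilon> u) \<le> 2 + 1 / \<epsilon>"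
proof -
  have "2 * norm u \<le> 1 + (norm u)\<^sup>2"
    using zero_le_power2[of "norm u - 1"] by (simp add: power2_diff)
  then have "norm u \<le> 1 + (norm u)\<^sup>2"
    using norm_ge_zero[of u] by linarith
  then have "gauss_kernel \<epsilon> u * norm u \<le> gauss_kernel \<epsilon> u * (1 + (norm u)\<^sup>2)"
    by (rule mult_left_mono) (rule less_imp_le[OF gauss_kernel_pos])
  also have "\<dots> \<le> 1 + 2 * \<epsilon>"
    using gauss_kernel_norm_sq_le[OF assms, of u] gauss_kernel_le_1[OF assms, of u]
    by (simp add: algebra_simps)
  finally show ?thesis
    using assms gauss_kernel_pos[of \<epsilon> u] by (simp add: gauss_grad_def field_simps)
qed

text \<open>The Hessian of the kernel is the kernel times a rank-one part, the square of
  \<open>w\<close> over \<open>\<epsilon>\<^sup>2\<close>, minus the identity over \<epsilon>. By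
  \<open>gauss_kernel_norm_sq_le\<close> the first part contributes at most
  \<open>2 / \<epsilon>\<close>, the second at most \<open>1 / \<epsilon>\<close>.\<close>

lemma gauss_grad_lipschitz:
  assumes "0 < \<epsilon>"
  shows "norm (gauss_grad \<epsilon> u - gauss_grad \<epsilon> v) \<le> 3 / \<epsilon> * norm (u - v)"
proof (rule differentiable_bound[of UNIV])
  fix w :: 'a
  let ?D = "\<lambda>h. (- (gauss_grad \<epsilon> w \<bullet> h) / \<epsilon>) *\<^sub>R w + (- gauss_kernel \<epsilon> w / \<epsilon>) *\<^sub>R h"
  show "(gauss_grad \<epsilon> has_derivative ?D) (at w within UNIV)"
    unfolding gauss_grad_def[abs_def] using assms
    by (auto intro!: derivative_eq_intros gauss_kernel_has_derivative simp: gauss_grad_def)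
  show "onorm ?D \<le> 3 / \<epsilon>"
  proof (rule onorm_le)
    fix h
    have "norm (?D h) \<le> norm ((- (gauss_grad \<epsilon> w \<bullet> h) / \<epsilon>) *\<^sub>R w) + norm ((- gauss_kernel \<epsilon> w / \<epsilon>) *\<^sub>R h)"
      by (rule norm_triangle_ineq)
    also have "\<dots> = \<bar>gauss_grad \<epsilon> w \<bullet> h\<bar> / \<epsilon> * norm w + gauss_kernel \<epsilon> w / \<epsilon> * norm h"
      using assms gauss_kernel_pos[of \<epsilon> w] by (simp add: abs_mult)
    also have "\<dots> \<le> 2 / \<epsilon> * norm h + 1 / \<epsilon> * norm h"
    proof (rule add_mono)
      have "\<bar>gauss_grad \<epsilon> w \<bullet> h\<bar> * norm w \<le> norm (gauss_grad \<epsilon> w) * norm h * norm w"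
        by (intro mult_right_mono Cauchy_Schwarz_ineq2) simp
      also have "\<dots> = gauss_kernel \<epsilon> w * (norm w)\<^sup>2 / \<epsilon> * norm h"
        using assms gauss_kernel_pos[of \<epsilon> w] by (simp add: gauss_grad_def power2_eq_square)
      also have "\<dots> \<le> 2 * norm h"
        using gauss_kernel_norm_sq_le[OF assms, of w] assms
        by (intro mult_right_mono) (auto simp: field_simps)
      finally have "\<bar>gauss_grad \<epsilon> w \<bullet> h\<bar> * norm w / \<epsilon> \<le> 2 * norm h / \<epsilon>"
        using assms by (intro divide_right_mono) auto
      then show "\<bar>gauss_grad \<epsilon> w \<bullet> h\<bar> / \<epsilon> * norm w \<le> 2 / \<epsilon> * norm h" by simp
      show "gauss_kernel \<epsilon> w / \<epsilon> * norm h \<le> 1 / \<epsilon> * norm h"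
        using gauss_kernel_le_1[OF assms, of w] assms
        by (intro mult_right_mono divide_right_mono) auto
    qed
    finally show "norm (?D h) \<le> 3 / \<epsilon> * norm h"
      by (simp add: add_divide_distrib[symmetric] distrib_right[symmetric])
  qed
qed auto

lemma gauss_kernel_remainder:
  fixes u v :: "'a::euclidean_space"
  assumes "0 < \<epsilon>"
  shows "\<bar>gauss_kernel \<epsilon> v - gauss_kernel \<epsilon> u - gauss_grad \<epsilon> u \<bullet> (v - u)\<bar> \<le> 3 / \<epsilon> * (norm (v - u))\<^sup>2"
  by (rule convex_quadratic_remainder[of UNIV])
     (use assms gauss_kernel_has_derivative gauss_grad_lipschitz in auto)

lemma gauss_kernel_lipschitz:
  fixes u v :: "'a::euclidean_space"
  assumes "0 < \<epsilon>"
  shows "\<bar>gauss_kernel \<epsilon> v - gauss_kernel \<epsilon> u\<bar> \<le> (2 + 1 / \<epsilon>) * norm (v - u)"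
proof -
  have "norm (gauss_kernel \<epsilon> v - gauss_kernel \<epsilon> u) \<le> (2 + 1 / \<epsilon>) * norm (v - u)"
  proof (rule differentiable_bound[of UNIV])
    fix w :: 'a
    show "(gauss_kernel \<epsilon> has_derivative (\<lambda>h. gauss_grad \<epsilon> w \<bullet> h)) (at w within UNIV)"
      by (rule gauss_kernel_has_derivative[OF assms])
    show "onorm (\<lambda>h. gauss_grad \<epsilon> w \<bullet> h) \<le> 2 + 1 / \<epsilon>"
    proof (rule onorm_le)
      fix h :: 'a
      have "norm (gauss_grad \<epsilon> w \<bullet> h) \<le> norm (gauss_grad \<epsilon> w) * norm h"
        using Cauchy_Schwarz_ineq2 by simp
      also have "\<dots> \<le> (2 + 1 / \<epsilon>) * norm h"
        by (rule mult_right_mono[OF norm_gauss_grad_le[OF assms] norm_ge_zero])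
      finally show "norm (gauss_grad \<epsilon> w \<bullet> h) \<le> (2 + 1 / \<epsilon>) * norm h" .
    qed
  qed auto
  then show ?thesis by simp
qed

section \<open>Integration against convex combinations\<close>

text \<open>The mixture is the law of a sample drawn from \<nu> or \<rho> after the toss of a coin
  with bias \<open>t\<close>. Written as a bind over \<open>bernoulli_pmf t\<close>, the set
  function in \<open>mix\<close> is seen to be a measure, and integrals split over the two
  outcomes.\<close>

lemma integral_mix:
  fixes f :: "'a \<Rightarrow> real"
  assumes \<rho>: "prob_space \<rho>" and \<nu>: "prob_space \<nu>" and sets: "sets \<nu> = sets \<rho>" and t: "0 \<le> t" "t \<le> 1"
    and f: "f \<in> borel_measurable \<rho>" "\<And>x. x \<in> space \<rho> \<Longrightarrow> \<bar>f x\<bar> \<le> B"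
  shows "(\<integral>x. f x \<partial>mix t \<rho> \<nu>) = (1 - t) * (\<integral>x. f x \<partial>\<rho>) + t * (\<integral>x. f x \<partial>\<nu>)"
    and "prob_space (mix t \<rho> \<nu>)" and "sets (mix t \<rho> \<nu>) = sets \<rho>"
proof -
  interpret \<rho>: prob_space \<rho> by fact
  interpret \<nu>: prob_space \<nu> by fact
  let ?N = "\<lambda>b. if b then \<nu> else \<rho>"
  let ?b = "measure_pmf (bernoulli_pmf t)"
  have N: "?N \<in> ?b \<rightarrow>\<^sub>M prob_algebra \<rho>"
    by (auto simp: space_prob_algebra sets \<rho> \<nu>)
  have N': "?N \<in> ?b \<rightarrow>\<^sub>M subprob_algebra \<rho>"
    using N by (rule measurable_prob_algebraD)
  have sets_bind: "sets (?b \<bind> ?N) = sets \<rho>"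
    by (rule sets_bind) (auto simp: sets)
  have emeasure: "emeasure (?b \<bind> ?N) A = ennreal (1 - t) * emeasure \<rho> A + ennreal t * emeasure \<nu> A"
    if "A \<in> sets \<rho>" for A
  proof -
    have "emeasure (?b \<bind> ?N) A = (\<integral>\<^sup>+b. emeasure (?N b) A \<partial>?b)"
      by (rule emeasure_bind[OF _ N' that]) simp
    also have "\<dots> = ennreal (1 - t) * emeasure \<rho> A + ennreal t * emeasure \<nu> A"
      using t by (subst nn_integral_bernoulli_pmf) (auto simp: ac_simps)
    finally show ?thesis .
  qed
  have mix: "mix t \<rho> \<nu> = ?b \<bind> ?N"
  proof -
    have "mix t \<rho> \<nu> = measure_of (space \<rho>) (sets \<rho>) (emeasure (?b \<bind> ?N))"
      unfolding mix_def
      by (rule measure_of_eq[OF sets.space_closed]) (simp add: emeasure sets.sigma_sets_eq)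
    also have "\<dots> = ?b \<bind> ?N"
      using measure_of_of_measure[of "?b \<bind> ?N"] sets_bind sets_eq_imp_space_eq[OF sets_bind] by simp
    finally show ?thesis .
  qed
  show "sets (mix t \<rho> \<nu>) = sets \<rho>"
    by (simp add: mix sets_bind)
  show "prob_space (mix t \<rho> \<nu>)"
    unfolding mix by (rule measure_pmf.prob_space_bind[OF _ N']) (use \<rho> \<nu> in \<open>auto intro!: AE_I2\<close>)
  have "(\<integral>x. f x \<partial>mix t \<rho> \<nu>) = (\<integral>b. (\<integral>x. f x \<partial>?N b) \<partial>?b)"
    unfolding mix
    by (rule integral_bind[OF f(1) _ N', where B=B and B'=1])
       (use f(2) sets_eq_imp_space_eq[OF sets] \<rho>.emeasure_space_1 \<nu>.emeasure_space_1 in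
         \<open>auto simp: measure_pmf.finite_measure_axioms intro!: AE_I2\<close>)
  also have "\<dots> = (1 - t) * (\<integral>x. f x \<partial>\<rho>) + t * (\<integral>x. f x \<partial>\<nu>)"
    using t by (subst integral_bernoulli_pmf) auto
  finally show "(\<integral>x. f x \<partial>mix t \<rho> \<nu>) = (1 - t) * (\<integral>x. f x \<partial>\<rho>) + t * (\<integral>x. f x \<partial>\<nu>)" .
qed

section \<open>The energy and its gradient field\<close>

text \<open>Both nonlocal terms of \<open>reg_energy_variation\<close> have this shape: weight 1
  gives \<open>gauss_conv\<close>, and weight \<open>1 / gauss_conv \<epsilon> \<rho> z\<close>
  gives the integral term. One differentiation serves both.\<close>

definition weighted_conv :: "real \<Rightarrow> 'a::euclidean_space measure \<Rightarrow> ('a \<Rightarrow> real) \<Rightarrow> 'a \<Rightarrow> real" where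
  "weighted_conv \<epsilon> \<rho> w x = (\<integral>z. w z * gauss_kernel \<epsilon> (x - z) \<partial>\<rho>)"

definition weighted_conv_grad :: "real \<Rightarrow> 'a::euclidean_space measure \<Rightarrow> ('a \<Rightarrow> real) \<Rightarrow> 'a \<Rightarrow> 'a" where
  "weighted_conv_grad \<epsilon> \<rho> w x = (\<integral>z. w z *\<^sub>R gauss_grad \<epsilon> (x - z) \<partial>\<rho>)"

text \<open>The gradient of \<open>reg_energy_variation\<close> in closed form: the middle summand
  comes from the integral term, the last one from the logarithm.\<close>

definition energy_field :: "('a \<Rightarrow> 'a) \<Rightarrow> real \<Rightarrow> 'a::euclidean_space measure \<Rightarrow> 'a \<Rightarrow> 'a" where
  "energy_field dU \<epsilon> \<rho> x = dU x + weighted_conv_grad \<epsilon> \<rho> (\<lambda>z. 1 / gauss_conv \<epsilon> \<rho> z) x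
     + (1 / gauss_conv \<epsilon> \<rho> x) *\<^sub>R weighted_conv_grad \<epsilon> \<rho> (\<lambda>_. 1) x"

lemma gauss_conv_eq_weighted_conv: "gauss_conv \<epsilon> \<rho> x = weighted_conv \<epsilon> \<rho> (\<lambda>_. 1) x"
  by (simp add: gauss_conv_def weighted_conv_def)

section \<open>Differentiation of weighted Gaussian convolutions\<close>

context
  fixes \<rho> :: "'a::euclidean_space measure" and C :: "'a set" and \<epsilon> :: real and w :: "'a \<Rightarrow> real" and W :: real
  assumes \<rho>: "prob_space \<rho>" "sets \<rho> = sets (borel_on C)" and \<epsilon>: "0 < \<epsilon>"
    and w: "w \<in> borel_measurable \<rho>" "\<And>z. z \<in> C \<Longrightarrow> \<bar>w z\<bar> \<le> W"
begin

interpretation prob_space \<rho> by fact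

lemma weight_bound_nonneg: "0 \<le> W"
  using not_empty w(2) abs_ge_zero order_trans unfolding space_eq_of_sets_borel_on[OF \<rho>(2)] by blast

lemma weighted_conv_integrable: "integrable \<rho> (\<lambda>z. w z * gauss_kernel \<epsilon> (x - z))"
proof (rule integrable_const_bound[where B=W])
  show "AE z in \<rho>. norm (w z * gauss_kernel \<epsilon> (x - z)) \<le> W"
  proof (rule AE_I2)
    fix z assume "z \<in> space \<rho>"
    then have "\<bar>w z\<bar> * \<bar>gauss_kernel \<epsilon> (x - z)\<bar> \<le> W * 1"
      using gauss_kernel_pos[of \<epsilon> "x - z"] gauss_kernel_le_1[OF \<epsilon>, of "x - z"] w(2)
      by (intro mult_mono weight_bound_nonneg) (auto simp: space_eq_of_sets_borel_on[OF \<rho>(2)])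
    then show "norm (w z * gauss_kernel \<epsilon> (x - z)) \<le> W" by (simp add: abs_mult)
  qed
qed (use w(1) measurable_ident_borel_on[OF \<rho>(2)] in measurable)

lemma weighted_conv_grad_norm_le:
  "z \<in> C \<Longrightarrow> norm (w z *\<^sub>R gauss_grad \<epsilon> (x - z)) \<le> W * (2 + 1 / \<epsilon>)"
  using w(2)[of z] norm_gauss_grad_le[OF \<epsilon>, of "x - z"] weight_bound_nonneg by (auto intro!: mult_mono)

lemma weighted_conv_grad_integrable: "integrable \<rho> (\<lambda>z. w z *\<^sub>R gauss_grad \<epsilon> (x - z))"
  by (rule integrable_const_bound[where B="W * (2 + 1 / \<epsilon>)"])
     (use w(1) measurable_ident_borel_on[OF \<rho>(2)] weighted_conv_grad_norm_le in \<open>auto simp: space_eq_of_sets_borel_on[OF \<rho>(2)]\<close>)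

text \<open>The bound on the kernel remainder does not depend on \<open>z\<close>, so integrating it
  against a weight bounded by \<open>W\<close> multiplies it by \<open>W\<close> and keeps it
  quadratic.\<close>

lemma weighted_conv_remainder:
  "\<bar>weighted_conv \<epsilon> \<rho> w y - weighted_conv \<epsilon> \<rho> w x - weighted_conv_grad \<epsilon> \<rho> w x \<bullet> (y - x)\<bar>
     \<le> W * (3 / \<epsilon>) * (norm (y - x))\<^sup>2"
proof -
  let ?r = "\<lambda>z. gauss_kernel \<epsilon> (y - z) - gauss_kernel \<epsilon> (x - z) - gauss_grad \<epsilon> (x - z) \<bullet> (y - x)"
  note [simp] = weighted_conv_integrable weighted_conv_grad_integrable
  have "weighted_conv_grad \<epsilon> \<rho> w x \<bullet> (y - x) = (\<integral>z. (w z *\<^sub>R gauss_grad \<epsilon> (x - z)) \<bullet> (y - x) \<partial>\<rho>)"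
    unfolding weighted_conv_grad_def by (rule integral_inner_left[symmetric]) simp
  moreover have "integrable \<rho> (\<lambda>z. (w z *\<^sub>R gauss_grad \<epsilon> (x - z)) \<bullet> (y - x))"
    by (rule integrable_inner_left) simp
  ultimately have eq: "weighted_conv \<epsilon> \<rho> w y - weighted_conv \<epsilon> \<rho> w x - weighted_conv_grad \<epsilon> \<rho> w x \<bullet> (y - x)
      = (\<integral>z. w z * ?r z \<partial>\<rho>)" and int: "integrable \<rho> (\<lambda>z. w z * ?r z)"
    by (simp_all add: weighted_conv_def right_diff_distrib)
  have "norm (\<integral>z. w z * ?r z \<partial>\<rho>) \<le> (\<integral>z. norm (w z * ?r z) \<partial>\<rho>)"
    by (rule integral_norm_bound)
  also have "\<dots> \<le> W * (3 / \<epsilon>) * (norm (y - x))\<^sup>2"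
  proof (rule integral_le_const)
    show "AE z in \<rho>. norm (w z * ?r z) \<le> W * (3 / \<epsilon>) * (norm (y - x))\<^sup>2"
    proof (rule AE_I2)
      fix z assume "z \<in> space \<rho>"
      then have "\<bar>w z\<bar> * \<bar>?r z\<bar> \<le> W * (3 / \<epsilon> * (norm (y - x))\<^sup>2)"
        using gauss_kernel_remainder[OF \<epsilon>, of "y - z" "x - z"] w(2) weight_bound_nonneg
        by (intro mult_mono) (auto simp: space_eq_of_sets_borel_on[OF \<rho>(2)])
      then show "norm (w z * ?r z) \<le> W * (3 / \<epsilon>) * (norm (y - x))\<^sup>2"
        by (simp add: abs_mult)
    qed
  qed (use int in simp)
  finally show ?thesis
    unfolding eq by simp
qed

lemma weighted_conv_has_derivative:
  "(weighted_conv \<epsilon> \<rho> w has_derivative (\<lambda>h. weighted_conv_grad \<epsilon> \<rho> w x \<bullet> h)) (at x within S)"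
  by (rule has_derivative_quadratic_remainder[OF weighted_conv_remainder])

lemma norm_weighted_conv_grad_le: "norm (weighted_conv_grad \<epsilon> \<rho> w x) \<le> W * (2 + 1 / \<epsilon>)"
proof -
  have "norm (weighted_conv_grad \<epsilon> \<rho> w x) \<le> (\<integral>z. norm (w z *\<^sub>R gauss_grad \<epsilon> (x - z)) \<partial>\<rho>)"
    unfolding weighted_conv_grad_def by (rule integral_norm_bound)
  also have "\<dots> \<le> W * (2 + 1 / \<epsilon>)"
    by (rule integral_le_const[OF integrable_norm[OF weighted_conv_grad_integrable]])
       (use weighted_conv_grad_norm_le in \<open>auto simp: space_eq_of_sets_borel_on[OF \<rho>(2)] intro!: AE_I2\<close>)
  finally show ?thesis .
qed

lemma continuous_on_weighted_conv: "continuous_on S (weighted_conv \<epsilon> \<rho> w)"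
  unfolding continuous_on_eq_continuous_within
  by (intro ballI has_derivative_continuous[OF weighted_conv_has_derivative])

lemma weighted_conv_grad_measurable: "weighted_conv_grad \<epsilon> \<rho> w \<in> borel_measurable borel"
  unfolding weighted_conv_grad_def using w(1) measurable_ident_borel_on[OF \<rho>(2)] by measurable

end

section \<open>The energy on a bounded convex domain\<close>

locale reg_energy_domain =
  fixes C :: "'a::euclidean_space set" and U :: "'a \<Rightarrow> real" and dU :: "'a \<Rightarrow> 'a" and \<epsilon> K :: real
  assumes bounded: "bounded C" and convex: "convex C" and borel: "C \<in> sets borel" and nonempty: "C \<noteq> {}"
    and \<epsilon>: "0 < \<epsilon>" and grad: "is_gradient_on C U dU" and lip: "K-lipschitz_on C dU"
begin

definition D where "D = diameter C"

text \<open>A lower bound for the kernel at differences of points of \<open>C\<close>. It bounds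
  \<open>gauss_conv\<close> on \<open>C\<close> from below for every law at once, which makes the
  later constants independent of the law.\<close>

definition m where "m = exp (- (D\<^sup>2 / (2 * \<epsilon>)))"

lemma m_pos: "0 < m" and m_le_1: "m \<le> 1"
  using \<epsilon> by (auto simp: m_def)

lemma m_le_gauss_kernel:
  assumes "x \<in> C" "y \<in> C"
  shows "m \<le> gauss_kernel \<epsilon> (x - y)"
proof -
  have "norm (x - y) \<le> D"
    using diameter_bounded_bound[OF bounded assms] by (simp add: D_def dist_norm)
  then have "(norm (x - y))\<^sup>2 \<le> D\<^sup>2"
    by (intro power_mono) auto
  then show ?thesis
    using \<epsilon> by (simp add: m_def gauss_kernel_def divide_right_mono)
qed

lemma P2_D:
  assumes "\<rho> \<in> P2 C"
  shows "prob_space \<rho>" "sets \<rho> = sets (borel_on C)" "space \<rho> = C"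
  using assms by (auto simp: P2_def dest: space_eq_of_sets_borel_on)

text \<open>On a bounded set the second moment is automatic, so the laws built below, Dirac masses
  and mixtures included, lie in \<open>P2 C\<close>.\<close>

lemma P2_I:
  assumes "prob_space \<rho>" "sets \<rho> = sets (borel_on C)"
  shows "\<rho> \<in> P2 C"
proof -
  interpret prob_space \<rho> by fact
  have sp: "space \<rho> = C"
    by (rule space_eq_of_sets_borel_on[OF assms(2)])
  have [measurable]: "(\<lambda>x. x) \<in> borel_measurable \<rho>"
    by (rule measurable_ident_borel_on[OF assms(2)])
  obtain B where B: "\<And>x. x \<in> C \<Longrightarrow> norm x \<le> B"
    using bounded by (auto simp: bounded_iff)
  have "integrable \<rho> (\<lambda>x. (norm x)\<^sup>2)"
    by (rule integrable_const_bound[where B="B\<^sup>2"])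
       (use B in \<open>auto simp: sp intro!: AE_I2 power_mono\<close>)
  with assms show ?thesis
    by (simp add: P2_def)
qed

lemma gauss_conv_bounds:
  assumes "\<rho> \<in> P2 C" "x \<in> C"
  shows "m \<le> gauss_conv \<epsilon> \<rho> x" "gauss_conv \<epsilon> \<rho> x \<le> 1"
proof -
  note \<rho> = P2_D[OF assms(1)]
  interpret prob_space \<rho> by (rule \<rho>)
  have int: "integrable \<rho> (\<lambda>z. gauss_kernel \<epsilon> (x - z))"
    using weighted_conv_integrable[OF \<rho>(1,2) \<epsilon>, of "\<lambda>_. 1" 1] by simp
  show "m \<le> gauss_conv \<epsilon> \<rho> x"
    unfolding gauss_conv_def using m_le_gauss_kernel assms(2)
    by (intro integral_ge_const int) (auto simp: \<rho>)
  show "gauss_conv \<epsilon> \<rho> x \<le> 1"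
    unfolding gauss_conv_def using gauss_kernel_le_1[OF \<epsilon>]
    by (intro integral_le_const int) auto
qed

lemma continuous_on_gauss_conv: "\<rho> \<in> P2 C \<Longrightarrow> continuous_on S (gauss_conv \<epsilon> \<rho>)"
  using continuous_on_weighted_conv[OF P2_D(1,2) \<epsilon>, of \<rho> "\<lambda>_. 1" 1 S]
  by (simp add: gauss_conv_eq_weighted_conv[abs_def])

lemma gauss_conv_measurable: "\<rho> \<in> P2 C \<Longrightarrow> gauss_conv \<epsilon> \<rho> \<in> borel_measurable borel"
  by (rule borel_measurable_continuous_onI[OF continuous_on_gauss_conv])

lemma recip_gauss_conv:
  assumes "\<rho> \<in> P2 C" "sets M = sets (borel_on C)"
  shows "(\<lambda>z. 1 / gauss_conv \<epsilon> \<rho> z) \<in> borel_measurable M"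
    and "z \<in> C \<Longrightarrow> \<bar>1 / gauss_conv \<epsilon> \<rho> z\<bar> \<le> 1 / m"
proof -
  have "(\<lambda>z. 1 / gauss_conv \<epsilon> \<rho> z) \<in> borel_measurable borel"
    using gauss_conv_measurable[OF assms(1)] by measurable
  then show "(\<lambda>z. 1 / gauss_conv \<epsilon> \<rho> z) \<in> borel_measurable M"
    by (simp add: measurable_cong_sets[OF assms(2) refl] measurable_restrict_space1)
  assume "z \<in> C"
  with gauss_conv_bounds[OF assms(1)] m_pos show "\<bar>1 / gauss_conv \<epsilon> \<rho> z\<bar> \<le> 1 / m"
    by (force simp: abs_of_pos intro!: divide_left_mono)
qed

lemma U_remainder:
  assumes "x \<in> C" "y \<in> C"
  shows "\<bar>U y - U x - dU x \<bullet> (y - x)\<bar> \<le> K * (norm (y - x))\<^sup>2"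
  using assms convex grad lip lipschitz_on_nonneg[OF lip]
  by (intro convex_quadratic_remainder[of C])
     (auto simp: is_gradient_on_def lipschitz_on_def dist_norm)

lemma K_nonneg: "0 \<le> K"
  by (rule lipschitz_on_nonneg[OF lip])

lemma dU_bounded: "\<exists>B. \<forall>x\<in>C. norm (dU x) \<le> B"
proof -
  have "bounded (dU ` C)"
    by (rule bounded_uniformly_continuous_image[OF lipschitz_on_uniformly_continuous[OF lip] bounded])
  then show ?thesis by (auto simp: bounded_iff)
qed

lemma continuous_on_U: "continuous_on C U"
  unfolding continuous_on_eq_continuous_within
proof
  fix x assume "x \<in> C"
  with grad show "continuous (at x within C) U"
    unfolding is_gradient_on_def by (intro has_derivative_continuous) (rule bspec)
qed

text \<open>Expansion about a single point: over a set of diameter \<open>D\<close> the linear and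
  the quadratic term are both bounded.\<close>

lemma U_bounded: "\<exists>B. \<forall>x\<in>C. \<bar>U x\<bar> \<le> B"
proof -
  obtain x0 where x0: "x0 \<in> C" using nonempty by blast
  have "\<bar>U x\<bar> \<le> \<bar>U x0\<bar> + norm (dU x0) * D + K * D\<^sup>2" if x: "x \<in> C" for x
  proof -
    have d: "norm (x - x0) \<le> D"
      using diameter_bounded_bound[OF bounded x x0] by (simp add: D_def dist_norm)
    have "\<bar>dU x0 \<bullet> (x - x0)\<bar> \<le> norm (dU x0) * D"
      using Cauchy_Schwarz_ineq2[of "dU x0" "x - x0"] mult_left_mono[OF d norm_ge_zero, of "dU x0"]
      by linarith
    moreover have "K * (norm (x - x0))\<^sup>2 \<le> K * D\<^sup>2"
      using d by (intro mult_left_mono power_mono K_nonneg) auto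
    ultimately show ?thesis
      using U_remainder[OF x0 x] by linarith
  qed
  then show ?thesis by blast
qed

lemma U_measurable: "U \<in> borel_measurable (borel_on C)"
  by (rule borel_measurable_continuous_on_restrict[OF continuous_on_U])

lemma dU_measurable: "dU \<in> borel_measurable (borel_on C)"
  by (rule borel_measurable_continuous_on_restrict[OF lipschitz_on_continuous_on[OF lip]])

lemma ln_gauss_conv_bound:
  assumes "\<rho> \<in> P2 C" "x \<in> C"
  shows "\<bar>ln (gauss_conv \<epsilon> \<rho> x)\<bar> \<le> - ln m"
proof -
  note b = gauss_conv_bounds[OF assms]
  have "ln m \<le> ln (gauss_conv \<epsilon> \<rho> x)"
    using b m_pos by simp
  moreover have "ln (gauss_conv \<epsilon> \<rho> x) \<le> 0"
    using b m_pos by simp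
  ultimately show ?thesis by linarith
qed

lemma bounded_integrable:
  fixes f :: "'a \<Rightarrow> 'c::{banach, second_countable_topology}"
  assumes "prob_space \<rho>" "sets \<rho> = sets (borel_on C)" "f \<in> borel_measurable (borel_on C)"
    "\<And>x. x \<in> C \<Longrightarrow> norm (f x) \<le> B"
  shows "integrable \<rho> f"
proof -
  interpret prob_space \<rho> by fact
  show ?thesis
    using assms
    by (intro integrable_const_bound[where B=B] AE_I2)
       (auto simp: space_eq_of_sets_borel_on[OF assms(2)] measurable_cong_sets[OF assms(2) refl])
qed

lemma ln_gauss_conv_measurable:
  "\<rho> \<in> P2 C \<Longrightarrow> (\<lambda>x. ln (gauss_conv \<epsilon> \<rho> x)) \<in> borel_measurable (borel_on C)"
  using gauss_conv_measurable[of \<rho>] by (intro measurable_restrict_space1) measurable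

lemma energy_integrable:
  assumes "\<rho> \<in> P2 C" "\<nu> \<in> P2 C"
  shows "integrable \<nu> U" "integrable \<nu> (\<lambda>x. ln (gauss_conv \<epsilon> \<rho> x))"
    "integrable \<nu> (\<lambda>x. U x + ln (gauss_conv \<epsilon> \<rho> x))"
proof -
  obtain B where "\<And>x. x \<in> C \<Longrightarrow> \<bar>U x\<bar> \<le> B"
    using U_bounded by blast
  then show "integrable \<nu> U"
    using P2_D[OF assms(2)] U_measurable by (intro bounded_integrable) auto
  moreover show "integrable \<nu> (\<lambda>x. ln (gauss_conv \<epsilon> \<rho> x))"
    using P2_D[OF assms(2)] ln_gauss_conv_measurable[OF assms(1)] ln_gauss_conv_bound[OF assms(1)]
    by (intro bounded_integrable) auto
  ultimately show "integrable \<nu> (\<lambda>x. U x + ln (gauss_conv \<epsilon> \<rho> x))"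
    by simp
qed

text \<open>The finite value of \<open>reg_energy\<close> on \<open>P2 C\<close>; the estimates run
  in the reals, and extended arithmetic returns only in the final statements.\<close>

definition energy where "energy \<rho> = (\<integral>x. U x + ln (gauss_conv \<epsilon> \<rho> x) \<partial>\<rho>)"

lemma reg_energy_eq: "\<rho> \<in> P2 C \<Longrightarrow> reg_energy U \<epsilon> \<rho> = ereal (energy \<rho>)"
  by (simp add: reg_energy_def energy_def energy_integrable)

abbreviation \<xi> where "\<xi> \<equiv> energy_field dU \<epsilon>"

lemma energy_field_is_gradient:
  assumes \<rho>: "\<rho> \<in> P2 C"
  shows "is_gradient_on C (reg_energy_variation U \<epsilon> \<rho>) (\<xi> \<rho>)"
  unfolding is_gradient_on_def
proof
  fix x assume x: "x \<in> C"
  note \<rho>' = P2_D[OF \<rho>]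
  have U: "(U has_derivative (\<lambda>h. dU x \<bullet> h)) (at x within C)"
    using grad x by (simp add: is_gradient_on_def)
  have w: "(weighted_conv \<epsilon> \<rho> (\<lambda>z. 1 / gauss_conv \<epsilon> \<rho> z) has_derivative
      (\<lambda>h. weighted_conv_grad \<epsilon> \<rho> (\<lambda>z. 1 / gauss_conv \<epsilon> \<rho> z) x \<bullet> h)) (at x within C)"
    using recip_gauss_conv[OF \<rho> \<rho>'(2)]
    by (rule weighted_conv_has_derivative[OF \<rho>'(1,2) \<epsilon>])
  have g: "(gauss_conv \<epsilon> \<rho> has_derivative (\<lambda>h. weighted_conv_grad \<epsilon> \<rho> (\<lambda>_. 1) x \<bullet> h)) (at x within C)"
    unfolding gauss_conv_eq_weighted_conv[abs_def]
    by (rule weighted_conv_has_derivative[OF \<rho>'(1,2) \<epsilon>, where W=1]) auto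
  have pos: "0 < gauss_conv \<epsilon> \<rho> x"
    using gauss_conv_bounds(1)[OF \<rho> x] m_pos by linarith
  have ln: "((\<lambda>x. ln (gauss_conv \<epsilon> \<rho> x)) has_derivative
      (\<lambda>h. (weighted_conv_grad \<epsilon> \<rho> (\<lambda>_. 1) x \<bullet> h) * inverse (gauss_conv \<epsilon> \<rho> x))) (at x within C)"
    by (rule has_derivative_ln[OF pos g])
  have eq: "reg_energy_variation U \<epsilon> \<rho> =
      (\<lambda>x. U x + weighted_conv \<epsilon> \<rho> (\<lambda>z. 1 / gauss_conv \<epsilon> \<rho> z) x + ln (gauss_conv \<epsilon> \<rho> x))"
    by (auto simp: reg_energy_variation_def weighted_conv_def)
  have "((\<lambda>x. U x + weighted_conv \<epsilon> \<rho> (\<lambda>z. 1 / gauss_conv \<epsilon> \<rho> z) x + ln (gauss_conv \<epsilon> \<rho> x)) has_derivative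
      (\<lambda>h. dU x \<bullet> h + weighted_conv_grad \<epsilon> \<rho> (\<lambda>z. 1 / gauss_conv \<epsilon> \<rho> z) x \<bullet> h
        + (weighted_conv_grad \<epsilon> \<rho> (\<lambda>_. 1) x \<bullet> h) * inverse (gauss_conv \<epsilon> \<rho> x))) (at x within C)"
    by (intro has_derivative_add U w ln)
  then show "(reg_energy_variation U \<epsilon> \<rho> has_derivative (\<lambda>h. \<xi> \<rho> x \<bullet> h)) (at x within C)"
    unfolding eq by (rule has_derivative_eq_rhs)
      (auto simp: energy_field_def inner_add_left divide_inverse mult.commute)
qed

lemma energy_field_measurable:
  assumes \<rho>: "\<rho> \<in> P2 C"
  shows "\<xi> \<rho> \<in> borel_measurable (borel_on C)"
proof -
  note \<rho>' = P2_D[OF \<rho>]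
  have 1: "weighted_conv_grad \<epsilon> \<rho> (\<lambda>z. 1 / gauss_conv \<epsilon> \<rho> z) \<in> borel_measurable borel"
    using recip_gauss_conv[OF \<rho> \<rho>'(2)] by (rule weighted_conv_grad_measurable[OF \<rho>'(1,2) \<epsilon>])
  have 2: "weighted_conv_grad \<epsilon> \<rho> (\<lambda>_. 1) \<in> borel_measurable borel"
    by (rule weighted_conv_grad_measurable[OF \<rho>'(1,2) \<epsilon>, where W=1]) auto
  note [measurable] = 1 2 dU_measurable gauss_conv_measurable[OF \<rho>]
  show ?thesis
    unfolding energy_field_def by (intro borel_measurable_add dU_measurable measurable_restrict_space1) measurable
qed

lemma energy_field_bounded:
  assumes \<rho>: "\<rho> \<in> P2 C"
  shows "\<exists>B. \<forall>x\<in>C. norm (\<xi> \<rho> x) \<le> B"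
proof -
  note \<rho>' = P2_D[OF \<rho>]
  obtain B where B: "\<And>x. x \<in> C \<Longrightarrow> norm (dU x) \<le> B"
    using dU_bounded by blast
  have 1: "norm (weighted_conv_grad \<epsilon> \<rho> (\<lambda>z. 1 / gauss_conv \<epsilon> \<rho> z) x) \<le> 1 / m * (2 + 1 / \<epsilon>)" for x
    using recip_gauss_conv[OF \<rho> \<rho>'(2)] by (rule norm_weighted_conv_grad_le[OF \<rho>'(1,2) \<epsilon>])
  have 2: "norm (weighted_conv_grad \<epsilon> \<rho> (\<lambda>_. 1) x) \<le> 1 * (2 + 1 / \<epsilon>)" for x
    by (rule norm_weighted_conv_grad_le[OF \<rho>'(1,2) \<epsilon>]) auto
  have "norm (\<xi> \<rho> x) \<le> B + 1 / m * (2 + 1 / \<epsilon>) + 1 / m * (1 * (2 + 1 / \<epsilon>))" if x: "x \<in> C" for x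
    unfolding energy_field_def
  proof (intro norm_triangle_le add_mono B x 1)
    show "norm ((1 / gauss_conv \<epsilon> \<rho> x) *\<^sub>R weighted_conv_grad \<epsilon> \<rho> (\<lambda>_. 1) x) \<le> 1 / m * (1 * (2 + 1 / \<epsilon>))"
      unfolding norm_scaleR using recip_gauss_conv(2)[OF \<rho> \<rho>'(2) x] 2 m_pos
      by (intro mult_mono) auto
  qed
  then show ?thesis by blast
qed

end

section \<open>Second-order expansion of the energy\<close>

lemma norm_diff_sq_le: "(norm (u - v))\<^sup>2 \<le> 2 * (norm u)\<^sup>2 + 2 * (norm (v::'a::real_inner))\<^sup>2"
proof -
  have "(norm (u - v))\<^sup>2 \<le> (norm u + norm v)\<^sup>2"
    by (intro power_mono norm_triangle_ineq4) simp
  also have "\<dots> \<le> 2 * (norm u)\<^sup>2 + 2 * (norm v)\<^sup>2"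
    using zero_le_power2[of "norm u - norm v"] by (simp add: power2_sum power2_diff)
  finally show ?thesis .
qed

lemma (in prob_space) integrable_bounded_on_space:
  fixes f :: "'a \<Rightarrow> 'c::{banach, second_countable_topology}"
  assumes "f \<in> borel_measurable M" "\<And>x. x \<in> space M \<Longrightarrow> norm (f x) \<le> B"
  shows "integrable M f"
  using assms by (intro integrable_const_bound[where B=B] AE_I2)

context reg_energy_domain
begin

text \<open>\<open>K\<close> is the share of \<open>U\<close>. In the bracket, the first term
  combines the quadratic remainder of \<open>ln\<close> on \<open>[m, 1]\<close> with the squared
  Lipschitz constant of the kernel; the second is the remainder constant of the kernel divided by
  the lower bound of the convolution. The factor 4 is 2 + 2: by \<open>norm_diff_sq_le\<close> the
  displacement of each of two independent copies contributes twice the mean square.\<close>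

definition \<kappa> :: real where
  "\<kappa> = K + 4 * ((2 + 1 / \<epsilon>)\<^sup>2 / m\<^sup>2 + 3 / \<epsilon> / m)"

lemma law_in_P2:
  assumes "prob_space M" "X \<in> M \<rightarrow>\<^sub>M borel_on C"
  shows "distr M (borel_on C) X \<in> P2 C"
  using prob_space.prob_space_distr[OF assms] by (intro P2_I) auto

lemma gauss_conv_law:
  assumes "X \<in> M \<rightarrow>\<^sub>M borel_on C"
  shows "gauss_conv \<epsilon> (distr M (borel_on C) X) x = (\<integral>\<omega>. gauss_kernel \<epsilon> (x - X \<omega>) \<partial>M)"
  unfolding gauss_conv_def
  by (rule integral_distr[OF assms]) (rule measurable_restrict_space1, measurable)

lemma weighted_conv_grad_law:
  assumes "X \<in> M \<rightarrow>\<^sub>M borel_on C" "w \<in> borel_measurable (borel_on C)"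
  shows "weighted_conv_grad \<epsilon> (distr M (borel_on C) X) w x
      = (\<integral>\<omega>. w (X \<omega>) *\<^sub>R gauss_grad \<epsilon> (x - X \<omega>) \<partial>M)"
proof -
  have "(\<lambda>z. gauss_grad \<epsilon> (x - z)) \<in> borel_measurable (borel_on C)"
    by (rule measurable_restrict_space1) measurable
  then show ?thesis
    unfolding weighted_conv_grad_def using assms(2)
    by (intro integral_distr[OF assms(1)]) measurable
qed

lemma energy_law:
  assumes "prob_space M" "X \<in> M \<rightarrow>\<^sub>M borel_on C"
  shows "energy (distr M (borel_on C) X)
      = (\<integral>\<omega>. U (X \<omega>) + ln (gauss_conv \<epsilon> (distr M (borel_on C) X) (X \<omega>)) \<partial>M)"
  unfolding energy_def
  using U_measurable ln_gauss_conv_measurable[OF law_in_P2[OF assms]]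
  by (intro integral_distr[OF assms(2)]) measurable

text \<open>The kernel inside the logarithm is evaluated at the difference of two independent
  copies, and this difference changes by \<open>\<Delta> \<omega> - \<Delta> \<omega>'\<close>. The
  part with \<open>\<Delta> \<omega>\<close> is already in gradient form; the part with
  \<open>\<Delta> \<omega>'\<close> becomes so once the copies exchange roles.\<close>

lemma energy_expansion:
  fixes M :: "'b measure" and X Y :: "'b \<Rightarrow> 'a"
  assumes "prob_space M" and X: "X \<in> M \<rightarrow>\<^sub>M borel_on C" and Y: "Y \<in> M \<rightarrow>\<^sub>M borel_on C"
  shows "\<bar>energy (distr M (borel_on C) Y) - energy (distr M (borel_on C) X)
      - (\<integral>\<omega>. \<xi> (distr M (borel_on C) X) (X \<omega>) \<bullet> (Y \<omega> - X \<omega>) \<partial>M)\<bar>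
    \<le> \<kappa> * (\<integral>\<omega>. (norm (Y \<omega> - X \<omega>))\<^sup>2 \<partial>M)"
proof -
  interpret prob_space M by fact
  interpret MM: pair_prob_space M M ..
  define \<rho> where "\<rho> = distr M (borel_on C) X"
  define \<nu> where "\<nu> = distr M (borel_on C) Y"
  have \<rho>: "\<rho> \<in> P2 C" and \<nu>: "\<nu> \<in> P2 C"
    unfolding \<rho>_def \<nu>_def using law_in_P2[OF assms(1)] X Y by auto
  have X_C: "X \<omega> \<in> C" and Y_C: "Y \<omega> \<in> C" if "\<omega> \<in> space M" for \<omega>
    using measurable_space[OF X that] measurable_space[OF Y that] by (auto simp: space_restrict_space)
  have X_b [measurable]: "X \<in> borel_measurable M" and Y_b [measurable]: "Y \<in> borel_measurable M"
    using X Y by (auto dest: measurable_borel_on_into_borel)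
  define a where "a \<omega> = gauss_conv \<epsilon> \<rho> (X \<omega>)" for \<omega>
  define b where "b \<omega> = gauss_conv \<epsilon> \<nu> (Y \<omega>)" for \<omega>
  define \<Delta> where "\<Delta> \<omega> = Y \<omega> - X \<omega>" for \<omega>
  define A where "A \<omega> \<omega>' = gauss_grad \<epsilon> (X \<omega> - X \<omega>')" for \<omega> \<omega>'
  define L where "L = 2 + 1 / \<epsilon>"
  define S where "S = (\<integral>\<omega>. (norm (\<Delta> \<omega>))\<^sup>2 \<partial>M)"
  \<comment> \<open>First-order change of the convolution: the evaluation point moves by
    \<open>\<Delta> \<omega>\<close> while the mass at \<open>X \<omega>'\<close> moves by
    \<open>\<Delta> \<omega>'\<close>.\<close>
  define lin where "lin \<omega> = (\<integral>\<omega>'. A \<omega> \<omega>' \<bullet> (\<Delta> \<omega> - \<Delta> \<omega>') \<partial>M)" for \<omega>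
  define c where "c = L\<^sup>2 / m\<^sup>2 + 3 / \<epsilon> / m"
  have L: "0 \<le> L" and c: "0 \<le> c"
    using \<epsilon> m_pos by (auto simp: L_def c_def)
  note [measurable] = gauss_conv_measurable[OF \<rho>] gauss_conv_measurable[OF \<nu>]
  have a_m [measurable]: "a \<in> borel_measurable M" and b_m [measurable]: "b \<in> borel_measurable M"
    unfolding a_def b_def by measurable
  have \<Delta>_m [measurable]: "\<Delta> \<in> borel_measurable M"
    unfolding \<Delta>_def by measurable
  have A_m [measurable]: "(\<lambda>p. A (fst p) (snd p)) \<in> borel_measurable (M \<Otimes>\<^sub>M M)"
      "A \<omega> \<in> borel_measurable M" "(\<lambda>\<omega>. A \<omega> \<omega>') \<in> borel_measurable M" for \<omega> \<omega>'
    unfolding A_def by measurable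
  have a_bd: "m \<le> a \<omega>" "a \<omega> \<le> 1" and b_bd: "m \<le> b \<omega>" "b \<omega> \<le> 1" if "\<omega> \<in> space M" for \<omega>
    unfolding a_def b_def using gauss_conv_bounds \<rho> \<nu> X_C Y_C that by auto
  have \<Delta>_bd: "norm (\<Delta> \<omega>) \<le> D" if "\<omega> \<in> space M" for \<omega>
    using diameter_bounded_bound[OF bounded Y_C[OF that] X_C[OF that]]
    by (simp add: \<Delta>_def D_def dist_norm)
  have D: "0 \<le> D"
    using not_empty \<Delta>_bd norm_ge_zero order_trans by blast
  have A_bd: "norm (A \<omega> \<omega>') \<le> L" for \<omega> \<omega>'
    unfolding A_def L_def by (rule norm_gauss_grad_le[OF \<epsilon>])
  have inner_bd: "norm (A \<omega> \<omega>' \<bullet> v) \<le> L * B" if "norm v \<le> B" for \<omega> \<omega>' v B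
  proof -
    have "norm (A \<omega> \<omega>' \<bullet> v) \<le> norm (A \<omega> \<omega>') * norm v"
      using Cauchy_Schwarz_ineq2 by simp
    also have "\<dots> \<le> L * B"
      using A_bd that L by (intro mult_mono) auto
    finally show ?thesis .
  qed
  have diff_bd: "norm (\<Delta> \<omega> - \<Delta> \<omega>') \<le> 2 * D" if "\<omega> \<in> space M" "\<omega>' \<in> space M" for \<omega> \<omega>'
    using norm_triangle_ineq4[of "\<Delta> \<omega>" "\<Delta> \<omega>'"] \<Delta>_bd[OF that(1)] \<Delta>_bd[OF that(2)] by linarith
  have int_\<Delta>2: "integrable M (\<lambda>\<omega>. (norm (\<Delta> \<omega>))\<^sup>2)"
    using \<Delta>_bd by (intro integrable_bounded_on_space[where B="D\<^sup>2"]) (auto intro: power_mono)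

  \<comment> \<open>Two errors add up: the remainder of \<open>ln\<close> beyond first order in
    \<open>b \<omega> - a \<omega>\<close>, and the replacement of
    \<open>b \<omega> - a \<omega>\<close> by \<open>lin \<omega>\<close>. The term \<open>S\<close>
    collects the displacement of the second copy.\<close>
  have ln_remainder: "\<bar>ln (b \<omega>) - ln (a \<omega>) - lin \<omega> / a \<omega>\<bar> \<le> c * (2 * (norm (\<Delta> \<omega>))\<^sup>2 + 2 * S)"
    if \<omega>: "\<omega> \<in> space M" for \<omega>
  proof -
    let ?n = "\<lambda>\<omega>'. norm (\<Delta> \<omega> - \<Delta> \<omega>')"
    let ?d = "\<lambda>\<omega>'. gauss_kernel \<epsilon> (Y \<omega> - Y \<omega>') - gauss_kernel \<epsilon> (X \<omega> - X \<omega>')"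
    let ?l = "\<lambda>\<omega>'. A \<omega> \<omega>' \<bullet> (\<Delta> \<omega> - \<Delta> \<omega>')"
    have int_n: "integrable M ?n"
      using diff_bd[OF \<omega>] by (intro integrable_bounded_on_space[where B="2 * D"]) auto
    have int_n2: "integrable M (\<lambda>\<omega>'. (?n \<omega>')\<^sup>2)"
    proof (rule integrable_bounded_on_space[where B="(2 * D)\<^sup>2"])
      show "norm ((?n \<omega>')\<^sup>2) \<le> (2 * D)\<^sup>2" if "\<omega>' \<in> space M" for \<omega>'
        using power_mono[OF diff_bd[OF \<omega> that] norm_ge_zero, of 2] by simp
    qed measurable
    have int_k: "integrable M (\<lambda>\<omega>'. gauss_kernel \<epsilon> (Z \<omega> - Z \<omega>'))"
      if [measurable]: "Z \<in> borel_measurable M" for Z :: "'b \<Rightarrow> 'a"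
      using gauss_kernel_le_1[OF \<epsilon>] gauss_kernel_pos
      by (intro integrable_bounded_on_space[where B=1]) (auto simp: abs_of_nonneg[OF less_imp_le[OF gauss_kernel_pos]])
    have int_d: "integrable M ?d"
      by (intro Bochner_Integration.integrable_diff int_k X_b Y_b)
    have int_l: "integrable M ?l"
      using inner_bd[OF diff_bd[OF \<omega>]] by (intro integrable_bounded_on_space[where B="L * (2 * D)"]) auto
    have ba: "b \<omega> - a \<omega> = (\<integral>\<omega>'. ?d \<omega>' \<partial>M)"
      unfolding a_def b_def \<rho>_def \<nu>_def gauss_conv_law[OF X] gauss_conv_law[OF Y]
      by (rule Bochner_Integration.integral_diff[symmetric]) (intro int_k X_b Y_b)+
    have step: "(Y \<omega> - Y \<omega>') - (X \<omega> - X \<omega>') = \<Delta> \<omega> - \<Delta> \<omega>'" for \<omega>'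
      by (simp add: \<Delta>_def)
    have "\<bar>b \<omega> - a \<omega> - lin \<omega>\<bar> = \<bar>\<integral>\<omega>'. ?d \<omega>' - ?l \<omega>' \<partial>M\<bar>"
      unfolding ba lin_def using int_d int_l by simp
    also have "\<dots> \<le> (\<integral>\<omega>'. \<bar>?d \<omega>' - ?l \<omega>'\<bar> \<partial>M)"
      by (rule integral_abs_bound)
    also have "\<dots> \<le> (\<integral>\<omega>'. 3 / \<epsilon> * (?n \<omega>')\<^sup>2 \<partial>M)"
    proof (rule integral_mono)
      show "\<bar>?d \<omega>' - ?l \<omega>'\<bar> \<le> 3 / \<epsilon> * (?n \<omega>')\<^sup>2" for \<omega>'
        using gauss_kernel_remainder[OF \<epsilon>, of "Y \<omega> - Y \<omega>'" "X \<omega> - X \<omega>'"]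
        unfolding step A_def by simp
    qed (use int_d int_l int_n2 in auto)
    finally have R1: "\<bar>b \<omega> - a \<omega> - lin \<omega>\<bar> \<le> 3 / \<epsilon> * (\<integral>\<omega>'. (?n \<omega>')\<^sup>2 \<partial>M)" by simp
    have "\<bar>b \<omega> - a \<omega>\<bar> \<le> (\<integral>\<omega>'. \<bar>?d \<omega>'\<bar> \<partial>M)"
      unfolding ba by (rule integral_abs_bound)
    also have "\<dots> \<le> (\<integral>\<omega>'. L * ?n \<omega>' \<partial>M)"
    proof (rule integral_mono)
      show "\<bar>?d \<omega>'\<bar> \<le> L * ?n \<omega>'" for \<omega>'
        using gauss_kernel_lipschitz[OF \<epsilon>, of "Y \<omega> - Y \<omega>'" "X \<omega> - X \<omega>'"]
        unfolding step L_def by simp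
    qed (use int_d int_n in auto)
    finally have "(b \<omega> - a \<omega>)\<^sup>2 \<le> (L * (\<integral>\<omega>'. ?n \<omega>' \<partial>M))\<^sup>2"
      by (intro abs_le_square_iff[THEN iffD1]) (simp add: abs_mult abs_of_nonneg[OF L])
    \<comment> \<open>The square of the mean displacement is at most the mean square, which makes
      the Lipschitz bound quadratic.\<close>
    also have "\<dots> \<le> L\<^sup>2 * (\<integral>\<omega>'. (?n \<omega>')\<^sup>2 \<partial>M)"
      unfolding power_mult_distrib by (intro mult_left_mono square_integral_le int_n int_n2) simp
    finally have R2: "(b \<omega> - a \<omega>)\<^sup>2 \<le> L\<^sup>2 * (\<integral>\<omega>'. (?n \<omega>')\<^sup>2 \<partial>M)" .
    have pos: "0 < a \<omega>"
      using a_bd(1)[OF \<omega>] m_pos by linarith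
    have "\<bar>(b \<omega> - a \<omega>) / a \<omega> - lin \<omega> / a \<omega>\<bar> = \<bar>b \<omega> - a \<omega> - lin \<omega>\<bar> / a \<omega>"
      using pos by (simp add: diff_divide_distrib[symmetric])
    also have "\<dots> \<le> \<bar>b \<omega> - a \<omega> - lin \<omega>\<bar> / m"
      using a_bd(1)[OF \<omega>] m_pos by (intro divide_left_mono mult_pos_pos) auto
    also have "\<dots> \<le> (3 / \<epsilon> * (\<integral>\<omega>'. (?n \<omega>')\<^sup>2 \<partial>M)) / m"
      using R1 m_pos by (intro divide_right_mono) auto
    finally have R3: "\<bar>(b \<omega> - a \<omega>) / a \<omega> - lin \<omega> / a \<omega>\<bar> \<le> 3 / \<epsilon> / m * (\<integral>\<omega>'. (?n \<omega>')\<^sup>2 \<partial>M)" by simp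
    have "\<bar>ln (b \<omega>) - ln (a \<omega>) - (b \<omega> - a \<omega>) / a \<omega>\<bar> \<le> (b \<omega> - a \<omega>)\<^sup>2 / m\<^sup>2"
      by (rule abs_ln_remainder[OF m_pos a_bd(1)[OF \<omega>] b_bd(1)[OF \<omega>]])
    also have "\<dots> \<le> L\<^sup>2 / m\<^sup>2 * (\<integral>\<omega>'. (?n \<omega>')\<^sup>2 \<partial>M)"
      using divide_right_mono[OF R2, of "m\<^sup>2"] by simp
    finally have "\<bar>ln (b \<omega>) - ln (a \<omega>) - lin \<omega> / a \<omega>\<bar> \<le> c * (\<integral>\<omega>'. (?n \<omega>')\<^sup>2 \<partial>M)"
      using R3 unfolding c_def distrib_right by linarith
    also have "\<dots> \<le> c * (\<integral>\<omega>'. 2 * (norm (\<Delta> \<omega>))\<^sup>2 + 2 * (norm (\<Delta> \<omega>'))\<^sup>2 \<partial>M)"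
      using int_\<Delta>2 int_n2 by (intro mult_left_mono[OF _ c] integral_mono norm_diff_sq_le) auto
    also have "(\<integral>\<omega>'. 2 * (norm (\<Delta> \<omega>))\<^sup>2 + 2 * (norm (\<Delta> \<omega>'))\<^sup>2 \<partial>M) = 2 * (norm (\<Delta> \<omega>))\<^sup>2 + 2 * S"
      using int_\<Delta>2 by (simp add: S_def prob_space)
    finally show ?thesis .
  qed

  let ?G1 = "\<lambda>\<omega>. weighted_conv_grad \<epsilon> \<rho> (\<lambda>_. 1) (X \<omega>)"
  let ?Gw = "\<lambda>\<omega>. weighted_conv_grad \<epsilon> \<rho> (\<lambda>z. 1 / gauss_conv \<epsilon> \<rho> z) (X \<omega>)"
  have recip: "\<bar>1 / a \<omega>\<bar> \<le> 1 / m" if "\<omega> \<in> space M" for \<omega>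
    unfolding a_def using recip_gauss_conv(2)[OF \<rho> _ X_C[OF that]] by simp
  have G1: "?G1 \<omega> = (\<integral>\<omega>'. A \<omega> \<omega>' \<partial>M)" for \<omega>
    unfolding \<rho>_def weighted_conv_grad_law[OF X borel_measurable_const] A_def by simp
  have Gw: "?Gw \<omega> = (\<integral>\<omega>'. (1 / a \<omega>') *\<^sub>R A \<omega> \<omega>' \<partial>M)" for \<omega>
    unfolding a_def A_def using recip_gauss_conv(1)[OF \<rho> refl] unfolding \<rho>_def
    by (subst weighted_conv_grad_law[OF X]) auto
  have int_A: "integrable M (A \<omega>)" for \<omega>
    by (rule integrable_bounded_on_space[OF _ A_bd]) measurable
  have int_wA: "integrable M (\<lambda>\<omega>'. (1 / a \<omega>') *\<^sub>R A \<omega> \<omega>')" for \<omega>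
  proof (rule integrable_bounded_on_space)
    show "norm ((1 / a \<omega>') *\<^sub>R A \<omega> \<omega>') \<le> 1 / m * L" if "\<omega>' \<in> space M" for \<omega>'
      unfolding norm_scaleR using recip[OF that] A_bd m_pos by (intro mult_mono) auto
  qed measurable
  \<comment> \<open>Up to sign, the part of the integrand of
    \<open>lin \<omega> / a \<omega>\<close> that contains the displacement of the second
    copy.\<close>
  let ?f = "\<lambda>\<omega> \<omega>'. 1 / a \<omega> * (A \<omega> \<omega>' \<bullet> \<Delta> \<omega>')"
  have f_bd: "norm (?f \<omega> \<omega>') \<le> 1 / m * (L * D)" if "\<omega> \<in> space M" "\<omega>' \<in> space M" for \<omega> \<omega>'
    unfolding norm_mult using recip[OF that(1)] inner_bd[OF \<Delta>_bd[OF that(2)]] m_pos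
    by (intro mult_mono) auto
  have f_m: "(\<lambda>(\<omega>, \<omega>'). ?f \<omega> \<omega>') \<in> borel_measurable (M \<Otimes>\<^sub>M M)"
    unfolding A_def by measurable
  have int_f: "integrable (M \<Otimes>\<^sub>M M) (\<lambda>(\<omega>, \<omega>'). ?f \<omega> \<omega>')"
  proof (rule MM.P.integrable_const_bound[where B="1 / m * (L * D)"])
    show "AE p in M \<Otimes>\<^sub>M M. norm (case p of (\<omega>, \<omega>') \<Rightarrow> ?f \<omega> \<omega>') \<le> 1 / m * (L * D)"
      using f_bd by (intro AE_I2) (auto simp: space_pair_measure)
  qed (rule f_m)
  \<comment> \<open>Exchanging the copies moves the weight from \<open>1 / a \<omega>\<close> to
    \<open>1 / a \<omega>'\<close>, which is the weight of the middle summand of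
    \<open>energy_field\<close>; the minus sign is the antisymmetry of \<open>A\<close>.\<close>
  have swap: "(\<integral>\<omega>. \<integral>\<omega>'. ?f \<omega> \<omega>' \<partial>M \<partial>M) = - (\<integral>\<omega>. ?Gw \<omega> \<bullet> \<Delta> \<omega> \<partial>M)"
  proof -
    have inner: "(\<integral>\<omega>'. ?f \<omega>' \<omega> \<partial>M) = - (?Gw \<omega> \<bullet> \<Delta> \<omega>)" for \<omega>
    proof -
      have "A \<omega>' \<omega> = - A \<omega> \<omega>'" for \<omega>'
        unfolding A_def by (rule gauss_grad_minus_commute)
      then have "(\<integral>\<omega>'. ?f \<omega>' \<omega> \<partial>M) = (\<integral>\<omega>'. - (((1 / a \<omega>') *\<^sub>R A \<omega> \<omega>') \<bullet> \<Delta> \<omega>) \<partial>M)"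
        by simp
      also have "\<dots> = - ((\<integral>\<omega>'. (1 / a \<omega>') *\<^sub>R A \<omega> \<omega>' \<partial>M) \<bullet> \<Delta> \<omega>)"
        using int_wA[of \<omega>] by (simp only: Bochner_Integration.integral_minus integral_inner_left)
      finally show ?thesis unfolding Gw .
    qed
    have "(\<integral>\<omega>. \<integral>\<omega>'. ?f \<omega> \<omega>' \<partial>M \<partial>M) = (\<integral>\<omega>. \<integral>\<omega>'. ?f \<omega>' \<omega> \<partial>M \<partial>M)"
      using MM.Fubini_integral[OF int_f] by simp
    also have "\<dots> = - (\<integral>\<omega>. ?Gw \<omega> \<bullet> \<Delta> \<omega> \<partial>M)"
      unfolding inner by simp
    finally show ?thesis .
  qed
  have lin_eq: "lin \<omega> / a \<omega> = ((1 / a \<omega>) *\<^sub>R ?G1 \<omega>) \<bullet> \<Delta> \<omega> - (\<integral>\<omega>'. ?f \<omega> \<omega>' \<partial>M)"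
    if \<omega>: "\<omega> \<in> space M" for \<omega>
  proof -
    have 1: "integrable M (\<lambda>\<omega>'. A \<omega> \<omega>' \<bullet> \<Delta> \<omega>)"
      using int_A by (intro integrable_inner_left) auto
    have 2: "integrable M (\<lambda>\<omega>'. A \<omega> \<omega>' \<bullet> \<Delta> \<omega>')"
      using inner_bd[OF \<Delta>_bd] by (intro integrable_bounded_on_space[where B="L * D"]) auto
    have "lin \<omega> = (\<integral>\<omega>'. A \<omega> \<omega>' \<bullet> \<Delta> \<omega> \<partial>M) - (\<integral>\<omega>'. A \<omega> \<omega>' \<bullet> \<Delta> \<omega>' \<partial>M)"
      unfolding lin_def inner_diff_right by (rule Bochner_Integration.integral_diff[OF 1 2])
    also have "(\<integral>\<omega>'. A \<omega> \<omega>' \<bullet> \<Delta> \<omega> \<partial>M) = ?G1 \<omega> \<bullet> \<Delta> \<omega>"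
      unfolding G1 using int_A by (intro integral_inner_left) auto
    finally show ?thesis
      by (simp add: diff_divide_distrib)
  qed
  let ?field = "\<lambda>\<omega>. (\<xi> \<rho> (X \<omega>) - dU (X \<omega>)) \<bullet> \<Delta> \<omega>"
  have \<xi>_m [measurable]: "(\<lambda>\<omega>. \<xi> \<rho> (X \<omega>)) \<in> borel_measurable M"
    by (rule measurable_compose[OF X energy_field_measurable[OF \<rho>]])
  have dU_m [measurable]: "(\<lambda>\<omega>. dU (X \<omega>)) \<in> borel_measurable M"
    by (rule measurable_compose[OF X dU_measurable])
  obtain B1 B2 where B1: "\<And>x. x \<in> C \<Longrightarrow> norm (\<xi> \<rho> x) \<le> B1" and B2: "\<And>x. x \<in> C \<Longrightarrow> norm (dU x) \<le> B2"
    using energy_field_bounded[OF \<rho>] dU_bounded by blast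
  have inner_int: "integrable M (\<lambda>\<omega>. V \<omega> \<bullet> \<Delta> \<omega>)"
    if [measurable]: "V \<in> borel_measurable M" and V: "\<And>\<omega>. \<omega> \<in> space M \<Longrightarrow> norm (V \<omega>) \<le> B" for V B
  proof (rule integrable_bounded_on_space[where B="B * D"])
    fix \<omega> assume \<omega>: "\<omega> \<in> space M"
    have "norm (V \<omega> \<bullet> \<Delta> \<omega>) \<le> norm (V \<omega>) * norm (\<Delta> \<omega>)"
      using Cauchy_Schwarz_ineq2 by simp
    also have "\<dots> \<le> B * D"
      using V[OF \<omega>] \<Delta>_bd[OF \<omega>] order_trans[OF norm_ge_zero V[OF \<omega>]] by (intro mult_mono) auto
    finally show "norm (V \<omega> \<bullet> \<Delta> \<omega>) \<le> B * D" .
  qed measurable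
  have int_\<xi>: "integrable M (\<lambda>\<omega>. \<xi> \<rho> (X \<omega>) \<bullet> \<Delta> \<omega>)"
    by (rule inner_int[OF \<xi>_m B1[OF X_C]])
  have int_dU: "integrable M (\<lambda>\<omega>. dU (X \<omega>) \<bullet> \<Delta> \<omega>)"
    by (rule inner_int[OF dU_m B2[OF X_C]])
  have int_ff: "integrable M (\<lambda>\<omega>. \<integral>\<omega>'. ?f \<omega> \<omega>' \<partial>M)"
    using MM.integrable_fst'[OF int_f] by simp
  have int_Gw: "integrable M (\<lambda>\<omega>. ?Gw \<omega> \<bullet> \<Delta> \<omega>)"
  proof (rule inner_int)
    note \<rho>' = P2_D[OF \<rho>]
    show "?Gw \<in> borel_measurable M"
      using recip_gauss_conv[OF \<rho> \<rho>'(2)]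
      by (intro measurable_compose[OF X_b] weighted_conv_grad_measurable[OF \<rho>'(1,2) \<epsilon>])
    show "norm (?Gw \<omega>) \<le> 1 / m * (2 + 1 / \<epsilon>)" for \<omega>
      using recip_gauss_conv[OF \<rho> \<rho>'(2)] by (rule norm_weighted_conv_grad_le[OF \<rho>'(1,2) \<epsilon>])
  qed
  \<comment> \<open>The last two summands cancel only after integration, by \<open>swap\<close>;
    then \<open>lin \<omega> / a \<omega>\<close> alone is left.\<close>
  have field_eq: "?field \<omega> = lin \<omega> / a \<omega> + (\<integral>\<omega>'. ?f \<omega> \<omega>' \<partial>M) + ?Gw \<omega> \<bullet> \<Delta> \<omega>"
    if "\<omega> \<in> space M" for \<omega>
    unfolding lin_eq[OF that] by (simp add: energy_field_def a_def inner_add_left)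
  have int_field: "integrable M ?field"
    unfolding inner_diff_left using int_\<xi> int_dU by simp
  \<comment> \<open>Integrability is read off from \<open>field_eq\<close>, all other terms being
    integrable; this spares a separate argument for the measurability of \<open>lin\<close>.\<close>
  have int_lin: "integrable M (\<lambda>\<omega>. lin \<omega> / a \<omega>)"
  proof -
    have "integrable M (\<lambda>\<omega>. ?field \<omega> - (\<integral>\<omega>'. ?f \<omega> \<omega>' \<partial>M) - ?Gw \<omega> \<bullet> \<Delta> \<omega>)"
      using int_field int_ff int_Gw by simp
    then show ?thesis
      using field_eq by (subst Bochner_Integration.integrable_cong[OF refl]) auto
  qed
  have lin_integral: "(\<integral>\<omega>. lin \<omega> / a \<omega> \<partial>M) = (\<integral>\<omega>. ?field \<omega> \<partial>M)"
  proof -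
    have "(\<integral>\<omega>. ?field \<omega> \<partial>M)
        = (\<integral>\<omega>. lin \<omega> / a \<omega> + (\<integral>\<omega>'. ?f \<omega> \<omega>' \<partial>M) + ?Gw \<omega> \<bullet> \<Delta> \<omega> \<partial>M)"
      using field_eq by (rule Bochner_Integration.integral_cong[OF refl])
    also have "\<dots> = (\<integral>\<omega>. lin \<omega> / a \<omega> \<partial>M)"
      using int_lin int_ff int_Gw swap by simp
    finally show ?thesis ..
  qed

  have int_E: "integrable M (\<lambda>\<omega>. U (Z \<omega>))" "integrable M (\<lambda>\<omega>. ln (gauss_conv \<epsilon> \<mu> (Z \<omega>)))"
    if Z: "Z \<in> M \<rightarrow>\<^sub>M borel_on C" and \<mu>: "\<mu> \<in> P2 C" for Z \<mu>
    using integrable_distr[OF Z] energy_integrable[OF \<mu> law_in_P2[OF assms(1) Z]] by auto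
  have "\<bar>energy \<nu> - energy \<rho> - (\<integral>\<omega>. \<xi> \<rho> (X \<omega>) \<bullet> \<Delta> \<omega> \<partial>M)\<bar>
      = \<bar>\<integral>\<omega>. (U (Y \<omega>) - U (X \<omega>) - dU (X \<omega>) \<bullet> \<Delta> \<omega>) + (ln (b \<omega>) - ln (a \<omega>) - lin \<omega> / a \<omega>) \<partial>M\<bar>"
  proof -
    have "energy \<nu> = (\<integral>\<omega>. U (Y \<omega>) \<partial>M) + (\<integral>\<omega>. ln (b \<omega>) \<partial>M)"
      unfolding \<nu>_def energy_law[OF assms(1) Y] unfolding \<nu>_def[symmetric] b_def
      using int_E[OF Y \<nu>] by simp
    moreover have "energy \<rho> = (\<integral>\<omega>. U (X \<omega>) \<partial>M) + (\<integral>\<omega>. ln (a \<omega>) \<partial>M)"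
      unfolding \<rho>_def energy_law[OF assms(1) X] unfolding \<rho>_def[symmetric] a_def
      using int_E[OF X \<rho>] by simp
    moreover have "(\<integral>\<omega>. \<xi> \<rho> (X \<omega>) \<bullet> \<Delta> \<omega> \<partial>M) = (\<integral>\<omega>. dU (X \<omega>) \<bullet> \<Delta> \<omega> \<partial>M) + (\<integral>\<omega>. lin \<omega> / a \<omega> \<partial>M)"
      unfolding lin_integral inner_diff_left using int_\<xi> int_dU by simp
    ultimately show ?thesis
      using int_E[OF Y \<nu>, folded b_def] int_E[OF X \<rho>, folded a_def] int_dU int_lin by simp
  qed
  also have "\<dots> \<le> (\<integral>\<omega>. K * (norm (\<Delta> \<omega>))\<^sup>2 + c * (2 * (norm (\<Delta> \<omega>))\<^sup>2 + 2 * S) \<partial>M)"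
  proof (rule order_trans[OF integral_abs_bound], rule integral_mono)
    fix \<omega> assume \<omega>: "\<omega> \<in> space M"
    have "\<bar>U (Y \<omega>) - U (X \<omega>) - dU (X \<omega>) \<bullet> \<Delta> \<omega>\<bar> \<le> K * (norm (\<Delta> \<omega>))\<^sup>2"
      unfolding \<Delta>_def by (rule U_remainder[OF X_C[OF \<omega>] Y_C[OF \<omega>]])
    with ln_remainder[OF \<omega>]
    show "\<bar>(U (Y \<omega>) - U (X \<omega>) - dU (X \<omega>) \<bullet> \<Delta> \<omega>) + (ln (b \<omega>) - ln (a \<omega>) - lin \<omega> / a \<omega>)\<bar>
        \<le> K * (norm (\<Delta> \<omega>))\<^sup>2 + c * (2 * (norm (\<Delta> \<omega>))\<^sup>2 + 2 * S)" by linarith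
  qed (use int_E[OF Y \<nu>, folded b_def] int_E[OF X \<rho>, folded a_def] int_dU int_lin int_\<Delta>2 in auto)
  also have "\<dots> = \<kappa> * S"
    using int_\<Delta>2 by (simp add: \<kappa>_def c_def L_def prob_space flip: S_def) (simp add: algebra_simps)
  finally show ?thesis
    by (simp add: \<rho>_def \<nu>_def S_def \<Delta>_def)
qed

end

section \<open>First variation\<close>

context reg_energy_domain
begin

text \<open>Fubini and the symmetry of the kernel let the convolution pass from the weighted \<rho>
  to \<mu>.\<close>

lemma integral_weighted_conv:
  assumes \<rho>: "\<rho> \<in> P2 C" and \<mu>: "\<mu> \<in> P2 C"
    and w: "w \<in> borel_measurable \<rho>" "\<And>z. z \<in> C \<Longrightarrow> \<bar>w z\<bar> \<le> W"
  shows "(\<integral>x. weighted_conv \<epsilon> \<rho> w x \<partial>\<mu>) = (\<integral>z. w z * gauss_conv \<epsilon> \<mu> z \<partial>\<rho>)"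
proof -
  note \<rho>' = P2_D[OF \<rho>] and \<mu>' = P2_D[OF \<mu>]
  interpret \<rho>: prob_space \<rho> by (rule \<rho>')
  interpret \<mu>: prob_space \<mu> by (rule \<mu>')
  interpret pair_prob_space \<mu> \<rho> ..
  note [measurable] = w(1) measurable_ident_borel_on[OF \<rho>'(2)] measurable_ident_borel_on[OF \<mu>'(2)]
  let ?f = "\<lambda>x z. w z * gauss_kernel \<epsilon> (x - z)"
  have "integrable (\<mu> \<Otimes>\<^sub>M \<rho>) (\<lambda>(x, z). ?f x z)"
  proof (rule P.integrable_bounded_on_space[where B=W])
    fix p assume "p \<in> space (\<mu> \<Otimes>\<^sub>M \<rho>)"
    then have p: "snd p \<in> C"
      by (auto simp: space_pair_measure \<rho>'(3))
    have "\<bar>w (snd p)\<bar> * \<bar>gauss_kernel \<epsilon> (fst p - snd p)\<bar> \<le> W * 1"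
      using w(2)[OF p] gauss_kernel_pos[of \<epsilon> "fst p - snd p"] gauss_kernel_le_1[OF \<epsilon>, of "fst p - snd p"]
      by (intro mult_mono) auto
    then show "norm (case p of (x, z) \<Rightarrow> ?f x z) \<le> W"
      by (simp add: case_prod_beta abs_mult)
  qed measurable
  then have "(\<integral>x. (\<integral>z. ?f x z \<partial>\<rho>) \<partial>\<mu>) = (\<integral>z. (\<integral>x. ?f x z \<partial>\<mu>) \<partial>\<rho>)"
    by (rule Fubini_integral[symmetric])
  then show ?thesis
    by (simp add: weighted_conv_def gauss_conv_def gauss_kernel_minus_commute)
qed

lemma variation_measurable:
  assumes \<rho>: "\<rho> \<in> P2 C"
  shows "reg_energy_variation U \<epsilon> \<rho> \<in> borel_measurable (borel_on C)"
proof (rule borel_measurable_continuous_on_restrict)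
  show "continuous_on C (reg_energy_variation U \<epsilon> \<rho>)"
    unfolding continuous_on_eq_continuous_within
    using energy_field_is_gradient[OF \<rho>] unfolding is_gradient_on_def
    by (intro ballI has_derivative_continuous) (rule bspec)
qed

text \<open>Integrated against \<mu>, the integral term becomes the \<rho>-mean of a ratio of
  convolutions, the form in which the derivative of the logarithm appears along a mixture.\<close>

lemma integral_variation:
  assumes \<rho>: "\<rho> \<in> P2 C" and \<mu>: "\<mu> \<in> P2 C"
  shows "integrable \<mu> (reg_energy_variation U \<epsilon> \<rho>)"
    and "(\<integral>x. reg_energy_variation U \<epsilon> \<rho> x \<partial>\<mu>) = (\<integral>x. U x + ln (gauss_conv \<epsilon> \<rho> x) \<partial>\<mu>)
      + (\<integral>z. gauss_conv \<epsilon> \<mu> z / gauss_conv \<epsilon> \<rho> z \<partial>\<rho>)"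
proof -
  note \<rho>' = P2_D[OF \<rho>] and \<mu>' = P2_D[OF \<mu>]
  let ?w = "\<lambda>z. 1 / gauss_conv \<epsilon> \<rho> z"
  note w = recip_gauss_conv[OF \<rho> \<rho>'(2)]
  have "continuous_on C (weighted_conv \<epsilon> \<rho> ?w)"
    using w by (rule continuous_on_weighted_conv[OF \<rho>'(1,2) \<epsilon>])
  then have "weighted_conv \<epsilon> \<rho> ?w \<in> borel_measurable (borel_on C)"
    by (rule borel_measurable_continuous_on_restrict)
  moreover have "norm (weighted_conv \<epsilon> \<rho> ?w x) \<le> 1 / m" for x
  proof -
    interpret prob_space \<rho> by (rule \<rho>')
    have int: "integrable \<rho> (\<lambda>z. ?w z * gauss_kernel \<epsilon> (x - z))"
      using w by (rule weighted_conv_integrable[OF \<rho>'(1,2) \<epsilon>])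
    have "norm (weighted_conv \<epsilon> \<rho> ?w x) \<le> (\<integral>z. norm (?w z * gauss_kernel \<epsilon> (x - z)) \<partial>\<rho>)"
      unfolding weighted_conv_def by (rule integral_norm_bound)
    also have "\<dots> \<le> 1 / m"
    proof (rule integral_le_const[OF integrable_norm[OF int]], rule AE_I2)
      fix z assume "z \<in> space \<rho>"
      then have "\<bar>?w z\<bar> * \<bar>gauss_kernel \<epsilon> (x - z)\<bar> \<le> 1 / m * 1"
        using w(2)[of z] gauss_kernel_pos[of \<epsilon> "x - z"] gauss_kernel_le_1[OF \<epsilon>, of "x - z"]
        by (intro mult_mono) (use m_pos in \<open>auto simp: \<rho>'(3)\<close>)
      then show "norm (?w z * gauss_kernel \<epsilon> (x - z)) \<le> 1 / m"
        by (simp only: real_norm_def abs_mult mult_1_right)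
    qed
    finally show ?thesis .
  qed
  ultimately have int_w: "integrable \<mu> (weighted_conv \<epsilon> \<rho> ?w)"
    by (intro bounded_integrable[OF \<mu>'(1,2)])
  have eq: "reg_energy_variation U \<epsilon> \<rho> = (\<lambda>x. (U x + ln (gauss_conv \<epsilon> \<rho> x)) + weighted_conv \<epsilon> \<rho> ?w x)"
    by (auto simp: reg_energy_variation_def weighted_conv_def)
  show "integrable \<mu> (reg_energy_variation U \<epsilon> \<rho>)"
    unfolding eq using int_w energy_integrable(3)[OF \<rho> \<mu>] by (rule Bochner_Integration.integrable_add[rotated])
  have "(\<integral>x. weighted_conv \<epsilon> \<rho> ?w x \<partial>\<mu>) = (\<integral>z. gauss_conv \<epsilon> \<mu> z / gauss_conv \<epsilon> \<rho> z \<partial>\<rho>)"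
    using integral_weighted_conv[OF \<rho> \<mu> w] by simp
  then show "(\<integral>x. reg_energy_variation U \<epsilon> \<rho> x \<partial>\<mu>) = (\<integral>x. U x + ln (gauss_conv \<epsilon> \<rho> x) \<partial>\<mu>)
      + (\<integral>z. gauss_conv \<epsilon> \<mu> z / gauss_conv \<epsilon> \<rho> z \<partial>\<rho>)"
    unfolding eq using Bochner_Integration.integral_add[OF energy_integrable(3)[OF \<rho> \<mu>] int_w] by simp
qed

lemma integral_mix_P2:
  assumes "\<rho> \<in> P2 C" "\<nu> \<in> P2 C" "0 \<le> t" "t \<le> 1"
    and "f \<in> borel_measurable (borel_on C)" "\<And>x. x \<in> C \<Longrightarrow> \<bar>f x\<bar> \<le> B"
  shows "(\<integral>x. f x \<partial>mix t \<rho> \<nu>) = (1 - t) * (\<integral>x. f x \<partial>\<rho>) + t * (\<integral>x. f x \<partial>\<nu>)"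
  using assms P2_D[OF assms(1)] P2_D[OF assms(2)]
  by (intro integral_mix(1)) (auto simp: measurable_cong_sets[OF P2_D(2)[OF assms(1)] refl])

lemma mix_P2:
  assumes "\<rho> \<in> P2 C" "\<nu> \<in> P2 C" "0 \<le> t" "t \<le> 1"
  shows "mix t \<rho> \<nu> \<in> P2 C"
proof (rule P2_I)
  have s: "sets \<nu> = sets \<rho>"
    using P2_D(2)[OF assms(1)] P2_D(2)[OF assms(2)] by simp
  note * = P2_D(1)[OF assms(1)] P2_D(1)[OF assms(2)] s assms(3,4) borel_measurable_const[of 0]
  show "prob_space (mix t \<rho> \<nu>)"
    by (rule integral_mix(2)[OF *, of 0]) simp
  show "sets (mix t \<rho> \<nu>) = sets (borel_on C)"
    using integral_mix(3)[OF *, of 0] P2_D(2)[OF assms(1)] by simp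
qed

text \<open>Along a mixture the convolution is affine in \<open>t\<close>. The constant 5 is 1 + 2 +
  2: one \<open>t\<^sup>2 / m\<^sup>2\<close> for linearising \<open>ln\<close> under \<rho>, and
  two for each of the products of \<open>t\<close> with the integrals of \<open>q\<close> under
  \<rho> and \<nu>.\<close>

lemma energy_mix_expansion:
  assumes \<rho>: "\<rho> \<in> P2 C" and \<nu>: "\<nu> \<in> P2 C" and t: "0 \<le> t" "t \<le> 1"
  shows "\<bar>energy (mix t \<rho> \<nu>) - energy \<rho>
      - t * ((\<integral>x. reg_energy_variation U \<epsilon> \<rho> x \<partial>\<nu>) - (\<integral>x. reg_energy_variation U \<epsilon> \<rho> x \<partial>\<rho>))\<bar>
    \<le> 5 * t\<^sup>2 / m\<^sup>2"
proof -
  note \<rho>' = P2_D[OF \<rho>] and \<nu>' = P2_D[OF \<nu>]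
  interpret \<rho>: prob_space \<rho> by (rule \<rho>')
  interpret \<nu>: prob_space \<nu> by (rule \<nu>')
  let ?\<mu> = "mix t \<rho> \<nu>"
  have \<mu>: "?\<mu> \<in> P2 C"
    by (rule mix_P2[OF \<rho> \<nu> t])
  define g where "g = gauss_conv \<epsilon> \<rho>"
  define k where "k = gauss_conv \<epsilon> \<nu>"
  define gt where "gt = gauss_conv \<epsilon> ?\<mu>"
  have bd: "m \<le> g x" "g x \<le> 1" "m \<le> k x" "k x \<le> 1" "m \<le> gt x" if "x \<in> C" for x
    using gauss_conv_bounds[OF \<rho> that] gauss_conv_bounds[OF \<nu> that] gauss_conv_bounds[OF \<mu> that]
    by (auto simp: g_def k_def gt_def)
  have gt: "gt x = g x + t * (k x - g x)" for x
  proof -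
    have "gt x = (1 - t) * g x + t * k x"
      unfolding gt_def g_def k_def gauss_conv_def
    proof (rule integral_mix_P2[OF \<rho> \<nu> t])
      show "(\<lambda>z. gauss_kernel \<epsilon> (x - z)) \<in> borel_measurable (borel_on C)"
        by (rule measurable_restrict_space1) measurable
      show "\<bar>gauss_kernel \<epsilon> (x - z)\<bar> \<le> 1" for z
        using gauss_kernel_pos[of \<epsilon> "x - z"] gauss_kernel_le_1[OF \<epsilon>, of "x - z"] by simp
    qed
    then show ?thesis by (simp add: algebra_simps)
  qed
  define h where "h x = (k x - g x) / g x" for x
  define q where "q x = ln (gt x) - ln (g x)" for x
  have h_bd: "\<bar>h x\<bar> \<le> 1 / m" if "x \<in> C" for x
  proof -
    have "\<bar>k x - g x\<bar> \<le> 1"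
      using bd[OF that] m_pos by linarith
    then have "\<bar>k x - g x\<bar> / g x \<le> 1 / m"
      using bd[OF that] m_pos by (intro frac_le) auto
    then show ?thesis
      using bd[OF that] m_pos by (simp add: h_def)
  qed
  have q_bd: "\<bar>q x - t * h x\<bar> \<le> t\<^sup>2 / m\<^sup>2" if "x \<in> C" for x
  proof -
    have "\<bar>q x - t * h x\<bar> \<le> (gt x - g x)\<^sup>2 / m\<^sup>2"
      using abs_ln_remainder[OF m_pos bd(1)[OF that] bd(5)[OF that]] by (simp add: q_def h_def gt)
    also have "\<dots> \<le> t\<^sup>2 / m\<^sup>2"
    proof (rule divide_right_mono)
      have "(k x - g x)\<^sup>2 \<le> 1\<^sup>2"
        using bd[OF that] m_pos by (intro power2_le_iff_abs_le[THEN iffD2]) auto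
      then show "(gt x - g x)\<^sup>2 \<le> t\<^sup>2"
        by (simp add: gt power_mult_distrib mult_left_le)
    qed simp
    finally show ?thesis .
  qed
  \<comment> \<open>\<open>m \<le> 1\<close> and \<open>t \<le> 1\<close> bring the linear and the
    quadratic term under the common bound \<open>t / m\<^sup>2\<close>.\<close>
  have q_bd': "\<bar>q x\<bar> \<le> 2 * t / m\<^sup>2" if "x \<in> C" for x
  proof -
    have "\<bar>q x\<bar> \<le> t * \<bar>h x\<bar> + t\<^sup>2 / m\<^sup>2"
      using q_bd[OF that] abs_triangle_ineq[of "q x - t * h x" "t * h x"] t
      by (simp add: abs_mult)
    also have "t * \<bar>h x\<bar> \<le> t * (1 / m)"
      by (rule mult_left_mono[OF h_bd[OF that] t(1)])
    also have "t * (1 / m) \<le> t / m\<^sup>2"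
      using m_pos m_le_1 t(1) by (auto simp: power2_eq_square intro!: divide_left_mono mult_left_le)
    also have "t\<^sup>2 / m\<^sup>2 \<le> t / m\<^sup>2"
      using t by (intro divide_right_mono) (auto simp: power2_eq_square mult_left_le)
    finally show ?thesis by simp
  qed
  have meas: "gauss_conv \<epsilon> \<sigma> \<in> borel_measurable (borel_on C)" if "\<sigma> \<in> P2 C" for \<sigma>
    by (rule measurable_restrict_space1[OF gauss_conv_measurable[OF that]])
  have [measurable]: "g \<in> borel_measurable (borel_on C)" "k \<in> borel_measurable (borel_on C)"
      "gt \<in> borel_measurable (borel_on C)"
    unfolding g_def k_def gt_def by (rule meas, fact)+
  have h_m: "h \<in> borel_measurable (borel_on C)" and q_m: "q \<in> borel_measurable (borel_on C)"
    unfolding h_def q_def by measurable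
  have int_h: "integrable \<rho> h"
    by (rule bounded_integrable[OF \<rho>'(1,2) h_m]) (use h_bd in auto)
  have int_q: "integrable \<sigma> q" if "\<sigma> \<in> P2 C" for \<sigma>
    by (rule bounded_integrable[OF P2_D(1,2)[OF that] q_m]) (use q_bd' in auto)
  have int_E: "integrable \<sigma> (\<lambda>x. U x + ln (g x))" if "\<sigma> \<in> P2 C" for \<sigma>
    unfolding g_def by (rule energy_integrable[OF \<rho> that])
  have E: "(\<integral>x. U x + ln (gt x) \<partial>\<sigma>) = (\<integral>x. U x + ln (g x) \<partial>\<sigma>) + (\<integral>x. q x \<partial>\<sigma>)" if "\<sigma> \<in> P2 C" for \<sigma>
    using Bochner_Integration.integral_add[OF int_E[OF that] int_q[OF that]] by (simp add: q_def[abs_def])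
  have "energy ?\<mu> = (1 - t) * (\<integral>x. U x + ln (gt x) \<partial>\<rho>) + t * (\<integral>x. U x + ln (gt x) \<partial>\<nu>)"
  proof -
    obtain B where B: "\<And>x. x \<in> C \<Longrightarrow> \<bar>U x\<bar> \<le> B"
      using U_bounded by blast
    have meas: "(\<lambda>x. U x + ln (gt x)) \<in> borel_measurable (borel_on C)"
      using U_measurable by measurable
    have "\<bar>U x + ln (gt x)\<bar> \<le> B + - ln m" if "x \<in> C" for x
      using B[OF that] ln_gauss_conv_bound[OF \<mu> that] unfolding gt_def by linarith
    then show ?thesis
      unfolding energy_def gt_def[symmetric] by (rule integral_mix_P2[OF \<rho> \<nu> t meas])
  qed
  moreover have "energy \<rho> = (\<integral>x. U x + ln (g x) \<partial>\<rho>)"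
    by (simp add: energy_def g_def)
  \<comment> \<open>The integral terms of the variation at \<nu> and at \<rho> combine to the mean
    of \<open>h\<close>, the first-order coefficient of the logarithm.\<close>
  moreover have "(\<integral>z. k z / g z \<partial>\<rho>) - (\<integral>z. g z / g z \<partial>\<rho>) = (\<integral>x. h x \<partial>\<rho>)"
  proof -
    have "(\<integral>x. h x \<partial>\<rho>) + (\<integral>z. 1 \<partial>\<rho>) = (\<integral>x. h x + 1 \<partial>\<rho>)"
      using int_h by simp
    also have "\<dots> = (\<integral>z. k z / g z \<partial>\<rho>)"
    proof (rule Bochner_Integration.integral_cong[OF refl])
      fix x assume "x \<in> space \<rho>"
      with bd(1)[of x] m_pos show "h x + 1 = k x / g x"
        by (auto simp: h_def \<rho>'(3) field_simps)
    qed
    moreover have "(\<integral>z. g z / g z \<partial>\<rho>) = (\<integral>z. 1 \<partial>\<rho>)"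
    proof (rule Bochner_Integration.integral_cong[OF refl])
      fix x assume "x \<in> space \<rho>"
      with bd(1)[of x] m_pos show "g x / g x = 1"
        by (auto simp: \<rho>'(3))
    qed
    ultimately show ?thesis by simp
  qed
  ultimately have expansion: "energy ?\<mu> - energy \<rho>
      - t * ((\<integral>x. reg_energy_variation U \<epsilon> \<rho> x \<partial>\<nu>) - (\<integral>x. reg_energy_variation U \<epsilon> \<rho> x \<partial>\<rho>))
      = (\<integral>x. q x \<partial>\<rho>) - t * (\<integral>x. h x \<partial>\<rho>) - t * (\<integral>x. q x \<partial>\<rho>) + t * (\<integral>x. q x \<partial>\<nu>)"
    unfolding integral_variation(2)[OF \<rho> \<rho>] integral_variation(2)[OF \<rho> \<nu>] E[OF \<rho>] E[OF \<nu>]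
      g_def[symmetric] k_def[symmetric] by (simp add: algebra_simps)
  have first: "\<bar>(\<integral>x. q x \<partial>\<rho>) - t * (\<integral>x. h x \<partial>\<rho>)\<bar> \<le> t\<^sup>2 / m\<^sup>2"
  proof -
    have "(\<integral>x. q x \<partial>\<rho>) - t * (\<integral>x. h x \<partial>\<rho>) = (\<integral>x. q x - t * h x \<partial>\<rho>)"
      using int_q[OF \<rho>] int_h by simp
    also have "\<bar>\<dots>\<bar> \<le> (\<integral>x. \<bar>q x - t * h x\<bar> \<partial>\<rho>)"
      by (rule integral_abs_bound)
    also have "\<dots> \<le> t\<^sup>2 / m\<^sup>2"
      using int_q[OF \<rho>] int_h q_bd by (intro \<rho>.integral_le_const) (auto simp: \<rho>'(3))
    finally show ?thesis .
  qed
  have second: "\<bar>t * (\<integral>x. q x \<partial>\<sigma>)\<bar> \<le> 2 * t\<^sup>2 / m\<^sup>2" if \<sigma>: "\<sigma> \<in> P2 C" for \<sigma>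
  proof -
    interpret \<sigma>: prob_space \<sigma> by (rule P2_D[OF \<sigma>])
    have "\<bar>\<integral>x. q x \<partial>\<sigma>\<bar> \<le> (\<integral>x. \<bar>q x\<bar> \<partial>\<sigma>)"
      by (rule integral_abs_bound)
    also have "\<dots> \<le> 2 * t / m\<^sup>2"
      using int_q[OF \<sigma>] q_bd' by (intro \<sigma>.integral_le_const) (auto simp: P2_D[OF \<sigma>])
    finally have "t * \<bar>\<integral>x. q x \<partial>\<sigma>\<bar> \<le> t * (2 * t / m\<^sup>2)"
      using t(1) by (rule mult_left_mono)
    then show ?thesis
      using t(1) by (simp add: abs_mult power2_eq_square mult_ac)
  qed
  have "5 * t\<^sup>2 / m\<^sup>2 = t\<^sup>2 / m\<^sup>2 + 2 * t\<^sup>2 / m\<^sup>2 + 2 * t\<^sup>2 / m\<^sup>2"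
    by (simp add: add_divide_distrib[symmetric])
  with first second[OF \<rho>] second[OF \<nu>] show ?thesis
    unfolding expansion by linarith
qed

lemma variation_is_first_variation:
  assumes \<rho>: "\<rho> \<in> P2 C"
  shows "is_first_variation C (reg_energy U \<epsilon>) \<rho> (\<lambda>x. ereal (reg_energy_variation U \<epsilon> \<rho> x))"
proof -
  let ?V = "reg_energy_variation U \<epsilon> \<rho>"
  have "((\<lambda>t. (reg_energy U \<epsilon> (mix t \<rho> \<nu>) - reg_energy U \<epsilon> \<rho>) / ereal t)
      \<longlongrightarrow> ereal ((\<integral>x. ?V x \<partial>\<nu>) - (\<integral>x. ?V x \<partial>\<rho>))) (at_right 0)" if \<nu>: "\<nu> \<in> P2 C" for \<nu>
  proof -
    let ?L = "(\<integral>x. ?V x \<partial>\<nu>) - (\<integral>x. ?V x \<partial>\<rho>)"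
    have t01: "\<forall>\<^sub>F t in at_right (0::real). 0 < t \<and> t < 1"
      using eventually_at_right_real[of 0 1] by (simp add: eventually_mono)
    have "((\<lambda>t. (energy (mix t \<rho> \<nu>) - energy \<rho>) / t - ?L) \<longlongrightarrow> 0) (at_right 0)"
    proof (rule Lim_null_comparison)
      show "\<forall>\<^sub>F t in at_right 0. norm ((energy (mix t \<rho> \<nu>) - energy \<rho>) / t - ?L) \<le> 5 / m\<^sup>2 * t"
        using t01
      proof eventually_elim
        case (elim t)
        then have "\<bar>energy (mix t \<rho> \<nu>) - energy \<rho> - t * ?L\<bar> / t \<le> (5 * t\<^sup>2 / m\<^sup>2) / t"
          by (intro divide_right_mono energy_mix_expansion \<rho> \<nu>) auto
        moreover have "(energy (mix t \<rho> \<nu>) - energy \<rho>) / t - ?L = (energy (mix t \<rho> \<nu>) - energy \<rho> - t * ?L) / t"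
          using elim by (simp add: diff_divide_distrib)
        ultimately show ?case
          using elim by (simp add: power2_eq_square)
      qed
      have "((\<lambda>t. 5 / m\<^sup>2 * t) \<longlongrightarrow> 5 / m\<^sup>2 * 0) (at_right 0)"
        by (intro tendsto_intros)
      then show "((\<lambda>t. 5 / m\<^sup>2 * t) \<longlongrightarrow> 0) (at_right 0)" by simp
    qed
    then have "((\<lambda>t. (energy (mix t \<rho> \<nu>) - energy \<rho>) / t) \<longlongrightarrow> ?L) (at_right 0)"
      by (rule Lim_null[THEN iffD2])
    then have "((\<lambda>t. ereal ((energy (mix t \<rho> \<nu>) - energy \<rho>) / t)) \<longlongrightarrow> ereal ?L) (at_right 0)"
      by simp
    then show ?thesis
    proof (rule Lim_transform_eventually)
      show "\<forall>\<^sub>F t in at_right 0. ereal ((energy (mix t \<rho> \<nu>) - energy \<rho>) / t)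
          = (reg_energy U \<epsilon> (mix t \<rho> \<nu>) - reg_energy U \<epsilon> \<rho>) / ereal t"
        using t01 by eventually_elim (simp add: reg_energy_eq \<rho> mix_P2[OF \<rho> \<nu>])
    qed
  qed
  then show ?thesis
    using integral_variation(1)[OF \<rho>] \<rho>
    by (auto simp: is_first_variation_def ext_integrable_def reg_energy_eq)
qed

text \<open>Testing against Dirac masses determines a first variation at every point of \<open>C\<close>.\<close>

lemma first_variation_unique:
  assumes \<rho>: "\<rho> \<in> P2 C" and g: "is_first_variation C (reg_energy U \<epsilon>) \<rho> g"
  obtains c where "\<And>x. x \<in> C \<Longrightarrow> g x = ereal (reg_energy_variation U \<epsilon> \<rho> x + c)"
proof -
  let ?V = "reg_energy_variation U \<epsilon> \<rho>"
  \<comment> \<open>Comparing the limits for the two variations at a Dirac mass leaves the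
    difference of their \<rho>-integrals as the additive constant, the same for every
    \<open>x\<close>.\<close>
  have "g x = ereal (?V x + ((\<integral>x. real_of_ereal (g x) \<partial>\<rho>) - (\<integral>x. ?V x \<partial>\<rho>)))" if x: "x \<in> C" for x
  proof -
    let ?d = "return (borel_on C) x"
    have x': "x \<in> space (borel_on C)"
      using x by (simp add: space_restrict_space)
    have d: "?d \<in> P2 C"
      using prob_space_return[OF x'] by (intro P2_I) auto
    then have fin: "reg_energy U \<epsilon> ?d < \<infinity>"
      by (simp add: reg_energy_eq)
    from g d fin have ext: "ext_integrable ?d g"
      and lim: "((\<lambda>t. (reg_energy U \<epsilon> (mix t \<rho> ?d) - reg_energy U \<epsilon> \<rho>) / ereal t) \<longlongrightarrow>
           ereal ((\<integral>x. real_of_ereal (g x) \<partial>?d) - (\<integral>x. real_of_ereal (g x) \<partial>\<rho>))) (at_right 0)"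
      by (auto simp: is_first_variation_def)
    from variation_is_first_variation[OF \<rho>] d fin
    have "((\<lambda>t. (reg_energy U \<epsilon> (mix t \<rho> ?d) - reg_energy U \<epsilon> \<rho>) / ereal t) \<longlongrightarrow>
           ereal ((\<integral>x. ?V x \<partial>?d) - (\<integral>x. ?V x \<partial>\<rho>))) (at_right 0)"
      by (auto simp: is_first_variation_def)
    with lim have "ereal ((\<integral>x. real_of_ereal (g x) \<partial>?d) - (\<integral>x. real_of_ereal (g x) \<partial>\<rho>))
        = ereal ((\<integral>x. ?V x \<partial>?d) - (\<integral>x. ?V x \<partial>\<rho>))"
      by (intro tendsto_unique) auto
    moreover have "(\<integral>x. real_of_ereal (g x) \<partial>?d) = real_of_ereal (g x)"
      using ext x' by (intro integral_return) (auto simp: ext_integrable_def dest: borel_measurable_integrable)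
    moreover have "(\<integral>x. ?V x \<partial>?d) = ?V x"
      using variation_measurable[OF \<rho>] x' by (intro integral_return)
    \<comment> \<open>What holds almost everywhere for the Dirac mass at \<open>x\<close> holds at
      \<open>x\<close>, since no null set contains that point.\<close>
    moreover have "\<bar>g x\<bar> \<noteq> \<infinity>"
    proof -
      from ext obtain N where N: "{y \<in> space ?d. \<not> \<bar>g y\<bar> \<noteq> \<infinity>} \<subseteq> N" "emeasure ?d N = 0" "N \<in> sets ?d"
        unfolding ext_integrable_def by (auto elim: AE_E)
      then have "x \<notin> N" by (auto simp: indicator_def split: if_splits)
      with N(1) x' show ?thesis by auto
    qed
    ultimately show ?thesis
      by (cases "g x") auto
  qed
  with that show ?thesis by blast
qed

lemma first_variation_gradient:
  assumes \<rho>: "\<rho> \<in> P2 C" and g: "is_first_variation C (reg_energy U \<epsilon>) \<rho> g"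
  shows "\<forall>x\<in>C. \<bar>g x\<bar> \<noteq> \<infinity>" "is_gradient_on C (\<lambda>x. real_of_ereal (g x)) (\<xi> \<rho>)"
proof -
  obtain c where c: "\<And>x. x \<in> C \<Longrightarrow> g x = ereal (reg_energy_variation U \<epsilon> \<rho> x + c)"
    using first_variation_unique[OF \<rho> g] by blast
  then show "\<forall>x\<in>C. \<bar>g x\<bar> \<noteq> \<infinity>" by simp
  show "is_gradient_on C (\<lambda>x. real_of_ereal (g x)) (\<xi> \<rho>)"
    unfolding is_gradient_on_def
  proof
    fix x assume x: "x \<in> C"
    have "((\<lambda>x. reg_energy_variation U \<epsilon> \<rho> x + c) has_derivative (\<lambda>h. \<xi> \<rho> x \<bullet> h)) (at x within C)"
      using energy_field_is_gradient[OF \<rho>] x by (auto simp: is_gradient_on_def intro!: derivative_eq_intros)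
    then show "((\<lambda>x. real_of_ereal (g x)) has_derivative (\<lambda>h. \<xi> \<rho> x \<bullet> h)) (at x within C)"
      by (rule has_derivative_transform[OF x, rotated]) (simp add: c)
  qed
qed

section \<open>From quadratic remainders to the two notions of differentiability\<close>

lemma \<kappa>_nonneg: "0 \<le> \<kappa>"
  using \<epsilon> m_pos K_nonneg by (simp add: \<kappa>_def)

text \<open>With \<open>\<kappa> + 1\<close> in the denominator, nonnegativity of
  \<open>\<kappa>\<close> is enough for a well-defined positive radius.\<close>

lemma quadratic_le_linear:
  assumes "0 < e" "0 \<le> d" "d < e / (\<kappa> + 1)"
  shows "\<kappa> * d\<^sup>2 \<le> e * d"
proof -
  have "d * (\<kappa> + 1) < e"
    using assms \<kappa>_nonneg by (simp add: pos_less_divide_eq)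
  then have "\<kappa> * d \<le> e"
    using assms(2) by (simp add: algebra_simps)
  then show ?thesis
    using mult_right_mono[OF _ assms(2), of "\<kappa> * d" e] by (simp add: power2_eq_square mult.assoc)
qed

lemma energy_field_L2:
  assumes \<rho>: "\<rho> \<in> P2 C" and "prob_space M" and X: "X \<in> M \<rightarrow>\<^sub>M borel_on C"
  shows "(\<lambda>z. \<xi> \<rho> (X z)) \<in> L2_space M UNIV"
proof -
  interpret prob_space M by fact
  obtain B where B: "\<And>x. x \<in> C \<Longrightarrow> norm (\<xi> \<rho> x) \<le> B"
    using energy_field_bounded[OF \<rho>] by blast
  have m: "(\<lambda>z. \<xi> \<rho> (X z)) \<in> borel_measurable M"
    by (rule measurable_compose[OF X energy_field_measurable[OF \<rho>]])
  have "norm ((norm (\<xi> \<rho> (X z)))\<^sup>2) \<le> B\<^sup>2" if "z \<in> space M" for z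
    using power_mono[OF B norm_ge_zero, of "X z" 2] measurable_space[OF X that]
    by (simp add: space_restrict_space)
  with m show ?thesis
    by (auto simp: L2_space_def measurable_restrict_space2_iff intro!: integrable_bounded_on_space)
qed

lemma energy_field_wasserstein_gradient:
  assumes \<rho>: "\<rho> \<in> P2 C"
  shows "\<xi> \<rho> \<in> wasserstein_gradients C (reg_energy U \<epsilon>) \<rho>"
proof -
  note \<rho>' = P2_D[OF \<rho>]
  \<comment> \<open>Any optimal plan will do, since the bound in \<open>est\<close> depends on the
    plan only through its cost. The choice fixes one plan for each \<nu> before \<open>e\<close> is
    given, as \<open>wasserstein_gradients\<close> demands.\<close>
  define plan where "plan \<nu> = (SOME \<pi>. \<pi> \<in> optimal_plans C \<rho> \<nu>)" for \<nu>
  have plan: "plan \<nu> \<in> optimal_plans C \<rho> \<nu>" if "\<nu> \<in> P2 C" for \<nu>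
    unfolding plan_def using optimal_plans_nonempty[OF bounded borel \<rho> that] by (simp add: some_in_eq)
  have est: "\<bar>energy \<nu> - energy \<rho> - (\<integral>p. \<xi> \<rho> (fst p) \<bullet> (snd p - fst p) \<partial>plan \<nu>)\<bar> \<le> \<kappa> * (W2 C \<rho> \<nu>)\<^sup>2"
    if \<nu>: "\<nu> \<in> P2 C" for \<nu>
  proof -
    have "plan \<nu> \<in> couplings C \<rho> \<nu>"
      using plan[OF \<nu>] by (simp add: optimal_plans_def)
    note \<pi> = couplingsD[OF this \<rho>'(1)]
    show ?thesis
      unfolding W2_optimal_plan(1)[OF bounded \<rho>'(1) plan[OF \<nu>]]
      using energy_expansion[OF \<pi>(1-3), unfolded \<pi>(5,6)] by (simp add: norm_minus_commute)
  qed
  have "\<xi> \<rho> \<in> L2_space \<rho> UNIV"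
    using energy_field_L2[OF \<rho> \<rho>'(1), of "\<lambda>x. x"] by (simp add: measurable_ident_sets \<rho>'(2))
  moreover have "\<exists>\<delta>>0. \<forall>\<nu>\<in>P2 C. reg_energy U \<epsilon> \<nu> < \<infinity> \<and> W2 C \<rho> \<nu> < \<delta> \<longrightarrow>
      \<bar>reg_energy U \<epsilon> \<nu> - reg_energy U \<epsilon> \<rho> - ereal (\<integral>p. \<xi> \<rho> (fst p) \<bullet> (snd p - fst p) \<partial>plan \<nu>)\<bar>
        \<le> ereal (e * W2 C \<rho> \<nu>)" if "e > 0" for e
  proof (intro exI[of _ "e / (\<kappa> + 1)"] conjI ballI impI)
    show "0 < e / (\<kappa> + 1)"
      using \<kappa>_nonneg that by simp
    fix \<nu> assume \<nu>: "\<nu> \<in> P2 C" and "reg_energy U \<epsilon> \<nu> < \<infinity> \<and> W2 C \<rho> \<nu> < e / (\<kappa> + 1)"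
    then show "\<bar>reg_energy U \<epsilon> \<nu> - reg_energy U \<epsilon> \<rho>
        - ereal (\<integral>p. \<xi> \<rho> (fst p) \<bullet> (snd p - fst p) \<partial>plan \<nu>)\<bar> \<le> ereal (e * W2 C \<rho> \<nu>)"
      using order_trans[OF est[OF \<nu>] quadratic_le_linear[OF that]]
        W2_optimal_plan(2)[OF bounded \<rho>'(1) plan[OF \<nu>]]
      by (simp add: reg_energy_eq \<rho> \<nu>)
  qed
  ultimately show ?thesis
    unfolding wasserstein_gradients_def using plan by (auto simp: reg_energy_eq \<rho>)
qed

lemma energy_field_frechet_derivative:
  assumes M: "prob_space M" and X: "X \<in> L2_space M C" and \<rho>: "\<rho> \<in> P2 C" "distr M (borel_on C) X = \<rho>"
  shows "has_frechet_derivative_L2 C M (lift C M (reg_energy U \<epsilon>)) (\<lambda>z. \<xi> \<rho> (X z)) X"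
proof -
  have X_m: "X \<in> M \<rightarrow>\<^sub>M borel_on C"
    using X by (simp add: L2_space_def)
  have lift: "lift C M (reg_energy U \<epsilon>) Y = ereal (energy (distr M (borel_on C) Y))"
    if "Y \<in> M \<rightarrow>\<^sub>M borel_on C" for Y
    unfolding lift_def by (rule reg_energy_eq[OF law_in_P2[OF M that]])
  have "\<exists>\<delta>>0. \<forall>Y\<in>L2_space M C. L2_dist M Y X < \<delta> \<longrightarrow>
      \<bar>lift C M (reg_energy U \<epsilon>) Y - lift C M (reg_energy U \<epsilon>) X
        - ereal (\<integral>z. \<xi> \<rho> (X z) \<bullet> (Y z - X z) \<partial>M)\<bar> \<le> ereal (e * L2_dist M Y X)" if "e > 0" for e
  proof (intro exI[of _ "e / (\<kappa> + 1)"] conjI ballI impI)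
    show "0 < e / (\<kappa> + 1)"
      using \<kappa>_nonneg that by simp
    fix Y assume "Y \<in> L2_space M C" and d: "L2_dist M Y X < e / (\<kappa> + 1)"
    then have Y: "Y \<in> M \<rightarrow>\<^sub>M borel_on C"
      by (simp add: L2_space_def)
    have "(L2_dist M Y X)\<^sup>2 = (\<integral>z. (norm (Y z - X z))\<^sup>2 \<partial>M)" "0 \<le> L2_dist M Y X"
      by (auto simp: L2_dist_def)
    then show "\<bar>lift C M (reg_energy U \<epsilon>) Y - lift C M (reg_energy U \<epsilon>) X
        - ereal (\<integral>z. \<xi> \<rho> (X z) \<bullet> (Y z - X z) \<partial>M)\<bar> \<le> ereal (e * L2_dist M Y X)"
      using energy_expansion[OF M X_m Y] quadratic_le_linear[OF that _ d]
      by (simp add: lift X_m Y \<rho>)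
  qed
  then show ?thesis
    unfolding has_frechet_derivative_L2_def using X energy_field_L2[OF \<rho>(1) M X_m] lift[OF X_m] by auto
qed

end

theorem theorem4p3:
  fixes C :: "'a::euclidean_space set"
    and U rho_star :: "'a \<Rightarrow> real" and grad_U :: "'a \<Rightarrow> 'a"
    and x0 :: 'a and \<epsilon> C0 C1 C2 :: real
    and M :: "'b::polish_space measure"
  assumes "bounded C" and "convex C" and "C \<in> sets borel"
    and "C1_boundary C" and "interior C \<noteq> {}"
    and "\<epsilon> > 0"
    and "\<And>x. x \<in> C \<Longrightarrow> rho_star x = exp (- U x)"
    and "is_gradient_on C U grad_U"
    and "C1 > 0" and "C1-lipschitz_on C grad_U"
    and "x0 \<in> C" and "C0 > 0" and "C2 > 0"
    and "\<bar>U x0\<bar> \<le> C0" and "norm (grad_U x0) \<le> C2"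
    and "prob_space M" and "sets M = sets borel" and "atomless M"
  shows "\<forall>\<rho>\<in>P2 C.
      L_differentiable C M (reg_energy U \<epsilon>) \<rho> \<and>
      wasserstein_differentiable C (reg_energy U \<epsilon>) \<rho> \<and>
      is_first_variation C (reg_energy U \<epsilon>) \<rho> (\<lambda>x. ereal (reg_energy_variation U \<epsilon> \<rho> x)) \<and>
      (\<exists>\<xi>. is_gradient_on C (reg_energy_variation U \<epsilon> \<rho>) \<xi> \<and>
           (\<forall>g. is_first_variation C (reg_energy U \<epsilon>) \<rho> g \<longrightarrow>
              (\<forall>x\<in>C. \<bar>g x\<bar> \<noteq> \<infinity>) \<and> is_gradient_on C (\<lambda>x. real_of_ereal (g x)) \<xi>) \<and>
           \<xi> \<in> wasserstein_gradients C (reg_energy U \<epsilon>) \<rho> \<and>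
           is_L_derivative C M (reg_energy U \<epsilon>) \<rho> \<xi>)"
proof
  fix \<rho> assume \<rho>: "\<rho> \<in> P2 C"
  interpret reg_energy_domain C U grad_U \<epsilon> C1
    using assms by unfold_locales auto
  note M = \<open>prob_space M\<close> \<open>sets M = sets borel\<close> \<open>atomless M\<close>
  \<comment> \<open>The quantifier over representatives in \<open>is_L_derivative\<close> has
    content only if some map has law \<rho>; this witness supplies the existential half.\<close>
  obtain X where X: "X \<in> L2_space M C" "distr M (borel_on C) X = \<rho>"
    using atomless_law_exists[OF M \<open>bounded C\<close> \<open>C \<in> sets borel\<close> \<rho>] .
  have L: "L_differentiable C M (reg_energy U \<epsilon>) \<rho>"
    unfolding L_differentiable_def using X energy_field_frechet_derivative[OF M(1) X(1) \<rho> X(2)] by blast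
  have W: "\<xi> \<rho> \<in> wasserstein_gradients C (reg_energy U \<epsilon>) \<rho>"
    by (rule energy_field_wasserstein_gradient[OF \<rho>])
  have "is_L_derivative C M (reg_energy U \<epsilon>) \<rho> (\<xi> \<rho>)"
    unfolding is_L_derivative_def
    using L energy_field_measurable[OF \<rho>] energy_field_frechet_derivative[OF M(1) _ \<rho>] by blast
  with L W show "L_differentiable C M (reg_energy U \<epsilon>) \<rho> \<and>
      wasserstein_differentiable C (reg_energy U \<epsilon>) \<rho> \<and>
      is_first_variation C (reg_energy U \<epsilon>) \<rho> (\<lambda>x. ereal (reg_energy_variation U \<epsilon> \<rho> x)) \<and>
      (\<exists>\<xi>. is_gradient_on C (reg_energy_variation U \<epsilon> \<rho>) \<xi> \<and>
           (\<forall>g. is_first_variation C (reg_energy U \<epsilon>) \<rho> g \<longrightarrow>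
              (\<forall>x\<in>C. \<bar>g x\<bar> \<noteq> \<infinity>) \<and> is_gradient_on C (\<lambda>x. real_of_ereal (g x)) \<xi>) \<and>
           \<xi> \<in> wasserstein_gradients C (reg_energy U \<epsilon>) \<rho> \<and>
           is_L_derivative C M (reg_energy U \<epsilon>) \<rho> \<xi>)"
    using variation_is_first_variation[OF \<rho>] energy_field_is_gradient[OF \<rho>]
    by (intro conjI exI[of _ "\<xi> \<rho>"] allI impI first_variation_gradient[OF \<rho>])
       (auto simp: wasserstein_differentiable_def)
qed

end
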